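(* Let $k$ be a field, let $n\ge 1$, $b_1,\dots,b_n\ge 1$ and $1\le t\le n$ be integers, and let $I_t(\mathbf D)$ be the ideal of $S=k[y_{i,j}:1\le i\le n,\ 1\le j\le b_i]$ generated by the $t$-minors of the matrix $\mathbf D=\mathbf D(b_1,\dots,b_n)$. Then for every $q\ge 0$, $$\beta_q(I_t(\mathbf D))=\sum_{s=t}^{\min\{t+q,n\}}\binom{s-1}{t-1}\ \sum_{1\le i_1<\cdots<i_s\le n}\ \ \sum_{\substack{r_1+\cdots+r_s=t+q\\ r_1,\dots,r_s\ge 1}}\binom{b_{i_1}}{r_1}\cdots\binom{b_{i_s}}{r_s}.$$ For the case $b_1=\cdots=b_n=b$, $$\beta_q(I_t(\mathbf D))=\sum_{s=t}^{t+q}\binom{s-1}{t-1}\binom{n}{s}\ \sum_{\substack{r_1+\cdots+r_s=t+q\\ r_1,\dots,r_s\ge 1}}\binom{b}{r_1}\cdots\binom{b}{r_s}.$$ For $b_1=\cdots=b_n=2$, $$\beta_q(I_t(\mathbf D))=\sum_{s=t}^{t+q}\binom{s-1}{t-1}\binom{n}{s}\binom{s}{t+q-s}2^{2s-t-q}.$$ Here the conventions $\binom{\alpha}{\beta}=0$ for $\alpha<\beta$ and $\binom{\alpha}{0}=1$ for $\alpha\ge 0$ are adopted.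
   Context: The matrix $\mathbf D=\mathbf D(b_1,\dots,b_n)$ is the $n\times(b_1+\cdots+b_n)$ matrix over $S$ whose $i$-th row is zero except in the $i$-th block of $b_i$ consecutive columns (columns $b_1+\cdots+b_{i-1}+1,\dots,b_1+\cdots+b_i$), where its entries are $y_{i,1},\dots,y_{i,b_i}$. Thus $I_t(\mathbf D)$ is the square-free monomial ideal generated by all products $y_{i_1,j_1}\cdots y_{i_t,j_t}$ with $1\le i_1<\cdots<i_t\le n$ and $1\le j_u\le b_{i_u}$ (a "transversal monomial ideal"). For a homogeneous ideal $I$ of a polynomial ring, $\beta_q(I)$ denotes the (total) $q$-th Betti number of $I$ as a module, i.e. the rank of the $q$-th free module in the minimal graded free resolution of $I$ (so $\beta_0(I)$ is the minimal number of generators of $I$). *)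

theory Defs
  imports "HOL-Library.Poly_Mapping" "HOL-Algebra.Ideal"
    "Jordan_Normal_Form.Determinant" "Jordan_Normal_Form.DL_Submatrix"
begin

section \<open>Polynomial rings\<close>

text \<open>A polynomial is a finitely supported function from power products
  (themselves finitely supported exponent functions) to coefficients; multiplication on the
  type \<open>\<Rightarrow>\<^sub>0\<close> is convolution. The indeterminates that may occur are cut out by a set \<open>V\<close>,
  so that \<open>k[V]\<close> is a subring of a type that does not depend on \<open>V\<close>.\<close>

type_synonym ('v, 'k) mpol = "('v \<Rightarrow>\<^sub>0 nat) \<Rightarrow>\<^sub>0 'k"

definition indet :: "'v \<Rightarrow> ('v, 'k::field) mpol" where
  "indet v = Poly_Mapping.single (Poly_Mapping.single v 1) 1"

definition pring :: "'v set \<Rightarrow> ('v, 'k::field) mpol ring" where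
  "pring V =
    \<lparr>carrier = {p. \<forall>m\<in>Poly_Mapping.keys p. Poly_Mapping.keys m \<subseteq> V},
     monoid.mult = (*), one = 1, ring.zero = 0, add = (+)\<rparr>"

definition mdeg :: "('v \<Rightarrow>\<^sub>0 nat) \<Rightarrow> nat" where
  "mdeg m = (\<Sum>v\<in>Poly_Mapping.keys m. Poly_Mapping.lookup m v)"

text \<open>As usual, \<open>0\<close> is homogeneous of every degree, and it is the only homogeneous
  polynomial of negative degree.\<close>

definition homogeneous :: "int \<Rightarrow> ('v, 'k::field) mpol \<Rightarrow> bool" where
  "homogeneous d p \<longleftrightarrow> (\<forall>m\<in>Poly_Mapping.keys p. int (mdeg m) = d)"

text \<open>The graded maximal ideal generated by the indeterminates in \<open>V\<close>.\<close>

definition irrelevant_ideal :: "'v set \<Rightarrow> ('v, 'k::field) mpol set" where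
  "irrelevant_ideal V = genideal (pring V) (indet ` V)"


section \<open>Minimal graded free resolutions and Betti numbers\<close>

definition free_mod :: "'v set \<Rightarrow> nat \<Rightarrow> ('v, 'k::field) mpol vec set" where
  "free_mod V r = {v \<in> carrier_vec r. \<forall>i<r. v $ i \<in> carrier (pring V)}"

text \<open>A minimal graded free resolution
  \<open>\<dots> \<rightarrow> F_2 \<rightarrow> F_1 \<rightarrow> F_0 \<rightarrow> I \<rightarrow> 0\<close>, where \<open>F_q\<close> is the direct sum of the \<open>S(- a q c)\<close> for \<open>c < r_q\<close>,
  of the ideal \<open>I\<close>, regarded as a module over \<open>S = k[V]\<close>. Here \<open>rk q\<close> is the rank \<open>r_q\<close>,
  \<open>a q c\<close> is the degree of the \<open>c\<close>-th basis element of \<open>F_q\<close>, the vector \<open>g\<close> consists of the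
  images of the basis of \<open>F_0\<close> in \<open>I\<close>, and \<open>\<phi> q\<close> is the matrix of \<open>F_{q+1} \<rightarrow> F_q\<close>.
  Minimality means that the entries of all \<open>\<phi> q\<close> lie in the graded maximal ideal; no condition
  is put on \<open>g\<close>.\<close>

definition minimal_graded_free_resolution ::
  "'v set \<Rightarrow> ('v, 'k::field) mpol set \<Rightarrow> (nat \<Rightarrow> nat) \<Rightarrow> (nat \<Rightarrow> nat \<Rightarrow> int) \<Rightarrow>
    ('v, 'k) mpol vec \<Rightarrow> (nat \<Rightarrow> ('v, 'k) mpol mat) \<Rightarrow> bool" where
  "minimal_graded_free_resolution V I rk a g \<phi> \<longleftrightarrow>
    \<comment> \<open>graded homomorphisms of degree 0 between free modules over \<open>k[V]\<close>\<close>
    g \<in> free_mod V (rk 0) \<and>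
    (\<forall>c<rk 0. homogeneous (a 0 c) (g $ c)) \<and>
    (\<forall>q. \<phi> q \<in> carrier_mat (rk q) (rk (Suc q))) \<and>
    (\<forall>q. \<forall>i<rk q. \<forall>c<rk (Suc q). \<phi> q $$ (i, c) \<in> carrier (pring V) \<and>
       homogeneous (a (Suc q) c - a q i) (\<phi> q $$ (i, c))) \<and>
    \<comment> \<open>exactness at \<open>I\<close>, at \<open>F_0\<close>, and at \<open>F_{q+1}\<close>\<close>
    (\<lambda>v. g \<bullet> v) ` free_mod V (rk 0) = I \<and>
    {v \<in> free_mod V (rk 0). g \<bullet> v = 0} = (\<lambda>w. \<phi> 0 *\<^sub>v w) ` free_mod V (rk 1) \<and>
    (\<forall>q. {v \<in> free_mod V (rk (Suc q)). \<phi> q *\<^sub>v v = 0\<^sub>v (rk q)} =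
         (\<lambda>w. \<phi> (Suc q) *\<^sub>v w) ` free_mod V (rk (Suc (Suc q)))) \<and>
    \<comment> \<open>minimality\<close>
    (\<forall>q. \<forall>i<rk q. \<forall>c<rk (Suc q). \<phi> q $$ (i, c) \<in> irrelevant_ideal V)"

definition betti :: "'v set \<Rightarrow> ('v, 'k::field) mpol set \<Rightarrow> nat \<Rightarrow> nat" where
  "betti V I q =
    (THE r. \<exists>rk a g \<phi>. minimal_graded_free_resolution V I rk a g \<phi> \<and> rk q = r)"


section \<open>The matrix D and its determinantal ideals\<close>

definition yvars :: "nat \<Rightarrow> (nat \<Rightarrow> nat) \<Rightarrow> (nat \<times> nat) set" where
  "yvars n b = {(i, j). 1 \<le> i \<and> i \<le> n \<and> 1 \<le> j \<and> j \<le> b i}"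

text \<open>Rows and columns of matrices are numbered from 0, whereas the indices of the
  indeterminates and of \<open>b\<close> start at 1: matrix row \<open>i\<close> is row \<open>i + 1\<close> in the usual numbering,
  and its block starts at the 0-based column \<open>b 1 + \<dots> + b i\<close>.\<close>

definition Dmat :: "nat \<Rightarrow> (nat \<Rightarrow> nat) \<Rightarrow> (nat \<times> nat, 'k::field) mpol mat" where
  "Dmat n b = mat n (\<Sum>l=1..n. b l) (\<lambda>(i, c).
     let off = (\<Sum>l=1..i. b l) in
     if off \<le> c \<and> c < off + b (i + 1) then indet (i + 1, c - off + 1) else 0)"

definition minors :: "nat \<Rightarrow> 'a::comm_ring_1 mat \<Rightarrow> 'a set" where
  "minors t A = {det (submatrix A R C) | R C.
     R \<subseteq> {..<dim_row A} \<and> C \<subseteq> {..<dim_col A} \<and> card R = t \<and> card C = t}"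

definition It_D :: "nat \<Rightarrow> nat \<Rightarrow> (nat \<Rightarrow> nat) \<Rightarrow> (nat \<times> nat, 'k::field) mpol set" where
  "It_D t n b = genideal (pring (yvars n b)) (minors t (Dmat n b))"


section \<open>Index sets of the sums\<close>

text \<open>The tuples \<open>1 \<le> i\<^sub>1 < \<dots> < i\<^sub>s \<le> n\<close>, and the tuples of \<open>s\<close> positive integers with
  sum \<open>m\<close>, as lists. Both sets are finite.\<close>

definition increasing_tuples :: "nat \<Rightarrow> nat \<Rightarrow> nat list set" where
  "increasing_tuples n s = {xs. length xs = s \<and> sorted_wrt (<) xs \<and> set xs \<subseteq> {1..n}}"

definition compositions :: "nat \<Rightarrow> nat \<Rightarrow> nat list set" where
  "compositions s m = {rs. length rs = s \<and> sum_list rs = m \<and> (\<forall>r\<in>set rs. 1 \<le> r)}"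

end

(* I_t(D) is spanned by the monomials that involve variables from at least t rows. Let x be the last
   variable of the last row, J = I_t of D without x, and K = I_(t-1) of D without its last row. Then
   J is contained in K, x is a nonzerodivisor modulo J, and I_t(D) = J + x K with J and x K
   intersecting in x J. The mapping cone of J(-1) --> J + K(-1) turns linear resolutions of J and K
   into one of I_t(D), whence beta_q(I_t(D)) = beta_q(J) + beta_(q-1)(J) + beta_q(K). The right-hand
   side of the formula is the coefficient of z^(t+q) in the sum over s of binomial(s-1, t-1) times
   the s-th elementary symmetric polynomial in the (1+z)^(b_i) - 1, which obeys the same recursion. *)

theory Submission
  imports Defs "HOL-Computational_Algebra.Polynomial"
begin

section \<open>Polynomials\<close>

text \<open>\<open>betti\<close> is a definite description over all minimal graded free resolutions,
  so exhibiting one is not enough: the ranks of any two must agree. This follows by lifting the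
  identity of the ideal both ways, contracting the difference between the composite and the
  identity, and taking constant terms in all matrices. A mapping cone need not be minimal, since the
  comparison map could contain nonzero constants. Linearity prevents this: the generators of J sit
  one degree above those of K, so beyond the augmentation the lift may be replaced by its part of
  degree 1, and every differential of the cone then consists of linear forms. Hence the induction
  carries linearity, and minimality is read off at the end. The recursion leaves the range of the
  theorem: it reaches t = 0, t > n, no rows at all, and empty blocks.\<close>

lemma carrier_pring: "p \<in> carrier (pring V) \<longleftrightarrow> (\<forall>m\<in>Poly_Mapping.keys p. Poly_Mapping.keys m \<subseteq> V)"
  by (simp add: pring_def)

lemma pring_simps [simp]:
  "monoid.mult (pring V) = (*)" "monoid.one (pring V) = 1" "ring.zero (pring V) = 0" "add (pring V) = (+)"
  by (simp_all add: pring_def)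

lemma keys_plus_nat: "Poly_Mapping.keys (a + b :: 'v \<Rightarrow>\<^sub>0 nat) = Poly_Mapping.keys a \<union> Poly_Mapping.keys b"
  by (auto simp: in_keys_iff lookup_add)

lemma pring_zero [simp]: "0 \<in> carrier (pring V)"
  and pring_one [simp]: "1 \<in> carrier (pring V)"
  by (simp_all add: carrier_pring)

lemma pring_add [simp]:
  "p \<in> carrier (pring V) \<Longrightarrow> q \<in> carrier (pring V) \<Longrightarrow> p + q \<in> carrier (pring V)"
  using keys_add[of p q] unfolding carrier_pring by blast

lemma pring_uminus [simp]: "p \<in> carrier (pring V) \<Longrightarrow> - p \<in> carrier (pring V)"
  by (simp add: carrier_pring in_keys_iff)

lemma pring_diff [simp]:
  "p \<in> carrier (pring V) \<Longrightarrow> q \<in> carrier (pring V) \<Longrightarrow> p - q \<in> carrier (pring V)"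
  using pring_add[of p V "- q"] by simp

lemma pring_mult [simp]:
  assumes "p \<in> carrier (pring V)" "q \<in> carrier (pring V)"
  shows "p * q \<in> carrier (pring V)"
  unfolding carrier_pring
proof
  fix m assume "m \<in> Poly_Mapping.keys (p * q)"
  then obtain a b where "m = a + b" "a \<in> Poly_Mapping.keys p" "b \<in> Poly_Mapping.keys q"
    using keys_mult[of p q] by blast
  with assms show "Poly_Mapping.keys m \<subseteq> V"
    by (auto simp: carrier_pring keys_plus_nat)
qed

lemma pring_sum [simp]:
  "(\<And>i. i \<in> A \<Longrightarrow> f i \<in> carrier (pring V)) \<Longrightarrow> sum f A \<in> carrier (pring V)"
  by (induction A rule: infinite_finite_induct) auto

lemma pring_single: "Poly_Mapping.keys m \<subseteq> V \<Longrightarrow> Poly_Mapping.single m c \<in> carrier (pring V)"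
  by (simp add: carrier_pring)

lemma indet_in_pring [simp]: "v \<in> V \<Longrightarrow> indet v \<in> carrier (pring V)"
  by (simp add: carrier_pring indet_def)

lemma cring_pring: "cring (pring V)"
proof (rule cringI)
  show "abelian_group (pring V)"
  proof (rule abelian_groupI)
    fix x assume "x \<in> carrier (pring V)"
    then show "\<exists>y\<in>carrier (pring V). y \<oplus>\<^bsub>pring V\<^esub> x = \<zero>\<^bsub>pring V\<^esub>"
      by (intro bexI[of _ "- x"]) auto
  qed (auto simp: algebra_simps)
  show "Group.comm_monoid (pring V)"
    by (rule comm_monoidI) (auto simp: algebra_simps)
qed (auto simp: algebra_simps)

lemma ideal_pringI:
  fixes J :: "('a, 'b::field) mpol set"
  assumes "J \<subseteq> carrier (pring V)" "0 \<in> J" "\<And>p q. p \<in> J \<Longrightarrow> q \<in> J \<Longrightarrow> p + q \<in> J"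
    and "\<And>p q. p \<in> carrier (pring V) \<Longrightarrow> q \<in> J \<Longrightarrow> p * q \<in> J"
  shows "ideal J (pring V)"
proof (rule idealI)
  interpret R: cring "pring V" by (rule cring_pring)
  show "ring (pring V)" ..
  show "subgroup J (add_monoid (pring V))"
  proof
    fix x assume x: "x \<in> J"
    then have "x \<in> carrier (pring V)" using assms(1) by blast
    then have "\<ominus>\<^bsub>pring V\<^esub> x = - x"
      by (intro R.minus_equality) auto
    moreover have "- 1 * x \<in> J" by (intro assms(4) x) simp
    ultimately show "inv\<^bsub>add_monoid (pring V)\<^esub> x \<in> J" by (simp add: a_inv_def)
  qed (use assms in auto)
  fix a x :: "('a, 'b) mpol" assume "a \<in> J" "x \<in> carrier (pring V)"
  then show "x \<otimes>\<^bsub>pring V\<^esub> a \<in> J" "a \<otimes>\<^bsub>pring V\<^esub> x \<in> J"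
    using assms(4)[of x a] by (simp_all add: mult.commute)
qed

section \<open>Multiplication by a monomial; selection of monomials\<close>

lemma single_mult_lookup:
  fixes p :: "('v, 'k::field) mpol"
  shows "Poly_Mapping.lookup (Poly_Mapping.single a c * p) (a + m) = c * Poly_Mapping.lookup p m"
proof -
  have "(\<Sum>q. Poly_Mapping.lookup p q when a + m = a + q) = Poly_Mapping.lookup p m"
    by (simp add: Sum_any_when_equal')
  moreover have "Poly_Mapping.lookup (Poly_Mapping.single a c) l *
      (\<Sum>q. Poly_Mapping.lookup p q when a + m = l + q) =
      (c * (\<Sum>q. Poly_Mapping.lookup p q when a + m = a + q) when l = a)" for l
    by (cases "l = a") (auto simp: lookup_single)
  ultimately show ?thesis
    by (simp add: lookup_mult)
qed

lemma indet_mult_eq_0: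
  fixes p :: "('v, 'k::field) mpol"
  assumes "indet v * p = 0" shows "p = 0"
proof (rule poly_mapping_eqI)
  fix m show "Poly_Mapping.lookup p m = Poly_Mapping.lookup 0 m"
    using single_mult_lookup[of "Poly_Mapping.single v 1" 1 p m] assms by (simp add: indet_def)
qed

text \<open>Selecting the monomials with property \<open>Q\<close> serves three purposes:
  homogeneous components, splitting off the constant term, and separating the monomials of an
  element of \<open>I\<close> that already lie in \<open>J\<close> from those divisible by the
  removed variable.\<close>

definition mpart :: "(('v \<Rightarrow>\<^sub>0 nat) \<Rightarrow> bool) \<Rightarrow> ('v, 'k::field) mpol \<Rightarrow> ('v, 'k) mpol" where
  "mpart Q p = Abs_poly_mapping (\<lambda>m. Poly_Mapping.lookup p m when Q m)"

lemma lookup_mpart: "Poly_Mapping.lookup (mpart Q p) m = (Poly_Mapping.lookup p m when Q m)"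
proof -
  have "finite {m. (Poly_Mapping.lookup p m when Q m) \<noteq> 0}"
    by (rule finite_subset[OF _ finite_lookup[of p]]) auto
  then show ?thesis by (simp add: mpart_def)
qed

lemma keys_mpart [simp]: "Poly_Mapping.keys (mpart Q p) = {m \<in> Poly_Mapping.keys p. Q m}"
  by (auto simp: in_keys_iff lookup_mpart)

lemma mpart_zero [simp]: "mpart Q 0 = 0"
  by (rule poly_mapping_eqI) (simp add: lookup_mpart)

lemma mpart_add: "mpart Q (p + q) = mpart Q p + mpart Q q"
  by (rule poly_mapping_eqI) (simp add: lookup_mpart lookup_add when_add_distrib)

lemma mpart_sum: "mpart Q (sum f A) = (\<Sum>i\<in>A. mpart Q (f i))"
  by (induction A rule: infinite_finite_induct) (simp_all add: mpart_add)

lemma mpart_split: "p = mpart Q p + mpart (\<lambda>m. \<not> Q m) p"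
  by (rule poly_mapping_eqI) (simp add: lookup_mpart lookup_add when_def)

lemma mpart_id: "(\<And>m. m \<in> Poly_Mapping.keys p \<Longrightarrow> Q m) \<Longrightarrow> mpart Q p = p"
  by (rule poly_mapping_eqI) (auto simp: lookup_mpart when_def in_keys_iff)

lemma mpart_none: "(\<And>m. m \<in> Poly_Mapping.keys p \<Longrightarrow> \<not> Q m) \<Longrightarrow> mpart Q p = 0"
  by (rule poly_mapping_eqI) (auto simp: lookup_mpart when_def in_keys_iff)

lemma mpart_in_pring [simp]: "p \<in> carrier (pring V) \<Longrightarrow> mpart Q p \<in> carrier (pring V)"
  by (simp add: carrier_pring)

section \<open>Degrees and homogeneous components\<close>

lemma mdeg_superset:
  assumes "finite A" "Poly_Mapping.keys m \<subseteq> A"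
  shows "mdeg m = (\<Sum>v\<in>A. Poly_Mapping.lookup m v)"
  unfolding mdeg_def using assms by (intro sum.mono_neutral_left) (auto simp: in_keys_iff)

lemma mdeg_add: "mdeg (a + b) = mdeg a + mdeg b"
proof -
  let ?A = "Poly_Mapping.keys a \<union> Poly_Mapping.keys b"
  show ?thesis
    by (simp add: mdeg_superset[of ?A] keys_plus_nat lookup_add sum.distrib)
qed

lemma mdeg_eq_0_iff: "mdeg m = 0 \<longleftrightarrow> m = 0"
proof
  assume "mdeg m = 0"
  then have "Poly_Mapping.lookup m v = 0" for v
    by (cases "v \<in> Poly_Mapping.keys m") (auto simp: mdeg_def in_keys_iff)
  then show "m = 0" by (intro poly_mapping_eqI) simp
qed (simp add: mdeg_def)

lemma homogeneous_zero [simp]: "homogeneous d 0"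
  by (simp add: homogeneous_def)

lemma homogeneous_one: "homogeneous 0 1"
  by (simp add: homogeneous_def mdeg_def)

lemma homogeneous_indet: "homogeneous 1 (indet v)"
  by (simp add: homogeneous_def indet_def mdeg_def)

lemma homogeneous_uminus [simp]: "homogeneous d p \<Longrightarrow> homogeneous d (- p)"
  by (simp add: homogeneous_def in_keys_iff)

lemma homogeneous_mult:
  assumes "homogeneous d p" "homogeneous e q" shows "homogeneous (d + e) (p * q)"
  unfolding homogeneous_def
proof
  fix m assume "m \<in> Poly_Mapping.keys (p * q)"
  then obtain a b where "m = a + b" "a \<in> Poly_Mapping.keys p" "b \<in> Poly_Mapping.keys q"
    using keys_mult[of p q] by blast
  with assms show "int (mdeg m) = d + e"
    by (auto simp: homogeneous_def mdeg_add)
qed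

definition hcomp :: "int \<Rightarrow> ('v, 'k::field) mpol \<Rightarrow> ('v, 'k) mpol" where
  "hcomp d = mpart (\<lambda>m. int (mdeg m) = d)"

lemma hcomp_zero [simp]: "hcomp d 0 = 0"
  and hcomp_in_pring [simp]: "p \<in> carrier (pring V) \<Longrightarrow> hcomp d p \<in> carrier (pring V)"
  and homogeneous_hcomp [simp]: "homogeneous d (hcomp d p)"
  by (simp_all add: hcomp_def homogeneous_def)

lemma hcomp_id: "homogeneous d p \<Longrightarrow> hcomp d p = p"
  unfolding hcomp_def homogeneous_def by (intro mpart_id) auto

text \<open>Degrees add on monomials, so the part of \<open>p\<close> outside degree
  \<open>d\<close> contributes nothing in degree \<open>e + d\<close>. This lets matrix equations
  with homogeneous coefficients be restricted to a single degree.\<close>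

lemma hcomp_mult:
  fixes h :: "('v, 'k::field) mpol"
  assumes "homogeneous e h"
  shows "hcomp (e + d) (h * p) = h * hcomp d p"
proof -
  let ?r = "mpart (\<lambda>m. int (mdeg m) \<noteq> d) p"
  have "h * p = h * hcomp d p + h * ?r"
    unfolding hcomp_def by (metis mpart_split distrib_left)
  moreover have "hcomp (e + d) (h * hcomp d p) = h * hcomp d p"
    by (intro hcomp_id homogeneous_mult assms) simp
  moreover have "hcomp (e + d) (h * ?r) = 0"
    unfolding hcomp_def
  proof (rule mpart_none)
    fix m assume "m \<in> Poly_Mapping.keys (h * ?r)"
    then obtain a b where "m = a + b" "a \<in> Poly_Mapping.keys h" "b \<in> Poly_Mapping.keys ?r"
      using keys_mult[of h ?r] by blast
    with assms show "int (mdeg m) \<noteq> e + d"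
      by (auto simp: homogeneous_def mdeg_add)
  qed
  ultimately show ?thesis
    by (simp add: hcomp_def mpart_add)
qed

lemma hcomp_mult_right:
  fixes h :: "('v, 'k::field) mpol"
  shows "homogeneous e h \<Longrightarrow> hcomp (e + d) (p * h) = hcomp d p * h"
  by (simp add: mult.commute[of _ h] hcomp_mult)

section \<open>Constant terms and the graded maximal ideal\<close>

lemma lookup_mult_0:
  fixes p q :: "('v, 'k::field) mpol"
  shows "Poly_Mapping.lookup (p * q) 0 = Poly_Mapping.lookup p 0 * Poly_Mapping.lookup q 0"
proof -
  let ?a = "Poly_Mapping.lookup p 0"
  let ?r = "mpart (\<lambda>m. m \<noteq> 0) p"
  have "mpart (\<lambda>m. m = 0) p = Poly_Mapping.single 0 ?a"
    by (rule poly_mapping_eqI) (auto simp: lookup_mpart lookup_single when_def)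
  then have "p * q = Poly_Mapping.single 0 ?a * q + ?r * q"
    by (metis mpart_split distrib_right)
  \<comment> \<open>Degrees of exponents are natural numbers, so a product of monomials equal to 1
    forces both factors to be 1, but \<open>?r\<close> has no constant term.\<close>
  moreover have "Poly_Mapping.lookup (?r * q) 0 = 0"
  proof (rule ccontr)
    assume "\<not> ?thesis"
    then have "0 \<in> Poly_Mapping.keys (?r * q)" by (simp add: in_keys_iff)
    then obtain a b where "0 = a + b" "a \<in> Poly_Mapping.keys ?r"
      using keys_mult[of ?r q] by blast
    then have "mdeg a + mdeg b = 0" "a \<noteq> 0"
      by (simp_all add: mdeg_add[symmetric] mdeg_eq_0_iff)
    then show False by (simp add: mdeg_eq_0_iff)
  qed
  ultimately show ?thesis
    using single_mult_lookup[of 0 ?a q 0] by (simp add: lookup_add)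
qed

text \<open>The polynomials with zero constant term form an ideal that contains every indeterminate
  of \<open>V\<close>. Reduction modulo the graded maximal ideal can therefore be carried out by
  reading off constant terms.\<close>

lemma lookup_0_irrelevant_ideal:
  fixes p :: "('v, 'k::field) mpol" and V :: "'v set"
  assumes "p \<in> irrelevant_ideal V"
  shows "Poly_Mapping.lookup p 0 = 0"
proof -
  let ?J = "{p \<in> carrier (pring V). Poly_Mapping.lookup p 0 = (0::'k)}"
  have "ideal ?J (pring V)"
    by (rule ideal_pringI) (auto simp: lookup_add lookup_mult_0)
  moreover have "indet ` V \<subseteq> ?J"
  proof -
    have "Poly_Mapping.single v 1 \<noteq> (0 :: 'v \<Rightarrow>\<^sub>0 nat)" for v
      by (metis lookup_single_eq lookup_zero zero_neq_one)
    then show ?thesis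
      by (auto simp: indet_def lookup_single carrier_pring when_def)
  qed
  ultimately have "irrelevant_ideal V \<subseteq> ?J"
    unfolding irrelevant_ideal_def genideal_def by blast
  with assms show ?thesis by blast
qed

lemma sum_single_lookup:
  "(\<Sum>m\<in>Poly_Mapping.keys p. Poly_Mapping.single m (Poly_Mapping.lookup p m)) = p"
  by (intro poly_mapping_eqI)
     (simp add: lookup_sum lookup_single when_def in_keys_iff sum.delta)

text \<open>A monomial of degree 1 is a single indeterminate. This is the passage from linearity of
  a resolution to its minimality.\<close>

lemma linear_in_irrelevant_ideal:
  fixes p :: "('v, 'k::field) mpol"
  assumes p: "p \<in> carrier (pring V)" and hom: "homogeneous 1 p"
  shows "p \<in> irrelevant_ideal V"
proof -
  interpret R: cring "pring V" by (rule cring_pring)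
  have sub: "indet ` V \<subseteq> carrier (pring V)" by auto
  interpret I: ideal "irrelevant_ideal V" "pring V"
    unfolding irrelevant_ideal_def by (rule R.genideal_ideal[OF sub])
  have gen: "indet v \<in> irrelevant_ideal V" if "v \<in> V" for v
    unfolding irrelevant_ideal_def using that R.genideal_self[OF sub] by blast
  have single: "Poly_Mapping.single m c \<in> irrelevant_ideal V"
    if m: "m \<in> Poly_Mapping.keys p" for m and c :: 'k
  proof -
    have "mdeg m = 1" using hom m by (auto simp: homogeneous_def)
    then obtain v where v: "v \<in> Poly_Mapping.keys m"
      by (metis (no_types) all_not_in_conv mdeg_def sum.empty zero_neq_one)
    then have vV: "v \<in> V" using p m by (auto simp: carrier_pring)
    have "Poly_Mapping.lookup m v \<noteq> 0" using v by (simp add: in_keys_iff)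
    \<comment> \<open>Subtraction of exponents is truncated; the splitting is exact because the
      exponent of \<open>v\<close> in \<open>m\<close> is positive.\<close>
    then have "m = Poly_Mapping.single v 1 + (m - Poly_Mapping.single v 1)"
      by (intro poly_mapping_eqI) (auto simp: lookup_add lookup_minus lookup_single when_def)
    then have m_eq: "mdeg (m - Poly_Mapping.single v 1) = 0"
      using \<open>mdeg m = 1\<close> mdeg_add[of "Poly_Mapping.single v 1" "m - Poly_Mapping.single v 1"]
      by (simp add: mdeg_def)
    then have "m = Poly_Mapping.single v 1"
      using \<open>m = _ + _\<close> by (simp add: mdeg_eq_0_iff)
    then have "Poly_Mapping.single m c = Poly_Mapping.single 0 c * indet v"
      by (simp add: indet_def mult_single)
    also have "\<dots> \<in> irrelevant_ideal V"
      using I.I_l_closed[OF gen[OF vV], of "Poly_Mapping.single 0 c"] by (simp add: pring_single)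
    finally show ?thesis .
  qed
  have "(\<Sum>m\<in>A. Poly_Mapping.single m (Poly_Mapping.lookup p m)) \<in> irrelevant_ideal V"
    if "A \<subseteq> Poly_Mapping.keys p" for A
    using finite_subset[OF that finite_keys] that
    by (induction A rule: finite_induct)
       (use I.zero_closed I.a_closed single in auto)
  from this[OF order_refl] show ?thesis by (simp add: sum_single_lookup)
qed

section \<open>Complexes of free modules\<close>

definition pring_mat :: "'v set \<Rightarrow> nat \<Rightarrow> nat \<Rightarrow> ('v, 'k::field) mpol mat set" where
  "pring_mat V m n = {A \<in> carrier_mat m n. \<forall>i<m. \<forall>j<n. A $$ (i, j) \<in> carrier (pring V)}"

lemma pring_matD: "A \<in> pring_mat V m n \<Longrightarrow> A \<in> carrier_mat m n"
  by (simp add: pring_mat_def)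

lemma pring_mat_dims:
  assumes "A \<in> pring_mat V m n" shows "dim_row A = m" "dim_col A = n"
  using assms by (auto simp: pring_mat_def)

lemma free_modD: "v \<in> free_mod V n \<Longrightarrow> v \<in> carrier_vec n"
  by (simp add: free_mod_def)

lemma pring_mat_zero [simp]: "0\<^sub>m m n \<in> pring_mat V m n"
  and pring_mat_one [simp]: "1\<^sub>m m \<in> pring_mat V m m"
  by (auto simp: pring_mat_def)

lemma pring_mat_col [simp]:
  "A \<in> pring_mat V m n \<Longrightarrow> j < n \<Longrightarrow> col A j \<in> free_mod V m"
  by (auto simp: pring_mat_def free_mod_def)

lemma pring_mat_eq_cols:
  "A \<in> pring_mat V m n \<longleftrightarrow> A \<in> carrier_mat m n \<and> (\<forall>j<n. col A j \<in> free_mod V m)"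
  by (auto simp: pring_mat_def free_mod_def)

lemma pring_mat_mult_vec [simp]:
  "A \<in> pring_mat V m n \<Longrightarrow> v \<in> free_mod V n \<Longrightarrow> A *\<^sub>v v \<in> free_mod V m"
  by (auto simp: pring_mat_def free_mod_def scalar_prod_def intro!: pring_sum pring_mult)

lemma pring_mat_mult [simp]:
  "A \<in> pring_mat V m n \<Longrightarrow> B \<in> pring_mat V n l \<Longrightarrow> A * B \<in> pring_mat V m l"
  by (auto simp: pring_mat_def scalar_prod_def intro!: pring_sum pring_mult)

lemma pring_mat_diff [simp]:
  "A \<in> pring_mat V m n \<Longrightarrow> B \<in> pring_mat V m n \<Longrightarrow> A - B \<in> pring_mat V m n"
  by (auto simp: pring_mat_def)

lemma pring_mat_uminus [simp]: "A \<in> pring_mat V m n \<Longrightarrow> - A \<in> pring_mat V m n"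
  by (auto simp: pring_mat_def)

lemma pring_mat_smult [simp]:
  "x \<in> carrier (pring V) \<Longrightarrow> A \<in> pring_mat V m n \<Longrightarrow> x \<cdot>\<^sub>m A \<in> pring_mat V m n"
  by (auto simp: pring_mat_def)

lemma free_mod_add [simp]:
  "v \<in> free_mod V n \<Longrightarrow> w \<in> free_mod V n \<Longrightarrow> v + w \<in> free_mod V n"
  by (auto simp: free_mod_def)

lemma free_mod_smult [simp]:
  "x \<in> carrier (pring V) \<Longrightarrow> v \<in> free_mod V n \<Longrightarrow> x \<cdot>\<^sub>v v \<in> free_mod V n"
  by (auto simp: free_mod_def)

lemma free_mod_unit [simp]: "unit_vec n j \<in> free_mod V n"
  by (auto simp: free_mod_def unit_vec_def)

lemma free_mod_append [simp]:
  "v \<in> free_mod V m \<Longrightarrow> w \<in> free_mod V n \<Longrightarrow> v @\<^sub>v w \<in> free_mod V (m + n)"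
  by (auto simp: free_mod_def)

lemma free_mod_splitE:
  assumes "z \<in> free_mod V (m + n)"
  obtains v w where "v \<in> free_mod V m" "w \<in> free_mod V n" "z = v @\<^sub>v w"
proof
  have "z \<in> carrier_vec (m + n)" using assms by (rule free_modD)
  from vec_first_last_append[OF this] show "z = vec_first z m @\<^sub>v vec_last z n" by simp
  show "vec_first z m \<in> free_mod V m" "vec_last z n \<in> free_mod V n"
    using assms by (auto simp: free_mod_def vec_first_def vec_last_def)
qed

lemma unit_vec_mat_col:
  fixes A :: "'a::semiring_1 mat"
  assumes "A \<in> carrier_mat m n" "j < n"
  shows "A *\<^sub>v unit_vec n j = col A j"
  using assms by (intro eq_vecI) auto

text \<open>The augmentation \<open>F_0 \<rightarrow> I \<subseteq> S\<close> is included as the \<open>1 \<times> \<rho> 1\<close> matrix \<open>M 0\<close>, so that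
  \<open>M (q + 1)\<close> is the differential \<open>F_{q+1} \<rightarrow> F_q\<close> and \<open>\<rho> (q + 1)\<close> is the rank of \<open>F_q\<close>.\<close>

definition aug_resolution ::
  "'v set \<Rightarrow> ('v, 'k::field) mpol set \<Rightarrow> (nat \<Rightarrow> nat) \<Rightarrow> (nat \<Rightarrow> ('v, 'k) mpol mat) \<Rightarrow> bool" where
  "aug_resolution V I \<rho> M \<longleftrightarrow>
    \<rho> 0 = 1 \<and> (\<forall>q. M q \<in> pring_mat V (\<rho> q) (\<rho> (Suc q))) \<and>
    (\<lambda>v. (M 0 *\<^sub>v v) $ 0) ` free_mod V (\<rho> 1) = I \<and>
    (\<forall>q. {v \<in> free_mod V (\<rho> (Suc q)). M q *\<^sub>v v = 0\<^sub>v (\<rho> q)} =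
       (\<lambda>w. M (Suc q) *\<^sub>v w) ` free_mod V (\<rho> (Suc (Suc q))))"

context
  fixes V :: "'v set" and I :: "('v, 'k::field) mpol set" and \<rho> M
  assumes res: "aug_resolution V I \<rho> M"
begin

lemma aug_rank_0: "\<rho> 0 = 1"
  and aug_mat: "M q \<in> pring_mat V (\<rho> q) (\<rho> (Suc q))"
  and aug_image: "(\<lambda>v. (M 0 *\<^sub>v v) $ 0) ` free_mod V (\<rho> 1) = I"
  and aug_exact: "{v \<in> free_mod V (\<rho> (Suc q)). M q *\<^sub>v v = 0\<^sub>v (\<rho> q)} =
       (\<lambda>w. M (Suc q) *\<^sub>v w) ` free_mod V (\<rho> (Suc (Suc q)))"
  using res unfolding aug_resolution_def by blast+

lemma aug_carrier: "M q \<in> carrier_mat (\<rho> q) (\<rho> (Suc q))"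
  using aug_mat by (rule pring_matD)

lemma aug_kernelE:
  assumes "v \<in> free_mod V (\<rho> (Suc q))" "M q *\<^sub>v v = 0\<^sub>v (\<rho> q)"
  obtains w where "w \<in> free_mod V (\<rho> (Suc (Suc q)))" "v = M (Suc q) *\<^sub>v w"
  using aug_exact[of q] assms by blast

lemma aug_comp_vec:
  "w \<in> free_mod V (\<rho> (Suc (Suc q))) \<Longrightarrow> M q *\<^sub>v (M (Suc q) *\<^sub>v w) = 0\<^sub>v (\<rho> q)"
  using aug_exact[of q] by blast

lemma aug_comp: "M q * M (Suc q) = 0\<^sub>m (\<rho> q) (\<rho> (Suc (Suc q)))"
proof (rule mat_col_eqI)
  fix j assume "j < dim_col (0\<^sub>m (\<rho> q) (\<rho> (Suc (Suc q))))"
  then have j: "j < \<rho> (Suc (Suc q))" by simp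
  have "col (M q * M (Suc q)) j = M q *\<^sub>v col (M (Suc q)) j"
    by (rule col_mult2[OF aug_carrier aug_carrier j])
  also have "\<dots> = M q *\<^sub>v (M (Suc q) *\<^sub>v unit_vec (\<rho> (Suc (Suc q))) j)"
    by (simp add: unit_vec_mat_col[OF aug_carrier j])
  also have "\<dots> = 0\<^sub>v (\<rho> q)" by (rule aug_comp_vec) simp
  finally show "col (M q * M (Suc q)) j = col (0\<^sub>m (\<rho> q) (\<rho> (Suc (Suc q)))) j"
    using j by simp
qed (use aug_carrier[of q] aug_carrier[of "Suc q"] in auto)

text \<open>Free modules are projective: each column of \<open>B\<close> is a cycle, hence a
  boundary, and chosen preimages of the columns are assembled into \<open>X\<close>.\<close>

lemma aug_lift:
  assumes B: "B \<in> pring_mat V (\<rho> (Suc q)) c" and "M q * B = 0\<^sub>m (\<rho> q) c"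
  shows "\<exists>X\<in>pring_mat V (\<rho> (Suc (Suc q))) c. M (Suc q) * X = B"
proof -
  have "\<exists>w\<in>free_mod V (\<rho> (Suc (Suc q))). col B j = M (Suc q) *\<^sub>v w" if j: "j < c" for j
  proof -
    have "M q *\<^sub>v col B j = col (M q * B) j"
      using col_mult2[OF aug_carrier[of q] pring_matD[OF B] j] by simp
    then have "M q *\<^sub>v col B j = 0\<^sub>v (\<rho> q)" using assms(2) j by simp
    with pring_mat_col[OF B j] show ?thesis by (blast elim: aug_kernelE)
  qed
  then obtain w where w: "\<And>j. j < c \<Longrightarrow> w j \<in> free_mod V (\<rho> (Suc (Suc q)))"
      "\<And>j. j < c \<Longrightarrow> col B j = M (Suc q) *\<^sub>v w j" by metis
  let ?X = "mat (\<rho> (Suc (Suc q))) c (\<lambda>(i, j). w j $ i)"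
  have col: "col ?X j = w j" if "j < c" for j
    using free_modD[OF w(1)[OF that]] that by (intro eq_vecI) auto
  then have X: "?X \<in> pring_mat V (\<rho> (Suc (Suc q))) c"
    using w(1) by (simp add: pring_mat_eq_cols)
  have "M (Suc q) * ?X = B"
  proof (rule mat_col_eqI)
    fix j assume "j < dim_col B"
    then have j: "j < c" using pring_matD[OF B] by simp
    show "col (M (Suc q) * ?X) j = col B j"
      using col_mult2[OF aug_carrier[of "Suc q"] pring_matD[OF X] j] w(2)[OF j] col[OF j] by simp
  qed (use pring_matD[OF B] aug_carrier[of "Suc q"] in auto)
  with X show ?thesis by blast
qed

text \<open>The same columnwise lifting at the bottom. Exactness there says that \<open>I\<close> is
  the image, so membership of the entries in \<open>I\<close> takes the place of the cycle
  condition.\<close>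

lemma aug_lift_0:
  assumes B: "B \<in> pring_mat V 1 c" and BI: "\<And>j. j < c \<Longrightarrow> B $$ (0, j) \<in> I"
  shows "\<exists>X\<in>pring_mat V (\<rho> 1) c. M 0 * X = B"
proof -
  have "\<exists>w\<in>free_mod V (\<rho> 1). B $$ (0, j) = (M 0 *\<^sub>v w) $ 0" if "j < c" for j
    using BI[OF that] aug_image by auto
  then obtain w where w: "\<And>j. j < c \<Longrightarrow> w j \<in> free_mod V (\<rho> 1)"
      "\<And>j. j < c \<Longrightarrow> B $$ (0, j) = (M 0 *\<^sub>v w j) $ 0" by metis
  let ?X = "mat (\<rho> 1) c (\<lambda>(i, j). w j $ i)"
  have col: "col ?X j = w j" if "j < c" for j
    using free_modD[OF w(1)[OF that]] that by (intro eq_vecI) auto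
  then have X: "?X \<in> pring_mat V (\<rho> 1) c"
    using w(1) by (simp add: pring_mat_eq_cols)
  have "M 0 * ?X = B"
  proof (rule eq_matI)
    fix i j assume "i < dim_row B" "j < dim_col B"
    then have j: "i = 0" "j < c" using pring_matD[OF B] by auto
    then show "(M 0 * ?X) $$ (i, j) = B $$ (i, j)"
      using w(2)[OF j(2)] col[OF j(2)] aug_carrier[of 0] aug_rank_0 by simp
  qed (use pring_matD[OF B] aug_carrier[of 0] aug_rank_0 in auto)
  with X show ?thesis by blast
qed

lemma aug_entry_in_ideal: "j < \<rho> 1 \<Longrightarrow> M 0 $$ (0, j) \<in> I"
proof -
  assume j: "j < \<rho> 1"
  then have "(M 0 *\<^sub>v unit_vec (\<rho> 1) j) $ 0 = M 0 $$ (0, j)"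
    using aug_carrier[of 0] aug_rank_0 by (subst unit_vec_mat_col) auto
  then show ?thesis using aug_image free_mod_unit by (metis imageI)
qed

end

section \<open>Chain maps and null homotopies\<close>

lemma dependent_nat_choice_from:
  assumes "P 0 a" "\<And>n x. P n x \<Longrightarrow> \<exists>y. P (Suc n) y \<and> Q n x y"
  shows "\<exists>f. f 0 = a \<and> (\<forall>n. P n (f n)) \<and> (\<forall>n. Q n (f n) (f (Suc n)))"
  using dependent_nat_choice[of "\<lambda>n x. P n x \<and> (n = 0 \<longrightarrow> x = a)" Q] assms by blast

text \<open>The comparison theorem, lifting the inclusion of \<open>J\<close> into \<open>I\<close>.
  The map at index 0 is the identity of the ring in which both ideals sit.\<close>

lemma ex_chain_map:
  fixes I J :: "('v, 'k::field) mpol set"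
  assumes J: "aug_resolution V J \<sigma> N" and I: "aug_resolution V I \<rho> M" and "J \<subseteq> I"
  shows "\<exists>\<Lambda>. \<Lambda> 0 = 1\<^sub>m 1 \<and> (\<forall>q. \<Lambda> q \<in> pring_mat V (\<rho> q) (\<sigma> q)) \<and>
    (\<forall>q. M q * \<Lambda> (Suc q) = \<Lambda> q * N q)"
proof -
  \<comment> \<open>The recursion step needs the previous square to commute. \<open>P\<close>
    remembers this with the previous map \<open>B\<close> existentially bound: any \<open>B\<close>
    with \<open>M p * A = B * N p\<close> makes \<open>A * N (Suc p)\<close> a cycle, because
    \<open>N p * N (Suc p) = 0\<close>.\<close>
  define P where "P q A \<longleftrightarrow> A \<in> pring_mat V (\<rho> q) (\<sigma> q) \<and> (q = 0 \<longrightarrow> A = 1\<^sub>m 1) \<and>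
    (\<forall>p. q = Suc p \<longrightarrow> (\<exists>B\<in>pring_mat V (\<rho> p) (\<sigma> p). M p * A = B * N p))" for q A
  have "P 0 (1\<^sub>m 1)"
    using aug_rank_0[OF I] aug_rank_0[OF J] by (simp add: P_def)
  moreover have "\<exists>B. P (Suc q) B \<and> M q * B = A * N q" if "P q A" for q A
  proof -
    have A: "A \<in> pring_mat V (\<rho> q) (\<sigma> q)" using that by (simp add: P_def)
    have AN: "A * N q \<in> pring_mat V (\<rho> q) (\<sigma> (Suc q))"
      using A aug_mat[OF J] by (rule pring_mat_mult)
    have "\<exists>B\<in>pring_mat V (\<rho> (Suc q)) (\<sigma> (Suc q)). M q * B = A * N q"
    proof (cases q)
      case 0
      then have "A * N q = N 0" using that aug_carrier[OF J, of 0] aug_rank_0[OF J] by (auto simp: P_def)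
      moreover have "N 0 $$ (0, j) \<in> I" if "j < \<sigma> 1" for j
        using aug_entry_in_ideal[OF J that] \<open>J \<subseteq> I\<close> by blast
      ultimately show ?thesis
        using aug_lift_0[OF I, of "N 0" "\<sigma> 1"] aug_mat[OF J, of 0] aug_rank_0[OF J] 0 by simp
    next
      case (Suc p)
      then obtain B where B: "B \<in> pring_mat V (\<rho> p) (\<sigma> p)" "M p * A = B * N p"
        using \<open>P q A\<close> by (auto simp: P_def)
      have "M p * (A * N q) = (M p * A) * N q"
        using assoc_mult_mat[OF aug_carrier[OF I, of p], of A "\<sigma> q" "N q"]
          pring_matD[OF A] aug_carrier[OF J, of q] Suc by simp
      also have "\<dots> = B * (N p * N q)"
        using assoc_mult_mat[OF pring_matD[OF B(1)] aug_carrier[OF J, of p], of "N q"] B(2)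
          aug_carrier[OF J, of q] Suc by simp
      also have "\<dots> = 0\<^sub>m (\<rho> p) (\<sigma> (Suc q))"
        using aug_comp[OF J, of p] pring_matD[OF B(1)] Suc by simp
      finally show ?thesis
        using aug_lift[OF I, of "A * N q" p] AN Suc by simp
    qed
    with A show ?thesis by (auto simp: P_def)
  qed
  ultimately obtain \<Lambda> where "\<Lambda> 0 = 1\<^sub>m 1" "\<And>q. P q (\<Lambda> q)" "\<And>q. M q * \<Lambda> (Suc q) = \<Lambda> q * N q"
    using dependent_nat_choice_from[of P "1\<^sub>m 1" "\<lambda>q A B. M q * B = A * N q"] by blast
  then show ?thesis by (intro exI[of _ \<Lambda>]) (auto simp: P_def)
qed

text \<open>A chain endomorphism that vanishes at the augmentation lifts the zero map of
  \<open>I\<close>, hence is null homotopic, and the homotopy can start with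
  \<open>h 0 = 0\<close>.\<close>

lemma ex_null_homotopy:
  fixes I :: "('v, 'k::field) mpol set"
  assumes I: "aug_resolution V I \<rho> M"
    and B: "\<And>q. B q \<in> pring_mat V (\<rho> q) (\<rho> q)" and B0: "B 0 = 0\<^sub>m 1 1"
    and chain: "\<And>q. M q * B (Suc q) = B q * M q"
  shows "\<exists>h. h 0 = 0\<^sub>m (\<rho> 1) 1 \<and> (\<forall>q. h q \<in> pring_mat V (\<rho> (Suc q)) (\<rho> q)) \<and>
    (\<forall>q. M (Suc q) * h (Suc q) = B (Suc q) - h q * M q)"
proof -
  \<comment> \<open>The second conjunct is the cycle condition for the next step: since
    \<open>B\<close> is a chain map,
    \<open>M q * (B (Suc q) - A * M q) = (B q - M q * A) * M q\<close>.\<close>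
  define P where "P q A \<longleftrightarrow> A \<in> pring_mat V (\<rho> (Suc q)) (\<rho> q) \<and>
    (B q - M q * A) * M q = 0\<^sub>m (\<rho> q) (\<rho> (Suc q))" for q A
  have "P 0 (0\<^sub>m (\<rho> 1) 1)"
  proof -
    have "B 0 - M 0 * 0\<^sub>m (\<rho> 1) 1 = 0\<^sub>m 1 1"
      using aug_rank_0[OF I] aug_carrier[OF I, of 0] B0 by (intro eq_matI) auto
    then show ?thesis
      using aug_rank_0[OF I] aug_carrier[OF I, of 0] by (simp add: P_def)
  qed
  moreover have "\<exists>X. P (Suc q) X \<and> M (Suc q) * X = B (Suc q) - A * M q" if "P q A" for q A
  proof -
    have A: "A \<in> pring_mat V (\<rho> (Suc q)) (\<rho> q)" using that by (simp add: P_def)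
    have c: "A \<in> carrier_mat (\<rho> (Suc q)) (\<rho> q)" "M q \<in> carrier_mat (\<rho> q) (\<rho> (Suc q))"
       "M (Suc q) \<in> carrier_mat (\<rho> (Suc q)) (\<rho> (Suc (Suc q)))"
       "B q \<in> carrier_mat (\<rho> q) (\<rho> q)" "B (Suc q) \<in> carrier_mat (\<rho> (Suc q)) (\<rho> (Suc q))"
      using pring_matD[OF A] aug_carrier[OF I, of q] aug_carrier[OF I, of "Suc q"]
        pring_matD[OF B, of q] pring_matD[OF B, of "Suc q"] by auto
    let ?C = "B (Suc q) - A * M q"
    have C: "?C \<in> pring_mat V (\<rho> (Suc q)) (\<rho> (Suc q))"
      using A B aug_mat[OF I] by (intro pring_mat_diff pring_mat_mult)
    have "M q * ?C = M q * B (Suc q) - M q * (A * M q)"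
      by (rule mult_minus_distrib_mat) (use c in auto)
    also have "\<dots> = B q * M q - (M q * A) * M q"
      using c chain[of q] by simp
    also have "\<dots> = (B q - M q * A) * M q"
      by (rule minus_mult_distrib_mat[symmetric]) (use c in auto)
    finally have "M q * ?C = 0\<^sub>m (\<rho> q) (\<rho> (Suc q))"
      using \<open>P q A\<close> by (simp add: P_def)
    from aug_lift[OF I C this] obtain X
      where X: "X \<in> pring_mat V (\<rho> (Suc (Suc q))) (\<rho> (Suc q))" "M (Suc q) * X = ?C" by blast
    have "B (Suc q) - M (Suc q) * X = A * M q"
      unfolding X(2) using c by (intro eq_matI) auto
    moreover have "A * M q * M (Suc q) = A * (M q * M (Suc q))"
      using c by (intro assoc_mult_mat)
    ultimately have "P (Suc q) X"
      using X aug_comp[OF I, of q] c by (simp add: P_def)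
    with X show ?thesis by blast
  qed
  ultimately obtain h where "h 0 = 0\<^sub>m (\<rho> 1) 1" "\<And>q. P q (h q)" "\<And>q. M (Suc q) * h (Suc q) = B (Suc q) - h q * M q"
    using dependent_nat_choice_from[of P "0\<^sub>m (\<rho> 1) 1" "\<lambda>q A X. M (Suc q) * X = B (Suc q) - A * M q"] by blast
  then show ?thesis by (intro exI[of _ h]) (auto simp: P_def)
qed


section \<open>Invariance of the ranks of a minimal resolution\<close>

lemma right_inverse_dim_le:
  fixes A B :: "'a::field mat"
  assumes A: "A \<in> carrier_mat r s" and B: "B \<in> carrier_mat s r" and AB: "A * B = 1\<^sub>m r"
  shows "r \<le> s"
proof (rule ccontr)
  assume "\<not> r \<le> s"
  then have sr: "s < r" by simp
  \<comment> \<open>Padding with zero columns and zero rows makes both factors square without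
    changing the product. For square matrices a right inverse is a left inverse, but row
    \<open>s\<close> of \<open>B'\<close> is zero.\<close>
  define A' where "A' = mat r r (\<lambda>(i, j). if j < s then A $$ (i, j) else 0)"
  define B' where "B' = mat r r (\<lambda>(i, j). if i < s then B $$ (i, j) else 0)"
  have "A' * B' = A * B"
  proof (rule eq_matI)
    fix i j assume "i < dim_row (A * B)" "j < dim_col (A * B)"
    then have ij: "i < r" "j < r" using A B by auto
    have "(A' * B') $$ (i, j) = (\<Sum>k<r. if k < s then A $$ (i, k) * B $$ (k, j) else 0)"
      using ij by (auto simp: A'_def B'_def scalar_prod_def atLeast0LessThan intro!: sum.cong)
    also have "\<dots> = (\<Sum>k<s. A $$ (i, k) * B $$ (k, j))"
      using sr by (intro sum.mono_neutral_cong_right) auto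
    also have "\<dots> = (A * B) $$ (i, j)"
      using ij A B by (auto simp: scalar_prod_def atLeast0LessThan)
    finally show "(A' * B') $$ (i, j) = (A * B) $$ (i, j)" .
  qed (use A B in \<open>auto simp: A'_def B'_def\<close>)
  with AB have "A' * B' = 1\<^sub>m r" by simp
  then have "B' * A' = 1\<^sub>m r"
    by (rule mat_mult_left_right_inverse[rotated 2]) (auto simp: A'_def B'_def)
  moreover have "(B' * A') $$ (s, s) = 0"
    using sr by (auto simp: A'_def B'_def scalar_prod_def)
  ultimately show False using sr by simp
qed

text \<open>The residue map modulo the graded maximal ideal. As a homomorphism it commutes with
  products of matrices, which turns chain maps into matrices over the field.\<close>

definition const_coeff :: "('v, 'k::field) mpol \<Rightarrow> 'k" where
  "const_coeff p = Poly_Mapping.lookup p 0"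

interpretation const_coeff: semiring_hom "const_coeff :: ('v, 'k::field) mpol \<Rightarrow> 'k"
  by unfold_locales (simp_all add: const_coeff_def lookup_add lookup_mult_0)

text \<open>Lift the identity of \<open>I\<close> in both directions; the composite is homotopic to the identity,
  hence equal to it modulo the irrelevant ideal.\<close>

lemma minimal_rank_le:
  fixes I :: "('v, 'k::field) mpol set"
  assumes M: "aug_resolution V I \<rho> M" and N: "aug_resolution V I \<sigma> N"
    and min: "\<And>q i j. i < \<rho> (Suc q) \<Longrightarrow> j < \<rho> (Suc (Suc q)) \<Longrightarrow>
      const_coeff (M (Suc q) $$ (i, j)) = 0"
  shows "\<rho> (Suc q) \<le> \<sigma> (Suc q)"
proof -
  obtain \<Lambda> where \<Lambda>: "\<Lambda> 0 = 1\<^sub>m 1" "\<And>q. \<Lambda> q \<in> pring_mat V (\<rho> q) (\<sigma> q)"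
      "\<And>q. M q * \<Lambda> (Suc q) = \<Lambda> q * N q"
    using ex_chain_map[OF N M order_refl] by blast
  obtain \<Gamma> where \<Gamma>: "\<Gamma> 0 = 1\<^sub>m 1" "\<And>q. \<Gamma> q \<in> pring_mat V (\<sigma> q) (\<rho> q)"
      "\<And>q. N q * \<Gamma> (Suc q) = \<Gamma> q * M q"
    using ex_chain_map[OF M N order_refl] by blast
  note c = aug_carrier[OF M] aug_carrier[OF N] pring_matD[OF \<Lambda>(2)] pring_matD[OF \<Gamma>(2)]
  \<comment> \<open>The chain endomorphism that measures how far lifting forth and back is from the
    identity; it vanishes at index 0, where both lifts are the identity.\<close>
  define B where "B q = \<Lambda> q * \<Gamma> q - 1\<^sub>m (\<rho> q)" for q
  have "B q \<in> pring_mat V (\<rho> q) (\<rho> q)" for q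
    unfolding B_def by (intro pring_mat_diff pring_mat_mult[OF \<Lambda>(2) \<Gamma>(2)] pring_mat_one)
  moreover have "B 0 = 0\<^sub>m 1 1"
    using aug_rank_0[OF M] unfolding B_def \<Lambda>(1) \<Gamma>(1) by (intro eq_matI) auto
  moreover have "M q * B (Suc q) = B q * M q" for q
  proof -
    have "M q * B (Suc q) = M q * (\<Lambda> (Suc q) * \<Gamma> (Suc q)) - M q * 1\<^sub>m (\<rho> (Suc q))"
      unfolding B_def
      by (rule mult_minus_distrib_mat[OF c(1) mult_carrier_mat[OF c(3) c(4)] one_carrier_mat])
    also have "M q * (\<Lambda> (Suc q) * \<Gamma> (Suc q)) = (M q * \<Lambda> (Suc q)) * \<Gamma> (Suc q)"
      by (rule assoc_mult_mat[symmetric, OF c(1) c(3) c(4)])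
    also have "\<dots> = \<Lambda> q * (N q * \<Gamma> (Suc q))"
      unfolding \<Lambda>(3) by (rule assoc_mult_mat[OF c(3) c(2) c(4)])
    also have "\<dots> = (\<Lambda> q * \<Gamma> q) * M q"
      unfolding \<Gamma>(3) by (rule assoc_mult_mat[symmetric, OF c(3) c(4) c(1)])
    also have "M q * 1\<^sub>m (\<rho> (Suc q)) = 1\<^sub>m (\<rho> q) * M q"
      using right_mult_one_mat[OF c(1)[of q]] left_mult_one_mat[OF c(1)[of q]] by simp
    also have "(\<Lambda> q * \<Gamma> q) * M q - 1\<^sub>m (\<rho> q) * M q = B q * M q"
      unfolding B_def
      by (rule minus_mult_distrib_mat[symmetric, OF mult_carrier_mat[OF c(3) c(4)] one_carrier_mat c(1)])
    finally show ?thesis .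
  qed
  ultimately obtain h where h: "h 0 = 0\<^sub>m (\<rho> 1) 1" "\<And>q. h q \<in> pring_mat V (\<rho> (Suc q)) (\<rho> q)"
      "\<And>q. M (Suc q) * h (Suc q) = B (Suc q) - h q * M q"
    using ex_null_homotopy[OF M, of B] by blast
  let ?c = "map_mat (const_coeff :: ('v, 'k) mpol \<Rightarrow> 'k)"
  have M0: "?c (M (Suc p)) = 0\<^sub>m (\<rho> (Suc p)) (\<rho> (Suc (Suc p)))" for p
    using min carrier_matD[OF c(1)[of "Suc p"]] by (intro eq_matI) auto
  have hc: "h p \<in> carrier_mat (\<rho> (Suc p)) (\<rho> p)" for p
    using h(2) by (rule pring_matD)
  note Mh = mult_carrier_mat[OF c(1)[of "Suc q"] hc[of "Suc q"]]
    and hM = mult_carrier_mat[OF hc[of q] c(1)[of q]]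
  have c0: "?c (M (Suc q) * h (Suc q)) = 0\<^sub>m (\<rho> (Suc q)) (\<rho> (Suc q))"
    unfolding const_coeff.mat_hom_mult[OF c(1) hc] M0
    by (rule left_mult_zero_mat) (use hc[of "Suc q"] in simp)
  \<comment> \<open>For \<open>q = 0\<close> the homotopy itself vanishes. Minimality says nothing
    about \<open>M 0\<close>, whose entries generate \<open>I\<close> and may be constants, as for
    the unit ideal.\<close>
  have c1: "?c (h q * M q) = 0\<^sub>m (\<rho> (Suc q)) (\<rho> (Suc q))"
  proof (cases q)
    case 0
    then have "h q * M q = 0\<^sub>m (\<rho> (Suc q)) (\<rho> (Suc q))"
      using h(1) c(1)[of 0] aug_rank_0[OF M] by simp
    then show ?thesis by (auto simp: const_coeff_def)
  next
    case (Suc p)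
    show ?thesis
      unfolding Suc const_coeff.mat_hom_mult[OF hc c(1)] M0
      by (rule right_mult_zero_mat) (use hc[of "Suc p"] in simp)
  qed
  have "\<Lambda> (Suc q) * \<Gamma> (Suc q) = M (Suc q) * h (Suc q) + h q * M q + 1\<^sub>m (\<rho> (Suc q))"
    unfolding h(3) B_def
    using carrier_matD[OF mult_carrier_mat[OF c(3)[of "Suc q"] c(4)[of "Suc q"]]] carrier_matD[OF hM]
    by (intro eq_matI) (simp_all del: index_mult_mat)
  also have "?c \<dots> = ?c (M (Suc q) * h (Suc q)) + ?c (h q * M q) + ?c (1\<^sub>m (\<rho> (Suc q)))"
    using carrier_matD[OF Mh] carrier_matD[OF hM]
    by (intro eq_matI) (simp_all add: const_coeff.hom_add del: index_mult_mat)
  also have "\<dots> = 1\<^sub>m (\<rho> (Suc q))"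
    unfolding c0 c1 const_coeff.mat_hom_one by simp
  finally have "?c (\<Lambda> (Suc q)) * ?c (\<Gamma> (Suc q)) = 1\<^sub>m (\<rho> (Suc q))"
    unfolding const_coeff.mat_hom_mult[OF c(3) c(4)] .
  then show ?thesis
    by (intro right_inverse_dim_le[of "?c (\<Lambda> (Suc q))" _ _ "?c (\<Gamma> (Suc q))"])
      (use c(3,4)[of "Suc q"] in simp_all)
qed

section \<open>Linear resolutions\<close>

definition hom_mat :: "int \<Rightarrow> ('v, 'k::field) mpol mat \<Rightarrow> bool" where
  "hom_mat d A \<longleftrightarrow> (\<forall>i<dim_row A. \<forall>j<dim_col A. homogeneous d (A $$ (i, j)))"

lemma hom_mat_zero [simp]: "hom_mat d (0\<^sub>m m n)"
  by (simp add: hom_mat_def)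

lemma hom_mat_uminus [simp]: "hom_mat d A \<Longrightarrow> hom_mat d (- A)"
  by (simp add: hom_mat_def)

lemma hom_mat_smult:
  "homogeneous e x \<Longrightarrow> hom_mat d A \<Longrightarrow> hom_mat (e + d) (x \<cdot>\<^sub>m A)"
  by (simp add: hom_mat_def homogeneous_mult)

lemma hom_mat_one: "hom_mat 0 (1\<^sub>m n)"
  by (simp add: hom_mat_def homogeneous_one)

lemma hom_mat_four_block:
  assumes "A \<in> carrier_mat m n" "B \<in> carrier_mat m l" "C \<in> carrier_mat k n" "D \<in> carrier_mat k l"
    and "hom_mat d A" "hom_mat d B" "hom_mat d C" "hom_mat d D"
  shows "hom_mat d (four_block_mat A B C D)"
  using assms by (auto simp: hom_mat_def)

lemma hom_mat_append_rows:
  assumes "A \<in> carrier_mat m n" "C \<in> carrier_mat k n" "hom_mat d A" "hom_mat d C"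
  shows "hom_mat d (A @\<^sub>r C)"
  unfolding append_rows_def using assms by (intro hom_mat_four_block) auto

lemma pring_mat_four_block:
  assumes "A \<in> pring_mat V m n" "B \<in> pring_mat V m l" "C \<in> pring_mat V k n" "D \<in> pring_mat V k l"
  shows "four_block_mat A B C D \<in> pring_mat V (m + k) (n + l)"
  using assms by (auto simp: pring_mat_def)

lemma pring_mat_append_rows:
  assumes "A \<in> pring_mat V m n" "C \<in> pring_mat V k n"
  shows "A @\<^sub>r C \<in> pring_mat V (m + k) n"
proof -
  have "four_block_mat A (0\<^sub>m m 0) C (0\<^sub>m k 0) \<in> pring_mat V (m + k) (n + 0)"
    using assms by (intro pring_mat_four_block) auto
  then show ?thesis
    using assms by (simp add: append_rows_def pring_mat_dims)
qed

lemma hcomp_sum: "hcomp d (sum f A) = (\<Sum>i\<in>A. hcomp d (f i))"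
  by (simp add: hcomp_def mpart_sum)

lemma map_mat_hcomp_mult:
  assumes "A \<in> carrier_mat m n" "B \<in> carrier_mat n l" "hom_mat e A"
  shows "map_mat (hcomp (e + d)) (A * B) = A * map_mat (hcomp d) B"
  using assms
  by (intro eq_matI) (auto simp: hom_mat_def scalar_prod_def hcomp_sum hcomp_mult intro!: sum.cong)

lemma map_mat_hcomp_mult_right:
  assumes "A \<in> carrier_mat m n" "B \<in> carrier_mat n l" "hom_mat e B"
  shows "map_mat (hcomp (e + d)) (A * B) = map_mat (hcomp d) A * B"
  using assms
  by (intro eq_matI) (auto simp: hom_mat_def scalar_prod_def hcomp_sum hcomp_mult_right intro!: sum.cong)

lemma map_mat_hcomp_id: "hom_mat d A \<Longrightarrow> map_mat (hcomp d) A = A"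
  by (intro eq_matI) (auto simp: hom_mat_def hcomp_id)

lemma pring_mat_hcomp [simp]: "A \<in> pring_mat V m n \<Longrightarrow> map_mat (hcomp d) A \<in> pring_mat V m n"
  by (auto simp: pring_mat_def)

definition linear_resolution ::
  "'v set \<Rightarrow> ('v, 'k::field) mpol set \<Rightarrow> int \<Rightarrow> (nat \<Rightarrow> nat) \<Rightarrow> (nat \<Rightarrow> ('v, 'k) mpol mat) \<Rightarrow> bool" where
  "linear_resolution V I d \<rho> M \<longleftrightarrow>
    aug_resolution V I \<rho> M \<and> hom_mat d (M 0) \<and> (\<forall>q. hom_mat 1 (M (Suc q)))"

text \<open>Since all differentials are homogeneous, one homogeneous component of an arbitrary lift
  still makes the squares commute. The right degree is 1: the basis elements in the resolution of
  \<open>J\<close> lie one degree above those in the same place of the resolution of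
  \<open>I\<close>.\<close>

lemma ex_linear_chain_map:
  fixes I J :: "('v, 'k::field) mpol set"
  assumes J: "linear_resolution V J (d + 1) \<sigma> N" and I: "linear_resolution V I d \<rho> M" and "J \<subseteq> I"
  shows "\<exists>\<Lambda>. (\<forall>q. \<Lambda> q \<in> pring_mat V (\<rho> q) (\<sigma> q)) \<and> \<Lambda> 0 = 1\<^sub>m 1 \<and>
    (\<forall>q. M q * \<Lambda> (Suc q) = \<Lambda> q * N q) \<and> (\<forall>q. hom_mat 1 (\<Lambda> (Suc q)))"
proof -
  from J I have J': "aug_resolution V J \<sigma> N" and I': "aug_resolution V I \<rho> M"
    and hN: "hom_mat (d + 1) (N 0)" "\<And>q. hom_mat 1 (N (Suc q))"
    and hM: "hom_mat d (M 0)" "\<And>q. hom_mat 1 (M (Suc q))"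
    by (auto simp: linear_resolution_def)
  from ex_chain_map[OF J' I' \<open>J \<subseteq> I\<close>] obtain \<Lambda> where \<Lambda>: "\<Lambda> 0 = 1\<^sub>m 1"
    "\<And>q. \<Lambda> q \<in> pring_mat V (\<rho> q) (\<sigma> q)" "\<And>q. M q * \<Lambda> (Suc q) = \<Lambda> q * N q" by blast
  note c = aug_carrier[OF I'] aug_carrier[OF J'] pring_matD[OF \<Lambda>(2)]
  \<comment> \<open>Index 0 is exempt: there the map is the identity of the ring, of degree
    0.\<close>
  define \<Lambda>' where "\<Lambda>' q = (if q = 0 then 1\<^sub>m 1 else map_mat (hcomp 1) (\<Lambda> q))" for q
  have \<Lambda>'_in: "\<Lambda>' q \<in> pring_mat V (\<rho> q) (\<sigma> q)" for q
    using \<Lambda>(1) \<Lambda>(2)[of q] by (auto simp: \<Lambda>'_def)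
  have eq: "M q * \<Lambda>' (Suc q) = \<Lambda>' q * N q" for q
  proof (cases q)
    case 0
    have N0: "\<Lambda> 0 * N 0 = N 0" using c(2)[of 0] \<Lambda>(1) aug_rank_0[OF J'] by simp
    \<comment> \<open>\<open>N 0\<close> has degree \<open>d + 1\<close> and \<open>M 0\<close> has
      degree \<open>d\<close>, so the component of degree \<open>d + 1\<close> of the square singles
      out the linear part of \<open>\<Lambda> 1\<close>.\<close>
    have "M 0 * map_mat (hcomp 1) (\<Lambda> 1) = map_mat (hcomp (d + 1)) (M 0 * \<Lambda> 1)"
      using map_mat_hcomp_mult[OF c(1)[of 0] c(3)[of "Suc 0"] hM(1), of 1] by simp
    also have "\<dots> = N 0"
      using \<Lambda>(3)[of 0] N0 map_mat_hcomp_id[OF hN(1)] by simp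
    finally show ?thesis using 0 N0 \<Lambda>(1) by (simp add: \<Lambda>'_def)
  next
    case (Suc p)
    have "M q * map_mat (hcomp 1) (\<Lambda> (Suc q)) = map_mat (hcomp (1 + 1)) (M q * \<Lambda> (Suc q))"
      using map_mat_hcomp_mult[OF c(1)[of q] c(3)[of "Suc q"], of 1 1] hM(2)[of p] Suc by simp
    also have "\<dots> = map_mat (hcomp 1) (\<Lambda> q) * N q"
      unfolding \<Lambda>(3)
      using map_mat_hcomp_mult_right[OF c(3)[of q] c(2)[of q], of 1 1] hN(2)[of p] Suc by simp
    finally show ?thesis using Suc by (simp add: \<Lambda>'_def)
  qed
  have "hom_mat 1 (\<Lambda>' (Suc q))" for q
    by (simp add: \<Lambda>'_def hom_mat_def)
  moreover have "\<Lambda>' 0 = 1\<^sub>m 1" by (simp add: \<Lambda>'_def)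
  ultimately show ?thesis using \<Lambda>'_in eq by blast
qed

lemma mult_smult_vec:
  fixes A :: "'a::comm_ring_1 mat"
  assumes "A \<in> carrier_mat m n" "v \<in> carrier_vec n"
  shows "A *\<^sub>v (c \<cdot>\<^sub>v v) = c \<cdot>\<^sub>v (A *\<^sub>v v)"
  using assms by (intro eq_vecI) (auto simp: scalar_prod_def sum_distrib_left ac_simps)

text \<open>The type of vectors does not fix their length, so the sign cancellations that occur in
  the cone are stated for vectors of a given length and checked entrywise.\<close>

lemma vec_cancel:
  fixes a b :: "'a::comm_ring_1 vec"
  assumes "a \<in> carrier_vec n" "b \<in> carrier_vec n"
  shows "0\<^sub>v n + c \<cdot>\<^sub>v a + c \<cdot>\<^sub>v ((-1) \<cdot>\<^sub>v a) = 0\<^sub>v n"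
    and "0\<^sub>v n + c \<cdot>\<^sub>v a + c \<cdot>\<^sub>v (0\<^sub>v n + (-1) \<cdot>\<^sub>v a) = 0\<^sub>v n"
    and "b + c \<cdot>\<^sub>v ((-1) \<cdot>\<^sub>v a) = b + (- c) \<cdot>\<^sub>v a"
    and "b + c \<cdot>\<^sub>v a + (- c) \<cdot>\<^sub>v a = b"
    and "b + (- c) \<cdot>\<^sub>v a + c \<cdot>\<^sub>v a = b"
    and "(-1) \<cdot>\<^sub>v ((-1) \<cdot>\<^sub>v a) = a"
  by (rule eq_vecI; use assms in \<open>simp add: algebra_simps\<close>)+

lemma mult_mat_vec_lin:
  fixes A :: "'a::comm_ring_1 mat"
  assumes "A \<in> carrier_mat m n" "a \<in> carrier_vec n" "b \<in> carrier_vec n"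
  shows "A *\<^sub>v (a + c \<cdot>\<^sub>v b) = A *\<^sub>v a + c \<cdot>\<^sub>v (A *\<^sub>v b)"
  using mult_add_distrib_mat_vec[OF assms(1,2), of "c \<cdot>\<^sub>v b"] mult_smult_vec[OF assms(1,3), of c] assms(3)
  by simp

lemma mat_mult_zero_vec: "A \<in> carrier_mat m n \<Longrightarrow> A *\<^sub>v 0\<^sub>v n = 0\<^sub>v m"
  by (intro eq_vecI) auto

lemma zero_mat_mult_vec: "v \<in> carrier_vec n \<Longrightarrow> 0\<^sub>m m n *\<^sub>v v = 0\<^sub>v m"
  by (intro eq_vecI) auto

lemma append_vec_dim_0: "dim_vec w = 0 \<Longrightarrow> v @\<^sub>v w = v"
  by (intro eq_vecI) auto

lemma append_vec_eq_0_iff: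
  assumes "v \<in> carrier_vec m" "w \<in> carrier_vec n"
  shows "v @\<^sub>v w = 0\<^sub>v (m + n) \<longleftrightarrow> v = 0\<^sub>v m \<and> w = 0\<^sub>v n"
proof -
  have "(0\<^sub>v (m + n) :: 'a vec) = 0\<^sub>v m @\<^sub>v 0\<^sub>v n" by (intro eq_vecI) auto
  then show ?thesis using append_vec_eq[OF assms(1), of "0\<^sub>v m" w "0\<^sub>v n"] by auto
qed

subsection \<open>The mapping cone\<close>

text \<open>Let \<open>J \<subseteq> K\<close>, let \<open>x\<close> be a nonzerodivisor modulo \<open>J\<close> and \<open>I = J + x K\<close>. Then
  \<open>0 \<rightarrow> J \<rightarrow> J \<oplus> K \<rightarrow> I \<rightarrow> 0\<close> with \<open>u \<mapsto> (x u, - u)\<close> and \<open>(p, q) \<mapsto> p + x q\<close> is exact,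
  and \<open>I\<close> is resolved by the mapping cone of a lift of the first map.\<close>

definition cone_tail :: "(nat \<Rightarrow> nat) \<Rightarrow> nat \<Rightarrow> nat" where
  "cone_tail \<sigma> p = (if p = 0 then 0 else \<sigma> p)"

text \<open>The last summand is the resolution of \<open>J\<close> shifted by one place. Without its
  augmentation that resolution begins at index 1, so at \<open>p = 0\<close> the rank
  \<open>\<sigma> 0 = 1\<close> is replaced by 0. At index 0 the cone has the single copy of the
  ring that receives \<open>p + x q\<close>.\<close>

definition cone_rank :: "(nat \<Rightarrow> nat) \<Rightarrow> (nat \<Rightarrow> nat) \<Rightarrow> nat \<Rightarrow> nat" where
  "cone_rank \<sigma> \<rho> q = (case q of 0 \<Rightarrow> 1 | Suc p \<Rightarrow> \<sigma> q + \<rho> q + cone_tail \<sigma> p)"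

text \<open>On triples the differential is
  \<open>(u, v, w) \<mapsto> (N u + x w, M v - \<Lambda> w, - N w)\<close>; the sign of the last
  entry makes consecutive maps compose to zero. For \<open>p = 0\<close> the bottom block has no
  rows, so \<open>N 0\<close> does not occur in it.\<close>

definition cone :: "(nat \<Rightarrow> nat) \<Rightarrow> (nat \<Rightarrow> nat) \<Rightarrow> (nat \<Rightarrow> 'a mat) \<Rightarrow> (nat \<Rightarrow> 'a mat) \<Rightarrow>
    (nat \<Rightarrow> 'a::comm_ring_1 mat) \<Rightarrow> 'a \<Rightarrow> nat \<Rightarrow> 'a mat" where
  "cone \<sigma> \<rho> N M \<Lambda> x q = (case q of
     0 \<Rightarrow> four_block_mat (N 0) (x \<cdot>\<^sub>m M 0) (0\<^sub>m 0 (\<sigma> 1)) (0\<^sub>m 0 (\<rho> 1))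
   | Suc p \<Rightarrow> four_block_mat
       (four_block_mat (N q) (0\<^sub>m (\<sigma> q) (\<rho> (Suc q))) (0\<^sub>m (\<rho> q) (\<sigma> (Suc q))) (M q))
       ((x \<cdot>\<^sub>m 1\<^sub>m (\<sigma> q)) @\<^sub>r - \<Lambda> q)
       (0\<^sub>m (cone_tail \<sigma> p) (\<sigma> (Suc q) + \<rho> (Suc q)))
       (if p = 0 then 0\<^sub>m 0 (\<sigma> 1) else - N p))"

context
  fixes V :: "'v set" and I J K :: "('v, 'k::field) mpol set" and \<sigma> \<rho> N M \<Lambda> x
  assumes J: "aug_resolution V J \<sigma> N" and K: "aug_resolution V K \<rho> M"
    and \<Lambda>: "\<And>q. \<Lambda> q \<in> pring_mat V (\<rho> q) (\<sigma> q)" "\<Lambda> 0 = 1\<^sub>m 1"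
    and chain: "\<And>q. M q * \<Lambda> (Suc q) = \<Lambda> q * N q"
    and x: "x \<in> carrier (pring V)" and nzd: "\<And>p. x * p = 0 \<Longrightarrow> p = 0"
    and nzd_mod: "\<And>p. p \<in> K \<Longrightarrow> x * p \<in> J \<Longrightarrow> p \<in> J"
    and I: "I = {p + x * q | p q. p \<in> J \<and> q \<in> K}"
begin

lemma cone_mat:
  "cone \<sigma> \<rho> N M \<Lambda> x q \<in> pring_mat V (cone_rank \<sigma> \<rho> q) (cone_rank \<sigma> \<rho> (Suc q))"
proof (cases q)
  case 0
  have "four_block_mat (N 0) (x \<cdot>\<^sub>m M 0) (0\<^sub>m 0 (\<sigma> 1)) (0\<^sub>m 0 (\<rho> 1)) \<in> pring_mat V (1 + 0) (\<sigma> 1 + \<rho> 1)"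
    using aug_mat[OF J, of 0] aug_mat[OF K, of 0] aug_rank_0[OF J] aug_rank_0[OF K] x
    by (intro pring_mat_four_block) auto
  then show ?thesis using 0 by (simp add: cone_def cone_rank_def cone_tail_def)
next
  case (Suc p)
  have *: "(if p = 0 then 0\<^sub>m 0 (\<sigma> 1) else - N p) \<in> pring_mat V (cone_tail \<sigma> p) (\<sigma> q)"
    using aug_mat[OF J, of p] Suc by (auto simp: cone_tail_def)
  have **: "(x \<cdot>\<^sub>m 1\<^sub>m (\<sigma> q)) @\<^sub>r - \<Lambda> q \<in> pring_mat V (\<sigma> q + \<rho> q) (\<sigma> q)"
    using \<Lambda>(1)[of q] x by (intro pring_mat_append_rows) auto
  have ***: "four_block_mat (N q) (0\<^sub>m (\<sigma> q) (\<rho> (Suc q))) (0\<^sub>m (\<rho> q) (\<sigma> (Suc q))) (M q) \<in>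
      pring_mat V (\<sigma> q + \<rho> q) (\<sigma> (Suc q) + \<rho> (Suc q))"
    using aug_mat[OF J, of q] aug_mat[OF K, of q] by (intro pring_mat_four_block) auto
  have "cone \<sigma> \<rho> N M \<Lambda> x q \<in>
      pring_mat V ((\<sigma> q + \<rho> q) + cone_tail \<sigma> p) ((\<sigma> (Suc q) + \<rho> (Suc q)) + \<sigma> q)"
    using pring_mat_four_block[OF *** ** pring_mat_zero *] unfolding cone_def Suc nat.case .
  then show ?thesis using Suc by (simp add: cone_rank_def cone_tail_def)
qed

lemma cone_0_vec:
  assumes u: "u \<in> carrier_vec (\<sigma> 1)" and v: "v \<in> carrier_vec (\<rho> 1)"
  shows "cone \<sigma> \<rho> N M \<Lambda> x 0 *\<^sub>v (u @\<^sub>v v) = N 0 *\<^sub>v u + x \<cdot>\<^sub>v (M 0 *\<^sub>v v)"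
proof -
  have "cone \<sigma> \<rho> N M \<Lambda> x 0 *\<^sub>v (u @\<^sub>v v) =
      (N 0 *\<^sub>v u + (x \<cdot>\<^sub>m M 0) *\<^sub>v v) @\<^sub>v (0\<^sub>m 0 (\<sigma> 1) *\<^sub>v u + 0\<^sub>m 0 (\<rho> 1) *\<^sub>v v)"
    unfolding cone_def using aug_carrier[OF J, of 0] aug_carrier[OF K, of 0]
      aug_rank_0[OF J] aug_rank_0[OF K] u v
    by (simp add: four_block_mat_mult_vec[of _ 1 "\<sigma> 1" _ "\<rho> 1" _ 0])
  also have "\<dots> = N 0 *\<^sub>v u + (x \<cdot>\<^sub>m M 0) *\<^sub>v v"
    by (rule append_vec_dim_0) simp
  also have "(x \<cdot>\<^sub>m M 0) *\<^sub>v v = x \<cdot>\<^sub>v (M 0 *\<^sub>v v)"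
    using aug_carrier[OF K, of 0] v by (intro eq_vecI) auto
  finally show ?thesis .
qed

lemma cone_Suc_vec:
  assumes u: "u \<in> carrier_vec (\<sigma> (Suc (Suc p)))" and v: "v \<in> carrier_vec (\<rho> (Suc (Suc p)))"
    and w: "w \<in> carrier_vec (\<sigma> (Suc p))"
  shows "cone \<sigma> \<rho> N M \<Lambda> x (Suc p) *\<^sub>v ((u @\<^sub>v v) @\<^sub>v w) =
    ((N (Suc p) *\<^sub>v u + x \<cdot>\<^sub>v w) @\<^sub>v (M (Suc p) *\<^sub>v v + (-1) \<cdot>\<^sub>v (\<Lambda> (Suc p) *\<^sub>v w))) @\<^sub>v
    (if p = 0 then 0\<^sub>v 0 else (-1) \<cdot>\<^sub>v (N p *\<^sub>v w))"
proof -
  let ?q = "Suc p"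
  let ?A = "four_block_mat (N ?q) (0\<^sub>m (\<sigma> ?q) (\<rho> (Suc ?q))) (0\<^sub>m (\<rho> ?q) (\<sigma> (Suc ?q))) (M ?q)"
  let ?B = "(x \<cdot>\<^sub>m 1\<^sub>m (\<sigma> ?q)) @\<^sub>r - \<Lambda> ?q"
  let ?C = "0\<^sub>m (cone_tail \<sigma> p) (\<sigma> (Suc ?q) + \<rho> (Suc ?q)) :: ('v, 'k) mpol mat"
  let ?D = "if p = 0 then 0\<^sub>m 0 (\<sigma> 1) else - N p"
  have cN: "N ?q \<in> carrier_mat (\<sigma> ?q) (\<sigma> (Suc ?q))" and cM: "M ?q \<in> carrier_mat (\<rho> ?q) (\<rho> (Suc ?q))"
    and cL: "\<Lambda> ?q \<in> carrier_mat (\<rho> ?q) (\<sigma> ?q)" and cNp: "N p \<in> carrier_mat (\<sigma> p) (\<sigma> ?q)"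
    using aug_carrier[OF J] aug_carrier[OF K] pring_matD[OF \<Lambda>(1)] by blast+
  have A: "?A \<in> carrier_mat (\<sigma> ?q + \<rho> ?q) (\<sigma> (Suc ?q) + \<rho> (Suc ?q))"
    using cN cM by (rule four_block_carrier_mat)
  have B: "?B \<in> carrier_mat (\<sigma> ?q + \<rho> ?q) (\<sigma> ?q)"
    using cL by (intro carrier_append_rows) auto
  have D: "?D \<in> carrier_mat (cone_tail \<sigma> p) (\<sigma> ?q)"
    using cNp by (auto simp: cone_tail_def)
  have uv: "u @\<^sub>v v \<in> carrier_vec (\<sigma> (Suc ?q) + \<rho> (Suc ?q))" using u v by simp
  have Au: "?A *\<^sub>v (u @\<^sub>v v) = (N ?q *\<^sub>v u) @\<^sub>v (M ?q *\<^sub>v v)"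
  proof -
    have "?A *\<^sub>v (u @\<^sub>v v) = (N ?q *\<^sub>v u + 0\<^sub>m (\<sigma> ?q) (\<rho> (Suc ?q)) *\<^sub>v v) @\<^sub>v
        (0\<^sub>m (\<rho> ?q) (\<sigma> (Suc ?q)) *\<^sub>v u + M ?q *\<^sub>v v)"
      by (rule four_block_mat_mult_vec[OF cN _ _ cM u v]) auto
    also have "\<dots> = (N ?q *\<^sub>v u) @\<^sub>v (M ?q *\<^sub>v v)"
      unfolding zero_mat_mult_vec[OF u] zero_mat_mult_vec[OF v]
      using mult_mat_vec_carrier[OF cN u] mult_mat_vec_carrier[OF cM v] by simp
    finally show ?thesis .
  qed
  have Bw: "?B *\<^sub>v w = (x \<cdot>\<^sub>v w) @\<^sub>v ((-1) \<cdot>\<^sub>v (\<Lambda> ?q *\<^sub>v w))"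
  proof -
    have "?B *\<^sub>v w = ((x \<cdot>\<^sub>m 1\<^sub>m (\<sigma> ?q)) *\<^sub>v w) @\<^sub>v (- \<Lambda> ?q *\<^sub>v w)"
      by (rule mat_mult_append[OF _ _ w]) (use cL in auto)
    moreover have "(x \<cdot>\<^sub>m 1\<^sub>m (\<sigma> ?q)) *\<^sub>v w = x \<cdot>\<^sub>v w"
      using w by (intro eq_vecI) auto
    moreover have "- \<Lambda> ?q *\<^sub>v w = (-1) \<cdot>\<^sub>v (\<Lambda> ?q *\<^sub>v w)"
      using cL w by (intro eq_vecI) auto
    ultimately show ?thesis by simp
  qed
  have Dw: "?D *\<^sub>v w = (if p = 0 then 0\<^sub>v 0 else (-1) \<cdot>\<^sub>v (N p *\<^sub>v w))"
    using cNp w by (intro eq_vecI) auto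
  have C0: "?C *\<^sub>v (u @\<^sub>v v) = 0\<^sub>v (cone_tail \<sigma> p)"
    using uv by (intro eq_vecI) auto
  have "cone \<sigma> \<rho> N M \<Lambda> x ?q = four_block_mat ?A ?B ?C ?D"
    by (simp add: cone_def)
  then have "cone \<sigma> \<rho> N M \<Lambda> x ?q *\<^sub>v ((u @\<^sub>v v) @\<^sub>v w) =
      (?A *\<^sub>v (u @\<^sub>v v) + ?B *\<^sub>v w) @\<^sub>v (?C *\<^sub>v (u @\<^sub>v v) + ?D *\<^sub>v w)"
    using four_block_mat_mult_vec[OF A B _ D uv w, of ?C] by simp
  also have "?A *\<^sub>v (u @\<^sub>v v) + ?B *\<^sub>v w =
      (N ?q *\<^sub>v u + x \<cdot>\<^sub>v w) @\<^sub>v (M ?q *\<^sub>v v + (-1) \<cdot>\<^sub>v (\<Lambda> ?q *\<^sub>v w))"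
    unfolding Au Bw
    by (rule append_vec_add) (use cN cM cL u v w in \<open>auto intro!: mult_mat_vec_carrier\<close>)
  also have "?C *\<^sub>v (u @\<^sub>v v) + ?D *\<^sub>v w = ?D *\<^sub>v w"
    unfolding C0 using D w by simp
  finally show ?thesis unfolding Dw .
qed

text \<open>The diagram chase for exactness. The vanishing of \<open>N p w\<close> follows from the
  first equation: applying \<open>N p\<close> leaves \<open>x\<close> times it, and \<open>x\<close>
  is a nonzerodivisor. This also settles \<open>p = 0\<close>, where the cone has no third component
  to supply that equation.\<close>

lemma cone_kernel_Suc:
  assumes u: "u \<in> free_mod V (\<sigma> (Suc (Suc p)))" and v: "v \<in> free_mod V (\<rho> (Suc (Suc p)))"
    and w: "w \<in> free_mod V (\<sigma> (Suc p))"
    and 1: "N (Suc p) *\<^sub>v u + x \<cdot>\<^sub>v w = 0\<^sub>v (\<sigma> (Suc p))"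
    and 2: "M (Suc p) *\<^sub>v v + (-1) \<cdot>\<^sub>v (\<Lambda> (Suc p) *\<^sub>v w) = 0\<^sub>v (\<rho> (Suc p))"
  shows "\<exists>u'\<in>free_mod V (\<sigma> (Suc (Suc (Suc p)))). \<exists>v'\<in>free_mod V (\<rho> (Suc (Suc (Suc p)))).
    \<exists>w'\<in>free_mod V (\<sigma> (Suc (Suc p))). u = N (Suc (Suc p)) *\<^sub>v u' + x \<cdot>\<^sub>v w' \<and>
      v = M (Suc (Suc p)) *\<^sub>v v' + (-1) \<cdot>\<^sub>v (\<Lambda> (Suc (Suc p)) *\<^sub>v w') \<and>
      w = (-1) \<cdot>\<^sub>v (N (Suc p) *\<^sub>v w')"
proof -
  let ?q = "Suc p"
  have cN: "N q \<in> carrier_mat (\<sigma> q) (\<sigma> (Suc q))" and cM: "M q \<in> carrier_mat (\<rho> q) (\<rho> (Suc q))"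
    and cL: "\<Lambda> q \<in> carrier_mat (\<rho> q) (\<sigma> q)" for q
    using aug_carrier[OF J] aug_carrier[OF K] pring_matD[OF \<Lambda>(1)] by blast+
  note fu = free_modD[OF u] and fv = free_modD[OF v] and fw = free_modD[OF w]
  have "N p *\<^sub>v (N ?q *\<^sub>v u + x \<cdot>\<^sub>v w) = N p *\<^sub>v (N ?q *\<^sub>v u) + x \<cdot>\<^sub>v (N p *\<^sub>v w)"
    by (rule mult_mat_vec_lin[OF cN mult_mat_vec_carrier[OF cN fu] fw])
  then have "0\<^sub>v (\<sigma> p) = 0\<^sub>v (\<sigma> p) + x \<cdot>\<^sub>v (N p *\<^sub>v w)"
    unfolding 1 aug_comp_vec[OF J u] mat_mult_zero_vec[OF cN] .
  then have xw: "x \<cdot>\<^sub>v (N p *\<^sub>v w) = 0\<^sub>v (\<sigma> p)"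
    using mult_mat_vec_carrier[OF cN fw] by simp
  have "N p *\<^sub>v w = 0\<^sub>v (\<sigma> p)"
  proof (rule eq_vecI)
    fix i assume i: "i < dim_vec (0\<^sub>v (\<sigma> p))"
    then have "x * (N p *\<^sub>v w) $ i = 0"
      using arg_cong[OF xw, of "\<lambda>v. v $ i"] cN[of p] by simp
    then show "(N p *\<^sub>v w) $ i = 0\<^sub>v (\<sigma> p) $ i" using nzd i by simp
  qed (use cN[of p] in simp)
  from aug_kernelE[OF J w this] obtain w0
    where w0: "w0 \<in> free_mod V (\<sigma> (Suc ?q))" "w = N ?q *\<^sub>v w0" by blast
  \<comment> \<open>The sign compensates the one in the bottom block of the cone, so that
    \<open>w = - N w'\<close>.\<close>
  define w' where "w' = (-1) \<cdot>\<^sub>v w0"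
  have w': "w' \<in> free_mod V (\<sigma> (Suc ?q))"
    unfolding w'_def using w0(1) by (intro free_mod_smult) auto
  note fw' = free_modD[OF w']
  have "w = (-1) \<cdot>\<^sub>v (N ?q *\<^sub>v w')"
    unfolding w'_def w0(2) mult_smult_vec[OF cN free_modD[OF w0(1)]]
    by (rule vec_cancel(6)[symmetric])
      (use mult_mat_vec_carrier[OF cN free_modD[OF w0(1)]] in \<open>assumption\<close>)+
  note w_eq = this
  have Nw': "N ?q *\<^sub>v w' \<in> carrier_vec (\<sigma> ?q)" by (rule mult_mat_vec_carrier[OF cN fw'])
  \<comment> \<open>With \<open>w = - N w'\<close> the first equation becomes
    \<open>N (u - x w') = 0\<close>.\<close>
  have "N ?q *\<^sub>v (u + (-x) \<cdot>\<^sub>v w') = N ?q *\<^sub>v u + (-x) \<cdot>\<^sub>v (N ?q *\<^sub>v w')"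
    by (rule mult_mat_vec_lin[OF cN fu fw'])
  also have "\<dots> = N ?q *\<^sub>v u + x \<cdot>\<^sub>v w"
    unfolding w_eq
    by (rule vec_cancel(3)[symmetric, OF Nw' mult_mat_vec_carrier[OF cN fu]])
  finally have ker: "N ?q *\<^sub>v (u + (-x) \<cdot>\<^sub>v w') = 0\<^sub>v (\<sigma> ?q)" using 1 by simp
  have mem: "u + (-x) \<cdot>\<^sub>v w' \<in> free_mod V (\<sigma> (Suc ?q))"
    using u w' x by (intro free_mod_add free_mod_smult) auto
  obtain u' where u': "u' \<in> free_mod V (\<sigma> (Suc (Suc ?q)))"
      "u + (-x) \<cdot>\<^sub>v w' = N (Suc ?q) *\<^sub>v u'"
    using aug_kernelE[OF J mem ker] by blast
  have u_eq: "u = N (Suc ?q) *\<^sub>v u' + x \<cdot>\<^sub>v w'"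
    unfolding u'(2)[symmetric] by (rule vec_cancel(5)[symmetric, OF fw' fu])
  have fL: "\<Lambda> (Suc ?q) *\<^sub>v w' \<in> free_mod V (\<rho> (Suc ?q))"
    by (rule pring_mat_mult_vec[OF \<Lambda>(1) w'])
  \<comment> \<open>The chain map relation turns the second equation into
    \<open>M (v + \<Lambda> w') = 0\<close>.\<close>
  have "M ?q *\<^sub>v (\<Lambda> (Suc ?q) *\<^sub>v w') = \<Lambda> ?q *\<^sub>v (N ?q *\<^sub>v w')"
    using assoc_mult_mat_vec[OF cM cL fw'] assoc_mult_mat_vec[OF cL cN fw'] chain[of ?q] by simp
  then have "M ?q *\<^sub>v (v + 1 \<cdot>\<^sub>v (\<Lambda> (Suc ?q) *\<^sub>v w')) =
      M ?q *\<^sub>v v + 1 \<cdot>\<^sub>v (\<Lambda> ?q *\<^sub>v (N ?q *\<^sub>v w'))"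
    using mult_mat_vec_lin[OF cM fv free_modD[OF fL], of 1] by simp
  also have "\<dots> = M ?q *\<^sub>v v + (-1) \<cdot>\<^sub>v (\<Lambda> ?q *\<^sub>v w)"
    unfolding w_eq mult_smult_vec[OF cL Nw']
    using vec_cancel(3)[OF mult_mat_vec_carrier[OF cL Nw'] mult_mat_vec_carrier[OF cM fv], of "-1"]
    by simp
  finally have ker: "M ?q *\<^sub>v (v + 1 \<cdot>\<^sub>v (\<Lambda> (Suc ?q) *\<^sub>v w')) = 0\<^sub>v (\<rho> ?q)" using 2 by simp
  have mem: "v + 1 \<cdot>\<^sub>v (\<Lambda> (Suc ?q) *\<^sub>v w') \<in> free_mod V (\<rho> (Suc ?q))"
    using v fL by (intro free_mod_add free_mod_smult) auto
  obtain v' where v': "v' \<in> free_mod V (\<rho> (Suc (Suc ?q)))"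
      "v + 1 \<cdot>\<^sub>v (\<Lambda> (Suc ?q) *\<^sub>v w') = M (Suc ?q) *\<^sub>v v'"
    using aug_kernelE[OF K mem ker] by blast
  have "v = M (Suc ?q) *\<^sub>v v' + (-1) \<cdot>\<^sub>v (\<Lambda> (Suc ?q) *\<^sub>v w')"
    unfolding v'(2)[symmetric] by (rule vec_cancel(4)[symmetric, OF free_modD[OF fL] fv])
  with u'(1) v'(1) w' u_eq w_eq show ?thesis by blast
qed

text \<open>These are the components of the composite of two consecutive cone differentials. The
  first cancels by the choice of signs, the second by the chain map relation, and the third vanishes
  because \<open>N p * N (Suc p) = 0\<close>.\<close>

lemma cone_comp_Suc:
  assumes u: "u \<in> free_mod V (\<sigma> (Suc (Suc (Suc p))))" and v: "v \<in> free_mod V (\<rho> (Suc (Suc (Suc p))))"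
    and w: "w \<in> free_mod V (\<sigma> (Suc (Suc p)))"
  shows "N (Suc p) *\<^sub>v (N (Suc (Suc p)) *\<^sub>v u + x \<cdot>\<^sub>v w) +
      x \<cdot>\<^sub>v ((-1) \<cdot>\<^sub>v (N (Suc p) *\<^sub>v w)) = 0\<^sub>v (\<sigma> (Suc p))" (is ?A)
    and "M (Suc p) *\<^sub>v (M (Suc (Suc p)) *\<^sub>v v + (-1) \<cdot>\<^sub>v (\<Lambda> (Suc (Suc p)) *\<^sub>v w)) +
      (-1) \<cdot>\<^sub>v (\<Lambda> (Suc p) *\<^sub>v ((-1) \<cdot>\<^sub>v (N (Suc p) *\<^sub>v w))) = 0\<^sub>v (\<rho> (Suc p))" (is ?B)
    and "N p *\<^sub>v ((-1) \<cdot>\<^sub>v (N (Suc p) *\<^sub>v w)) = 0\<^sub>v (\<sigma> p)" (is ?C)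
proof -
  let ?q = "Suc p"
  have cN: "N q \<in> carrier_mat (\<sigma> q) (\<sigma> (Suc q))" and cM: "M q \<in> carrier_mat (\<rho> q) (\<rho> (Suc q))"
    and cL: "\<Lambda> q \<in> carrier_mat (\<rho> q) (\<sigma> q)" for q
    using aug_carrier[OF J] aug_carrier[OF K] pring_matD[OF \<Lambda>(1)] by blast+
  note fu = free_modD[OF u] and fv = free_modD[OF v] and fw = free_modD[OF w]
  note fNw = mult_mat_vec_carrier[OF cN fw]
  show ?A
    unfolding mult_mat_vec_lin[OF cN mult_mat_vec_carrier[OF cN fu] fw] aug_comp_vec[OF J u]
    by (rule vec_cancel(1)[OF fNw fNw])
  have fLw: "\<Lambda> (Suc ?q) *\<^sub>v w \<in> carrier_vec (\<rho> (Suc ?q))"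
    by (rule mult_mat_vec_carrier[OF cL fw])
  have "M ?q *\<^sub>v (\<Lambda> (Suc ?q) *\<^sub>v w) = \<Lambda> ?q *\<^sub>v (N ?q *\<^sub>v w)"
    using assoc_mult_mat_vec[OF cM cL fw] assoc_mult_mat_vec[OF cL cN fw] chain[of ?q] by simp
  moreover have "\<Lambda> ?q *\<^sub>v (N ?q *\<^sub>v w) \<in> carrier_vec (\<rho> ?q)"
    by (rule mult_mat_vec_carrier[OF cL fNw])
  ultimately show ?B
    unfolding mult_mat_vec_lin[OF cM mult_mat_vec_carrier[OF cM fv] fLw] aug_comp_vec[OF K v]
      mult_smult_vec[OF cL fNw]
    by (simp only: vec_cancel(1))
  show ?C
    unfolding mult_smult_vec[OF cN fNw] aug_comp_vec[OF J w] by (intro eq_vecI) auto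
qed

text \<open>The bottom of the chase, where the ideals enter. Let \<open>q\<close> be the entry of
  \<open>M 0 v\<close>: the equation puts \<open>x q\<close> into \<open>J\<close>, so
  \<open>q\<close> lies in \<open>J\<close> by \<open>nzd_mod\<close>, and \<open>- q\<close> has a
  preimage \<open>w'\<close> under \<open>N 0\<close>. The rest runs as in the higher
  places.\<close>

lemma cone_kernel_0:
  assumes J_uminus: "\<And>p. p \<in> J \<Longrightarrow> - p \<in> J"
    and u: "u \<in> free_mod V (\<sigma> 1)" and v: "v \<in> free_mod V (\<rho> 1)"
    and 0: "N 0 *\<^sub>v u + x \<cdot>\<^sub>v (M 0 *\<^sub>v v) = 0\<^sub>v 1"
  shows "\<exists>u'\<in>free_mod V (\<sigma> 2). \<exists>v'\<in>free_mod V (\<rho> 2). \<exists>w'\<in>free_mod V (\<sigma> 1).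
    u = N 1 *\<^sub>v u' + x \<cdot>\<^sub>v w' \<and> v = M 1 *\<^sub>v v' + (-1) \<cdot>\<^sub>v (\<Lambda> 1 *\<^sub>v w')"
proof -
  have cN: "N q \<in> carrier_mat (\<sigma> q) (\<sigma> (Suc q))" and cM: "M q \<in> carrier_mat (\<rho> q) (\<rho> (Suc q))"
    and cL: "\<Lambda> q \<in> carrier_mat (\<rho> q) (\<sigma> q)" for q
    using aug_carrier[OF J] aug_carrier[OF K] pring_matD[OF \<Lambda>(1)] by blast+
  have cN0: "N 0 \<in> carrier_mat 1 (\<sigma> 1)" and cM0: "M 0 \<in> carrier_mat 1 (\<rho> 1)"
    and cL1: "\<Lambda> 1 \<in> carrier_mat (\<rho> 1) (\<sigma> 1)"
    using cN[of 0] cM[of 0] cL[of 1] aug_rank_0[OF J] aug_rank_0[OF K] by auto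
  note fu = free_modD[OF u] and fv = free_modD[OF v]
  have Nu: "(N 0 *\<^sub>v u) $ 0 \<in> J" using aug_image[OF J] u by blast
  have Mv: "(M 0 *\<^sub>v v) $ 0 \<in> K" using aug_image[OF K] v by blast
  have eq0: "(N 0 *\<^sub>v u) $ 0 + x * (M 0 *\<^sub>v v) $ 0 = 0"
    using arg_cong[OF 0, of "\<lambda>v. v $ 0"] cN0 cM0 by (simp del: index_mult_mat_vec)
  then have "x * (M 0 *\<^sub>v v) $ 0 = - (N 0 *\<^sub>v u) $ 0"
    by (simp only: add_eq_0_iff)
  then have "x * (M 0 *\<^sub>v v) $ 0 \<in> J" using J_uminus[OF Nu] by simp
  then have "- (M 0 *\<^sub>v v) $ 0 \<in> J" using nzd_mod[OF Mv] J_uminus by blast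
  then obtain w' where w': "w' \<in> free_mod V (\<sigma> 1)" "(N 0 *\<^sub>v w') $ 0 = - (M 0 *\<^sub>v v) $ 0"
    unfolding aug_image[OF J, symmetric] by (elim imageE) simp
  note fw' = free_modD[OF w'(1)]
  have "N 0 *\<^sub>v (u + (-x) \<cdot>\<^sub>v w') = N 0 *\<^sub>v u + (-x) \<cdot>\<^sub>v (N 0 *\<^sub>v w')"
    by (rule mult_mat_vec_lin[OF cN0 fu fw'])
  also have "\<dots> = 0\<^sub>v (\<sigma> 0)"
    using cN0 w'(2) eq0 aug_rank_0[OF J] by (intro eq_vecI) (auto simp del: index_mult_mat_vec)
  finally have ker: "N 0 *\<^sub>v (u + (-x) \<cdot>\<^sub>v w') = 0\<^sub>v (\<sigma> 0)" .
  have mem: "u + (-x) \<cdot>\<^sub>v w' \<in> free_mod V (\<sigma> (Suc 0))"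
    using u w' x by (intro free_mod_add free_mod_smult) auto
  obtain u' where u': "u' \<in> free_mod V (\<sigma> (Suc (Suc 0)))"
      "u + (-x) \<cdot>\<^sub>v w' = N (Suc 0) *\<^sub>v u'"
    using aug_kernelE[OF J mem ker] by blast
  have u_eq: "u = N 1 *\<^sub>v u' + x \<cdot>\<^sub>v w'"
    using u'(2)[symmetric] vec_cancel(5)[OF fw' fu, of x] by simp
  have fL: "\<Lambda> 1 *\<^sub>v w' \<in> free_mod V (\<rho> 1)"
    by (rule pring_mat_mult_vec[OF _ w'(1)]) (use \<Lambda>(1)[of 1] in simp)
  have "\<Lambda> 0 * N 0 = N 0" using \<Lambda>(2) cN0 by simp
  then have "M 0 *\<^sub>v (\<Lambda> 1 *\<^sub>v w') = N 0 *\<^sub>v w'"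
    using assoc_mult_mat_vec[OF cM0 cL1 fw'] chain[of 0] by simp
  then have "M 0 *\<^sub>v (v + 1 \<cdot>\<^sub>v (\<Lambda> 1 *\<^sub>v w')) = M 0 *\<^sub>v v + 1 \<cdot>\<^sub>v (N 0 *\<^sub>v w')"
    using mult_mat_vec_lin[OF cM0 fv free_modD[OF fL], of 1] by simp
  also have "\<dots> = 0\<^sub>v (\<rho> 0)"
    using cN0 cM0 w'(2) aug_rank_0[OF K] by (intro eq_vecI) (auto simp del: index_mult_mat_vec)
  finally have ker: "M 0 *\<^sub>v (v + 1 \<cdot>\<^sub>v (\<Lambda> 1 *\<^sub>v w')) = 0\<^sub>v (\<rho> 0)" .
  have mem: "v + 1 \<cdot>\<^sub>v (\<Lambda> 1 *\<^sub>v w') \<in> free_mod V (\<rho> (Suc 0))"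
    using v fL by (intro free_mod_add free_mod_smult) auto
  obtain v' where v': "v' \<in> free_mod V (\<rho> (Suc (Suc 0)))"
      "v + 1 \<cdot>\<^sub>v (\<Lambda> 1 *\<^sub>v w') = M (Suc 0) *\<^sub>v v'"
    using aug_kernelE[OF K mem ker] by blast
  have "v = M 1 *\<^sub>v v' + (-1) \<cdot>\<^sub>v (\<Lambda> 1 *\<^sub>v w')"
    using v'(2)[symmetric] vec_cancel(4)[OF free_modD[OF fL] fv, of 1] by simp
  with u'(1) v'(1) w'(1) u_eq show ?thesis by (auto simp: numeral_2_eq_2)
qed

lemma cone_comp_0:
  assumes u: "u \<in> free_mod V (\<sigma> 2)" and v: "v \<in> free_mod V (\<rho> 2)"
    and w: "w \<in> free_mod V (\<sigma> 1)"
  shows "N 0 *\<^sub>v (N 1 *\<^sub>v u + x \<cdot>\<^sub>v w) +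
      x \<cdot>\<^sub>v (M 0 *\<^sub>v (M 1 *\<^sub>v v + (-1) \<cdot>\<^sub>v (\<Lambda> 1 *\<^sub>v w))) = 0\<^sub>v 1"
proof -
  have cN: "N q \<in> carrier_mat (\<sigma> q) (\<sigma> (Suc q))" and cM: "M q \<in> carrier_mat (\<rho> q) (\<rho> (Suc q))"
    and cL: "\<Lambda> q \<in> carrier_mat (\<rho> q) (\<sigma> q)" for q
    using aug_carrier[OF J] aug_carrier[OF K] pring_matD[OF \<Lambda>(1)] by blast+
  have cN0: "N 0 \<in> carrier_mat 1 (\<sigma> 1)" and cM0: "M 0 \<in> carrier_mat 1 (\<rho> 1)"
    and cL1: "\<Lambda> 1 \<in> carrier_mat (\<rho> 1) (\<sigma> 1)" and cN1: "N 1 \<in> carrier_mat (\<sigma> 1) (\<sigma> 2)"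
    and cM1: "M 1 \<in> carrier_mat (\<rho> 1) (\<rho> 2)"
    using cN[of 0] cM[of 0] cN[of 1] cM[of 1] cL[of 1] aug_rank_0[OF J] aug_rank_0[OF K]
    by (auto simp: numeral_2_eq_2)
  note fu = free_modD[OF u] and fv = free_modD[OF v] and fw = free_modD[OF w]
  have "\<Lambda> 0 * N 0 = N 0" using \<Lambda>(2) cN0 by simp
  then have L: "M 0 *\<^sub>v (\<Lambda> 1 *\<^sub>v w) = N 0 *\<^sub>v w"
    using assoc_mult_mat_vec[OF cM0 cL1 fw] chain[of 0] by simp
  have 1: "N 0 *\<^sub>v (N 1 *\<^sub>v u) = 0\<^sub>v 1" and 2: "M 0 *\<^sub>v (M 1 *\<^sub>v v) = 0\<^sub>v 1"
    using aug_comp_vec[OF J, of u 0] aug_comp_vec[OF K, of v 0] u v aug_rank_0[OF J] aug_rank_0[OF K]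
    by (auto simp: numeral_2_eq_2)
  show ?thesis
    unfolding mult_mat_vec_lin[OF cN0 mult_mat_vec_carrier[OF cN1 fu] fw]
      mult_mat_vec_lin[OF cM0 mult_mat_vec_carrier[OF cM1 fv] mult_mat_vec_carrier[OF cL1 fw]] L 1 2
    by (rule vec_cancel(2)) (rule mult_mat_vec_carrier[OF cN0 fw])+
qed

text \<open>The two inclusions of each exactness statement are the chase and the vanishing of the
  composites. Index 0 is separate since the target of the cone there is one copy of the ring instead
  of a sum of blocks.\<close>

lemma cone_resolution:
  assumes J_uminus: "\<And>p. p \<in> J \<Longrightarrow> - p \<in> J"
  shows "aug_resolution V I (cone_rank \<sigma> \<rho>) (cone \<sigma> \<rho> N M \<Lambda> x)"
proof -
  let ?R = "cone_rank \<sigma> \<rho>" and ?C = "cone \<sigma> \<rho> N M \<Lambda> x"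
  have R1: "?R 1 = \<sigma> 1 + \<rho> 1" by (simp add: cone_rank_def cone_tail_def)
  have RSS: "?R (Suc (Suc p)) = (\<sigma> (Suc (Suc p)) + \<rho> (Suc (Suc p))) + \<sigma> (Suc p)" for p
    by (simp add: cone_rank_def cone_tail_def)
  have cN: "N q \<in> carrier_mat (\<sigma> q) (\<sigma> (Suc q))" and cM: "M q \<in> carrier_mat (\<rho> q) (\<rho> (Suc q))"
    and cL: "\<Lambda> q \<in> carrier_mat (\<rho> q) (\<sigma> q)" for q
    using aug_carrier[OF J] aug_carrier[OF K] pring_matD[OF \<Lambda>(1)] by blast+
  have img: "(\<lambda>v. (?C 0 *\<^sub>v v) $ 0) ` free_mod V (?R 1) = I"
  proof
    show "(\<lambda>v. (?C 0 *\<^sub>v v) $ 0) ` free_mod V (?R 1) \<subseteq> I"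
    proof (clarify)
      fix z :: "('v, 'k) mpol vec" assume "z \<in> free_mod V (?R 1)"
      then obtain u v where uv: "u \<in> free_mod V (\<sigma> 1)" "v \<in> free_mod V (\<rho> 1)" "z = u @\<^sub>v v"
        unfolding R1 by (rule free_mod_splitE)
      have "(?C 0 *\<^sub>v z) $ 0 = (N 0 *\<^sub>v u) $ 0 + x * (M 0 *\<^sub>v v) $ 0"
        unfolding uv(3) cone_0_vec[OF free_modD[OF uv(1)] free_modD[OF uv(2)]]
        using cN[of 0] cM[of 0] aug_rank_0[OF J] aug_rank_0[OF K] by (simp del: index_mult_mat_vec)
      moreover have "(N 0 *\<^sub>v u) $ 0 \<in> J" using aug_image[OF J] uv(1) by blast
      moreover have "(M 0 *\<^sub>v v) $ 0 \<in> K" using aug_image[OF K] uv(2) by blast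
      ultimately show "(?C 0 *\<^sub>v z) $ 0 \<in> I" using I by blast
    qed
    show "I \<subseteq> (\<lambda>v. (?C 0 *\<^sub>v v) $ 0) ` free_mod V (?R 1)"
    proof
      fix r assume "r \<in> I"
      then obtain p q where r: "r = p + x * q" and "p \<in> J" "q \<in> K" using I by blast
      then obtain u v where u: "u \<in> free_mod V (\<sigma> 1)" "p = (N 0 *\<^sub>v u) $ 0"
        and v: "v \<in> free_mod V (\<rho> 1)" "q = (M 0 *\<^sub>v v) $ 0"
        using aug_image[OF J] aug_image[OF K] by blast
      have "(?C 0 *\<^sub>v (u @\<^sub>v v)) $ 0 = r"
        unfolding r u(2) v(2) cone_0_vec[OF free_modD[OF u(1)] free_modD[OF v(1)]]
        using cN[of 0] cM[of 0] aug_rank_0[OF J] aug_rank_0[OF K] by (simp del: index_mult_mat_vec)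
      moreover have "u @\<^sub>v v \<in> free_mod V (?R 1)" unfolding R1 using u v by simp
      ultimately show "r \<in> (\<lambda>v. (?C 0 *\<^sub>v v) $ 0) ` free_mod V (?R 1)" by blast
    qed
  qed
  have ex0: "{v \<in> free_mod V (?R (Suc 0)). ?C 0 *\<^sub>v v = 0\<^sub>v (?R 0)} =
       (\<lambda>w. ?C (Suc 0) *\<^sub>v w) ` free_mod V (?R (Suc (Suc 0)))"
  proof -
    have C1: "?C (Suc 0) *\<^sub>v ((u @\<^sub>v v) @\<^sub>v w) =
        (N 1 *\<^sub>v u + x \<cdot>\<^sub>v w) @\<^sub>v (M 1 *\<^sub>v v + (-1) \<cdot>\<^sub>v (\<Lambda> 1 *\<^sub>v w))"
      if "u \<in> free_mod V (\<sigma> 2)" "v \<in> free_mod V (\<rho> 2)" "w \<in> free_mod V (\<sigma> 1)" for u v w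
      using cone_Suc_vec[of u 0 v w] that[THEN free_modD]
      by (simp add: numeral_2_eq_2 append_vec_dim_0)
    have R2: "?R (Suc (Suc 0)) = (\<sigma> 2 + \<rho> 2) + \<sigma> 1"
      unfolding RSS by (simp add: numeral_2_eq_2)
    have R0: "?R 0 = 1" by (simp add: cone_rank_def)
    show ?thesis
    proof (intro equalityI subsetI)
      fix z assume "z \<in> {v \<in> free_mod V (?R (Suc 0)). ?C 0 *\<^sub>v v = 0\<^sub>v (?R 0)}"
      then have z: "z \<in> free_mod V (\<sigma> 1 + \<rho> 1)" "?C 0 *\<^sub>v z = 0\<^sub>v 1"
        using R1 R0 by simp_all
      from z(1) obtain u v where uv: "u \<in> free_mod V (\<sigma> 1)" "v \<in> free_mod V (\<rho> 1)" "z = u @\<^sub>v v"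
        by (rule free_mod_splitE)
      have "N 0 *\<^sub>v u + x \<cdot>\<^sub>v (M 0 *\<^sub>v v) = 0\<^sub>v 1"
        using z(2) unfolding uv(3) cone_0_vec[OF free_modD[OF uv(1)] free_modD[OF uv(2)]] .
      from cone_kernel_0[OF J_uminus uv(1,2) this] obtain u' v' w'
        where *: "u' \<in> free_mod V (\<sigma> 2)" "v' \<in> free_mod V (\<rho> 2)" "w' \<in> free_mod V (\<sigma> 1)"
          "u = N 1 *\<^sub>v u' + x \<cdot>\<^sub>v w'" "v = M 1 *\<^sub>v v' + (-1) \<cdot>\<^sub>v (\<Lambda> 1 *\<^sub>v w')" by blast
      then have "z = ?C (Suc 0) *\<^sub>v ((u' @\<^sub>v v') @\<^sub>v w')"
        using C1[OF *(1-3)] uv(3) by simp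
      moreover have "(u' @\<^sub>v v') @\<^sub>v w' \<in> free_mod V (?R (Suc (Suc 0)))"
        unfolding R2 using * by (intro free_mod_append)
      ultimately show "z \<in> (\<lambda>w. ?C (Suc 0) *\<^sub>v w) ` free_mod V (?R (Suc (Suc 0)))" by blast
    next
      fix z assume "z \<in> (\<lambda>w. ?C (Suc 0) *\<^sub>v w) ` free_mod V (?R (Suc (Suc 0)))"
      then obtain z' where z': "z' \<in> free_mod V ((\<sigma> 2 + \<rho> 2) + \<sigma> 1)" "z = ?C (Suc 0) *\<^sub>v z'"
        unfolding R2 by blast
      from z'(1) obtain y w where y: "y \<in> free_mod V (\<sigma> 2 + \<rho> 2)" "w \<in> free_mod V (\<sigma> 1)" "z' = y @\<^sub>v w"
        by (rule free_mod_splitE)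
      from y(1) obtain u v where uv: "u \<in> free_mod V (\<sigma> 2)" "v \<in> free_mod V (\<rho> 2)" "y = u @\<^sub>v v"
        by (rule free_mod_splitE)
      have z: "z = (N 1 *\<^sub>v u + x \<cdot>\<^sub>v w) @\<^sub>v (M 1 *\<^sub>v v + (-1) \<cdot>\<^sub>v (\<Lambda> 1 *\<^sub>v w))"
        using C1[OF uv(1,2) y(2)] z'(2) y(3) uv(3) by simp
      have "z \<in> free_mod V (?R (Suc 0))"
        unfolding z'(2) by (rule pring_mat_mult_vec[OF cone_mat]) (use z'(1) R2 in simp)
      moreover have "?C 0 *\<^sub>v z = 0\<^sub>v 1"
        unfolding z
        by (subst cone_0_vec)
          (use cone_comp_0[OF uv(1,2) y(2)] uv(1,2)[THEN free_modD] y(2)[THEN free_modD]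
             cN[of 1] cM[of 1] cL[of 1] in \<open>auto simp: numeral_2_eq_2\<close>)
      ultimately show "z \<in> {v \<in> free_mod V (?R (Suc 0)). ?C 0 *\<^sub>v v = 0\<^sub>v (?R 0)}"
        using R0 by simp
    qed
  qed
  have exS: "{v \<in> free_mod V (?R (Suc (Suc p))). ?C (Suc p) *\<^sub>v v = 0\<^sub>v (?R (Suc p))} =
       (\<lambda>w. ?C (Suc (Suc p)) *\<^sub>v w) ` free_mod V (?R (Suc (Suc (Suc p))))" for p
  proof -
    have RS: "?R (Suc p) = (\<sigma> (Suc p) + \<rho> (Suc p)) + cone_tail \<sigma> p"
      by (simp add: cone_rank_def)
    have CSS: "?C (Suc (Suc p)) *\<^sub>v ((u @\<^sub>v v) @\<^sub>v w) =
        ((N (Suc (Suc p)) *\<^sub>v u + x \<cdot>\<^sub>v w) @\<^sub>v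
         (M (Suc (Suc p)) *\<^sub>v v + (-1) \<cdot>\<^sub>v (\<Lambda> (Suc (Suc p)) *\<^sub>v w))) @\<^sub>v
        ((-1) \<cdot>\<^sub>v (N (Suc p) *\<^sub>v w))"
      if "u \<in> free_mod V (\<sigma> (Suc (Suc (Suc p))))" "v \<in> free_mod V (\<rho> (Suc (Suc (Suc p))))"
        "w \<in> free_mod V (\<sigma> (Suc (Suc p)))" for u v w
      using cone_Suc_vec[OF that[THEN free_modD]] by simp
    \<comment> \<open>The third condition is guarded because for \<open>p = 0\<close> the last
      component is the empty vector, whose equation is void.\<close>
    have kernel: "?C (Suc p) *\<^sub>v ((u @\<^sub>v v) @\<^sub>v w) = 0\<^sub>v (?R (Suc p)) \<longleftrightarrow>
        N (Suc p) *\<^sub>v u + x \<cdot>\<^sub>v w = 0\<^sub>v (\<sigma> (Suc p)) \<and>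
        M (Suc p) *\<^sub>v v + (-1) \<cdot>\<^sub>v (\<Lambda> (Suc p) *\<^sub>v w) = 0\<^sub>v (\<rho> (Suc p)) \<and>
        (p \<noteq> 0 \<longrightarrow> (-1) \<cdot>\<^sub>v (N p *\<^sub>v w) = 0\<^sub>v (\<sigma> p))"
      if "u \<in> free_mod V (\<sigma> (Suc (Suc p)))" "v \<in> free_mod V (\<rho> (Suc (Suc p)))"
        "w \<in> free_mod V (\<sigma> (Suc p))" for u v w
    proof -
      note f = that[THEN free_modD]
      have 1: "N (Suc p) *\<^sub>v u + x \<cdot>\<^sub>v w \<in> carrier_vec (\<sigma> (Suc p))"
        using mult_mat_vec_carrier[OF cN f(1)] f(3) by simp
      have 2: "M (Suc p) *\<^sub>v v + (-1) \<cdot>\<^sub>v (\<Lambda> (Suc p) *\<^sub>v w) \<in> carrier_vec (\<rho> (Suc p))"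
        using mult_mat_vec_carrier[OF cM f(2)] mult_mat_vec_carrier[OF cL f(3)] by simp
      have 3: "(if p = 0 then 0\<^sub>v 0 else (-1) \<cdot>\<^sub>v (N p *\<^sub>v w)) \<in> carrier_vec (cone_tail \<sigma> p)"
        using mult_mat_vec_carrier[OF cN f(3)] by (simp add: cone_tail_def)
      have 12: "(N (Suc p) *\<^sub>v u + x \<cdot>\<^sub>v w) @\<^sub>v (M (Suc p) *\<^sub>v v + (-1) \<cdot>\<^sub>v (\<Lambda> (Suc p) *\<^sub>v w))
          \<in> carrier_vec (\<sigma> (Suc p) + \<rho> (Suc p))"
        using 1 2 by (rule append_carrier_vec)
      show ?thesis
        unfolding cone_Suc_vec[OF f] RS append_vec_eq_0_iff[OF 12 3] append_vec_eq_0_iff[OF 1 2]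
        by (auto simp: cone_tail_def)
    qed
    show ?thesis
    proof (intro equalityI subsetI)
      fix z assume "z \<in> {v \<in> free_mod V (?R (Suc (Suc p))). ?C (Suc p) *\<^sub>v v = 0\<^sub>v (?R (Suc p))}"
      then have z: "z \<in> free_mod V ((\<sigma> (Suc (Suc p)) + \<rho> (Suc (Suc p))) + \<sigma> (Suc p))"
          "?C (Suc p) *\<^sub>v z = 0\<^sub>v (?R (Suc p))"
        using RSS by simp_all
      from z(1) obtain y w where y: "y \<in> free_mod V (\<sigma> (Suc (Suc p)) + \<rho> (Suc (Suc p)))"
          "w \<in> free_mod V (\<sigma> (Suc p))" "z = y @\<^sub>v w"
        by (rule free_mod_splitE)
      from y(1) obtain u v where uv: "u \<in> free_mod V (\<sigma> (Suc (Suc p)))"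
          "v \<in> free_mod V (\<rho> (Suc (Suc p)))" "y = u @\<^sub>v v"
        by (rule free_mod_splitE)
      have "N (Suc p) *\<^sub>v u + x \<cdot>\<^sub>v w = 0\<^sub>v (\<sigma> (Suc p))"
        "M (Suc p) *\<^sub>v v + (-1) \<cdot>\<^sub>v (\<Lambda> (Suc p) *\<^sub>v w) = 0\<^sub>v (\<rho> (Suc p))"
        using z(2) kernel[OF uv(1,2) y(2)] unfolding y(3) uv(3) by blast+
      from cone_kernel_Suc[OF uv(1,2) y(2) this] obtain u' v' w'
        where *: "u' \<in> free_mod V (\<sigma> (Suc (Suc (Suc p))))" "v' \<in> free_mod V (\<rho> (Suc (Suc (Suc p))))"
          "w' \<in> free_mod V (\<sigma> (Suc (Suc p)))"
          "u = N (Suc (Suc p)) *\<^sub>v u' + x \<cdot>\<^sub>v w'"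
          "v = M (Suc (Suc p)) *\<^sub>v v' + (-1) \<cdot>\<^sub>v (\<Lambda> (Suc (Suc p)) *\<^sub>v w')"
          "w = (-1) \<cdot>\<^sub>v (N (Suc p) *\<^sub>v w')" by blast
      then have "z = ?C (Suc (Suc p)) *\<^sub>v ((u' @\<^sub>v v') @\<^sub>v w')"
        unfolding CSS[OF *(1-3)] y(3) uv(3) by simp
      moreover have "(u' @\<^sub>v v') @\<^sub>v w' \<in> free_mod V (?R (Suc (Suc (Suc p))))"
        unfolding RSS using * by (intro free_mod_append)
      ultimately show "z \<in> (\<lambda>w. ?C (Suc (Suc p)) *\<^sub>v w) ` free_mod V (?R (Suc (Suc (Suc p))))" by blast
    next
      fix z assume "z \<in> (\<lambda>w. ?C (Suc (Suc p)) *\<^sub>v w) ` free_mod V (?R (Suc (Suc (Suc p))))"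
      then obtain z' where z': "z' \<in> free_mod V (?R (Suc (Suc (Suc p))))" "z = ?C (Suc (Suc p)) *\<^sub>v z'"
        by blast
      from z'(1) obtain y w where y: "y \<in> free_mod V (\<sigma> (Suc (Suc (Suc p))) + \<rho> (Suc (Suc (Suc p))))"
          "w \<in> free_mod V (\<sigma> (Suc (Suc p)))" "z' = y @\<^sub>v w"
        unfolding RSS by (rule free_mod_splitE)
      from y(1) obtain u v where uv: "u \<in> free_mod V (\<sigma> (Suc (Suc (Suc p))))"
          "v \<in> free_mod V (\<rho> (Suc (Suc (Suc p))))" "y = u @\<^sub>v v"
        by (rule free_mod_splitE)
      have F: "N (Suc (Suc p)) *\<^sub>v u + x \<cdot>\<^sub>v w \<in> free_mod V (\<sigma> (Suc (Suc p)))"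
        "M (Suc (Suc p)) *\<^sub>v v + (-1) \<cdot>\<^sub>v (\<Lambda> (Suc (Suc p)) *\<^sub>v w) \<in> free_mod V (\<rho> (Suc (Suc p)))"
        "(-1) \<cdot>\<^sub>v (N (Suc p) *\<^sub>v w) \<in> free_mod V (\<sigma> (Suc p))"
        using pring_mat_mult_vec[OF aug_mat[OF J] uv(1)] pring_mat_mult_vec[OF aug_mat[OF K] uv(2)]
          pring_mat_mult_vec[OF \<Lambda>(1) y(2)] pring_mat_mult_vec[OF aug_mat[OF J] y(2)] y(2) x
        by simp_all
      have "z \<in> free_mod V (?R (Suc (Suc p)))"
        unfolding z'(2) by (rule pring_mat_mult_vec[OF cone_mat z'(1)])
      moreover have "?C (Suc p) *\<^sub>v z = 0\<^sub>v (?R (Suc p))"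
        unfolding z'(2) y(3) uv(3) CSS[OF uv(1,2) y(2)] kernel[OF F]
      proof (intro conjI impI)
        show "(-1) \<cdot>\<^sub>v (N p *\<^sub>v ((-1) \<cdot>\<^sub>v (N (Suc p) *\<^sub>v w))) = 0\<^sub>v (\<sigma> p)"
          unfolding cone_comp_Suc(3)[OF uv(1,2) y(2)] by (intro eq_vecI) auto
      qed (use cone_comp_Suc(1,2)[OF uv(1,2) y(2)] in blast)+
      ultimately show "z \<in> {v \<in> free_mod V (?R (Suc (Suc p))). ?C (Suc p) *\<^sub>v v = 0\<^sub>v (?R (Suc p))}"
        by simp
    qed
  qed
  have "{v \<in> free_mod V (?R (Suc q)). ?C q *\<^sub>v v = 0\<^sub>v (?R q)} =
       (\<lambda>w. ?C (Suc q) *\<^sub>v w) ` free_mod V (?R (Suc (Suc q)))" for q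
    using ex0 exS by (cases q) simp_all
  moreover have "?R 0 = 1" by (simp add: cone_rank_def)
  ultimately show ?thesis
    unfolding aug_resolution_def using img cone_mat by blast
qed

text \<open>Multiplication by the linear form \<open>x\<close> raises the degree of
  \<open>M 0\<close> to that of \<open>N 0\<close>, and the identity block scaled by
  \<open>x\<close> is as linear as the differentials.\<close>

lemma hom_mat_cone:
  assumes "hom_mat d (N 0)" "hom_mat e (M 0)" "homogeneous 1 x" "d = 1 + e"
    and "\<And>q. hom_mat 1 (N (Suc q))" "\<And>q. hom_mat 1 (M (Suc q))" "\<And>q. hom_mat 1 (\<Lambda> (Suc q))"
  shows "hom_mat d (cone \<sigma> \<rho> N M \<Lambda> x 0)" "hom_mat 1 (cone \<sigma> \<rho> N M \<Lambda> x (Suc p))"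
proof -
  have cN: "N q \<in> carrier_mat (\<sigma> q) (\<sigma> (Suc q))" and cM: "M q \<in> carrier_mat (\<rho> q) (\<rho> (Suc q))"
    and cL: "\<Lambda> q \<in> carrier_mat (\<rho> q) (\<sigma> q)" for q
    using aug_carrier[OF J] aug_carrier[OF K] pring_matD[OF \<Lambda>(1)] by blast+
  show "hom_mat d (cone \<sigma> \<rho> N M \<Lambda> x 0)"
    unfolding cone_def nat.case
    by (rule hom_mat_four_block[of _ 1 "\<sigma> 1" _ "\<rho> 1" _ 0])
      (use assms cN[of 0] cM[of 0] aug_rank_0[OF J] aug_rank_0[OF K] in \<open>auto intro: hom_mat_smult\<close>)
  let ?q = "Suc p"
  have 1: "hom_mat 1 (four_block_mat (N ?q) (0\<^sub>m (\<sigma> ?q) (\<rho> (Suc ?q))) (0\<^sub>m (\<rho> ?q) (\<sigma> (Suc ?q))) (M ?q))"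
    by (rule hom_mat_four_block[OF cN _ _ cM]) (use assms in auto)
  have "hom_mat 1 (x \<cdot>\<^sub>m 1\<^sub>m (\<sigma> ?q))"
    using hom_mat_smult[OF assms(3) hom_mat_one] by simp
  then have 2: "hom_mat 1 ((x \<cdot>\<^sub>m 1\<^sub>m (\<sigma> ?q)) @\<^sub>r - \<Lambda> ?q)"
    by (intro hom_mat_append_rows[of _ "\<sigma> ?q" "\<sigma> ?q" _ "\<rho> ?q"]) (use assms cL[of ?q] in auto)
  \<comment> \<open>Only differentials \<open>N p\<close> with \<open>p > 0\<close> stand in the
    bottom block, so \<open>N 0\<close>, whose degree is \<open>d\<close>, does not disturb
    linearity.\<close>
  have 3: "hom_mat 1 (if p = 0 then 0\<^sub>m 0 (\<sigma> 1) else - N p)"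
    using assms(5) by (cases p) auto
  show "hom_mat 1 (cone \<sigma> \<rho> N M \<Lambda> x (Suc p))"
    unfolding cone_def nat.case
    by (rule hom_mat_four_block[OF four_block_carrier_mat[OF cN cM] carrier_append_rows[of _ _ "\<sigma> ?q"] zero_carrier_mat _ 1 2 _ 3])
      (use cL[of ?q] cN[of p] in \<open>auto simp: cone_tail_def\<close>)
qed

end

lemma linear_resolution_cone:
  fixes I J K :: "('v, 'k::field) mpol set"
  assumes J: "linear_resolution V J (d + 1) \<sigma> N" and K: "linear_resolution V K d \<rho> M"
    and "J \<subseteq> K" "\<And>p. p \<in> J \<Longrightarrow> - p \<in> J"
    and x: "x \<in> carrier (pring V)" "homogeneous 1 x" "\<And>p. x * p = 0 \<Longrightarrow> p = 0"
    and "\<And>p. p \<in> K \<Longrightarrow> x * p \<in> J \<Longrightarrow> p \<in> J"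
    and "I = {p + x * q | p q. p \<in> J \<and> q \<in> K}"
  shows "\<exists>C. linear_resolution V I (d + 1) (cone_rank \<sigma> \<rho>) C"
proof -
  obtain \<Lambda> where \<Lambda>: "\<And>q. \<Lambda> q \<in> pring_mat V (\<rho> q) (\<sigma> q)" "\<Lambda> 0 = 1\<^sub>m 1"
      "\<And>q. M q * \<Lambda> (Suc q) = \<Lambda> q * N q" "\<And>q. hom_mat 1 (\<Lambda> (Suc q))"
    using ex_linear_chain_map[OF J K \<open>J \<subseteq> K\<close>] by blast
  from J K have J': "aug_resolution V J \<sigma> N" "hom_mat (d + 1) (N 0)" "\<And>q. hom_mat 1 (N (Suc q))"
    and K': "aug_resolution V K \<rho> M" "hom_mat d (M 0)" "\<And>q. hom_mat 1 (M (Suc q))"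
    by (auto simp: linear_resolution_def)
  have "aug_resolution V I (cone_rank \<sigma> \<rho>) (cone \<sigma> \<rho> N M \<Lambda> x)"
    by (rule cone_resolution[OF J'(1) K'(1) \<Lambda>(1-3) x(1,3) assms(8,9,4)])
  moreover have "hom_mat (d + 1) (cone \<sigma> \<rho> N M \<Lambda> x 0)" "hom_mat 1 (cone \<sigma> \<rho> N M \<Lambda> x (Suc p))" for p
    using hom_mat_cone[OF J'(1) K'(1) \<Lambda>(1-3) x(1,3) assms(8,9) J'(2) K'(2) x(2) _ J'(3) K'(3) \<Lambda>(4)]
    by simp_all
  ultimately show ?thesis unfolding linear_resolution_def by blast
qed

section \<open>Transversal ideals\<close>

definition hit_rows :: "nat \<Rightarrow> (nat \<Rightarrow> nat) \<Rightarrow> (nat \<times> nat \<Rightarrow>\<^sub>0 nat) \<Rightarrow> nat set" where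
  "hit_rows n b m = {i\<in>{1..n}. \<exists>j\<in>{1..b i}. (i, j) \<in> Poly_Mapping.keys m}"

text \<open>\<open>V\<close> is a parameter separate from \<open>n\<close> and \<open>b\<close>, so
  that the ideals of smaller matrices are ideals of the same ring. For \<open>t = 0\<close> this is
  the unit ideal, for \<open>t > n\<close> the zero ideal.\<close>

definition transversal_ideal ::
  "(nat \<times> nat) set \<Rightarrow> nat \<Rightarrow> (nat \<Rightarrow> nat) \<Rightarrow> nat \<Rightarrow> (nat \<times> nat, 'k::field) mpol set" where
  "transversal_ideal V n b t =
    {p \<in> carrier (pring V). \<forall>m\<in>Poly_Mapping.keys p. t \<le> card (hit_rows n b m)}"

lemma finite_hit_rows [simp]: "finite (hit_rows n b m)"
  by (simp add: hit_rows_def)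

lemma hit_rows_plus: "hit_rows n b (m + m') = hit_rows n b m \<union> hit_rows n b m'"
  by (auto simp: hit_rows_def keys_plus_nat)

lemma hit_rows_no_rows [simp]: "hit_rows 0 b m = {}"
  by (simp add: hit_rows_def)

lemma hit_rows_empty_row: "b (Suc n) = 0 \<Longrightarrow> hit_rows (Suc n) b m = hit_rows n b m"
  by (auto simp: hit_rows_def le_Suc_eq)

lemma ideal_transversal_ideal:
  "ideal (transversal_ideal V n b t :: (nat \<times> nat, 'k::field) mpol set) (pring V)"
proof (rule ideal_pringI)
  fix p q :: "(nat \<times> nat, 'k) mpol"
  assume "p \<in> transversal_ideal V n b t" "q \<in> transversal_ideal V n b t"
  then show "p + q \<in> transversal_ideal V n b t"
    using keys_add[of p q] unfolding transversal_ideal_def by auto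
next
  fix p q :: "(nat \<times> nat, 'k) mpol"
  assume p: "p \<in> carrier (pring V)" and q: "q \<in> transversal_ideal V n b t"
  have "t \<le> card (hit_rows n b m)" if mpq: "m \<in> Poly_Mapping.keys (p * q)" for m
  proof -
    obtain m1 m2 where m: "m = m1 + m2" "m2 \<in> Poly_Mapping.keys q"
      using keys_mult[of p q] mpq by blast
    have "t \<le> card (hit_rows n b m2)" using q m by (simp add: transversal_ideal_def)
    also have "\<dots> \<le> card (hit_rows n b m)"
      unfolding m(1) hit_rows_plus by (intro card_mono) auto
    finally show ?thesis .
  qed
  then show "p * q \<in> transversal_ideal V n b t"
    using p q by (simp add: transversal_ideal_def)
qed (auto simp: transversal_ideal_def)

lemma transversal_ideal_uminus:
  "p \<in> transversal_ideal V n b t \<Longrightarrow> - p \<in> transversal_ideal V n b t"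
  by (simp add: transversal_ideal_def in_keys_iff)

lemma transversal_ideal_sum:
  "(\<And>i. i \<in> A \<Longrightarrow> f i \<in> transversal_ideal V n b t) \<Longrightarrow> sum f A \<in> transversal_ideal V n b t"
proof (induction A rule: infinite_finite_induct)
  case (insert i A)
  then have "f i \<in> transversal_ideal V n b t" "sum f A \<in> transversal_ideal V n b t" by auto
  with insert.hyps show ?case
    using keys_add[of "f i" "sum f A"] unfolding transversal_ideal_def by auto
qed (auto simp: transversal_ideal_def)

lemma transversal_ideal_add:
  "p \<in> transversal_ideal V n b t \<Longrightarrow> q \<in> transversal_ideal V n b t \<Longrightarrow>
    p + q \<in> transversal_ideal V n b t"
  using transversal_ideal_sum[of UNIV "\<lambda>i. if i then p else q"] by (simp add: UNIV_bool add.commute)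

section \<open>Removing the last variable or the last row\<close>

context
  fixes n c :: nat and b :: "nat \<Rightarrow> nat"
  assumes b: "b (Suc n) = Suc c"
begin

lemma hit_rows_remove_var_subset: "hit_rows (Suc n) (b(Suc n := c)) m \<subseteq> hit_rows (Suc n) b m"
  using b by (auto simp: hit_rows_def)

lemma hit_rows_remove_row_subset:
  "hit_rows n b m \<subseteq> hit_rows (Suc n) b m" "hit_rows (Suc n) b m \<subseteq> insert (Suc n) (hit_rows n b m)"
  "hit_rows (Suc n) (b(Suc n := c)) m \<subseteq> insert (Suc n) (hit_rows n b m)"
  by (auto simp: hit_rows_def le_Suc_eq)

lemma hit_rows_single_last:
  "hit_rows (Suc n) (b(Suc n := c)) (Poly_Mapping.single (Suc n, Suc c) 1) = {}"
  "hit_rows n b (Poly_Mapping.single (Suc n, Suc c) 1) = {}"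
  "hit_rows (Suc n) b (Poly_Mapping.single (Suc n, Suc c) 1) = {Suc n}"
  using b by (auto simp: hit_rows_def)

text \<open>Shrinking the last block discards one variable only, so a row that is lost was met
  through that variable.\<close>

lemma hit_rows_last_var:
  assumes "hit_rows (Suc n) b m \<noteq> hit_rows (Suc n) (b(Suc n := c)) m"
  shows "(Suc n, Suc c) \<in> Poly_Mapping.keys m"
proof -
  obtain i where i: "i \<in> hit_rows (Suc n) b m" "i \<notin> hit_rows (Suc n) (b(Suc n := c)) m"
    using assms hit_rows_remove_var_subset[of m] by blast
  from i(1) obtain j where ij: "i \<in> {1..Suc n}" "j \<in> {1..b i}" "(i, j) \<in> Poly_Mapping.keys m"
    unfolding hit_rows_def by blast
  with i(2) have "j \<notin> {1..(b(Suc n := c)) i}" unfolding hit_rows_def by blast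
  with ij b have "i = Suc n" "j = Suc c" by (auto split: if_splits)
  with ij show ?thesis by simp
qed

text \<open>Forgetting the last row costs a monomial at most one of the rows that it meets.\<close>

lemma transversal_ideal_subset:
  "(transversal_ideal V (Suc n) (b(Suc n := c)) (Suc t) :: (nat \<times> nat, 'k::field) mpol set) \<subseteq>
    transversal_ideal V n b t"
proof -
  have "t \<le> card (hit_rows n b m)" if "Suc t \<le> card (hit_rows (Suc n) (b(Suc n := c)) m)" for m
  proof -
    have "card (hit_rows (Suc n) (b(Suc n := c)) m) \<le> card (insert (Suc n) (hit_rows n b m))"
      using hit_rows_remove_row_subset(3) by (intro card_mono) auto
    also have "\<dots> \<le> Suc (card (hit_rows n b m))" by (rule card_insert_le_m1) auto
    finally show ?thesis using that by simp
  qed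
  then show ?thesis by (auto simp: transversal_ideal_def)
qed

text \<open>The removed variable lies in no block of the shrunken matrix, so multiplying a monomial
  by it does not change the rows met, and multiplication by a variable cancels no terms of
  \<open>p\<close>.\<close>

lemma transversal_ideal_cancel:
  fixes p :: "(nat \<times> nat, 'k::field) mpol"
  assumes "p \<in> carrier (pring V)"
    and "indet (Suc n, Suc c) * p \<in> transversal_ideal V (Suc n) (b(Suc n := c)) t"
  shows "p \<in> transversal_ideal V (Suc n) (b(Suc n := c)) t"
proof -
  let ?v = "Poly_Mapping.single (Suc n, Suc c) (1::nat)"
  have "t \<le> card (hit_rows (Suc n) (b(Suc n := c)) m)" if m: "m \<in> Poly_Mapping.keys p" for m
  proof -
    have "?v + m \<in> Poly_Mapping.keys (indet (Suc n, Suc c) * p)"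
      using m single_mult_lookup[of ?v 1 p m] by (simp add: in_keys_iff indet_def)
    then have "t \<le> card (hit_rows (Suc n) (b(Suc n := c)) (?v + m))"
      using assms(2) by (simp add: transversal_ideal_def)
    then show ?thesis by (simp only: hit_rows_plus hit_rows_single_last(1) Un_empty_left)
  qed
  then show ?thesis using assms(1) by (simp add: transversal_ideal_def)
qed

text \<open>Monomials that meet \<open>Suc t\<close> rows of the shrunken matrix go to the first
  summand. Any other one loses a row when the variable is removed, hence is divisible by it, and it
  meets \<open>t\<close> of the first \<open>n\<close> rows. Conversely the variable contributes the
  last row on top of \<open>t\<close> earlier ones.\<close>

lemma transversal_ideal_decomp:
  assumes V: "(Suc n, Suc c) \<in> V"
  shows "(transversal_ideal V (Suc n) b (Suc t) :: (nat \<times> nat, 'k::field) mpol set) =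
    {p + indet (Suc n, Suc c) * q | p q.
      p \<in> transversal_ideal V (Suc n) (b(Suc n := c)) (Suc t) \<and> q \<in> transversal_ideal V n b t}"
    (is "?I = ?R")
proof (intro equalityI subsetI)
  let ?v = "Poly_Mapping.single (Suc n, Suc c) (1::nat)"
  let ?b = "b(Suc n := c)"
  fix p :: "(nat \<times> nat, 'k) mpol" assume p: "p \<in> ?I"
  let ?Q = "\<lambda>m. Suc t \<le> card (hit_rows (Suc n) ?b m)"
  define r where "r = mpart (\<lambda>m. \<not> ?Q m) p"
  \<comment> \<open>\<open>q\<close> is \<open>r\<close> divided by the variable, term by term; by
    \<open>m_eq\<close> the truncated subtraction of exponents is exact.\<close>
  define q where "q = (\<Sum>m\<in>Poly_Mapping.keys r. Poly_Mapping.single (m - ?v) (Poly_Mapping.lookup r m))"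
  have keys_r: "(Suc n, Suc c) \<in> Poly_Mapping.keys m \<and> t \<le> card (hit_rows n b m) \<and>
      Poly_Mapping.keys m \<subseteq> V" if "m \<in> Poly_Mapping.keys r" for m
  proof -
    have 1: "Suc t \<le> card (hit_rows (Suc n) b m)" "\<not> ?Q m" "Poly_Mapping.keys m \<subseteq> V"
      using p that by (auto simp: r_def transversal_ideal_def carrier_pring)
    have "card (hit_rows (Suc n) b m) \<le> card (insert (Suc n) (hit_rows n b m))"
      using hit_rows_remove_row_subset(2) by (intro card_mono) auto
    also have "\<dots> \<le> Suc (card (hit_rows n b m))" by (rule card_insert_le_m1) auto
    finally show ?thesis using 1 hit_rows_last_var[of m] by fastforce
  qed
  have m_eq: "?v + (m - ?v) = m" if "m \<in> Poly_Mapping.keys r" for m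
  proof (rule poly_mapping_eqI)
    fix k show "Poly_Mapping.lookup (?v + (m - ?v)) k = Poly_Mapping.lookup m k"
      using keys_r[OF that] by (auto simp: lookup_add lookup_minus lookup_single when_def in_keys_iff)
  qed
  have "indet (Suc n, Suc c) * q = r"
    unfolding q_def sum_distrib_left
    by (subst (3) sum_single_lookup[of r, symmetric], rule sum.cong)
       (simp_all add: indet_def mult_single m_eq[unfolded One_nat_def])
  moreover have "q \<in> transversal_ideal V n b t"
    unfolding q_def
  proof (rule transversal_ideal_sum)
    fix m assume m: "m \<in> Poly_Mapping.keys r"
    have "hit_rows n b m = hit_rows n b (m - ?v)"
      using hit_rows_plus[of n b ?v "m - ?v"] hit_rows_single_last(2) m_eq[OF m] by simp
    moreover have "Poly_Mapping.keys (m - ?v) \<subseteq> Poly_Mapping.keys m"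
      using keys_plus_nat[of ?v "m - ?v"] m_eq[OF m] by auto
    ultimately show "Poly_Mapping.single (m - ?v) (Poly_Mapping.lookup r m) \<in> transversal_ideal V n b t"
      using keys_r[OF m] by (auto simp: transversal_ideal_def carrier_pring)
  qed
  moreover have "mpart ?Q p \<in> transversal_ideal V (Suc n) ?b (Suc t)"
    using p by (auto simp: transversal_ideal_def)
  moreover have "p = mpart ?Q p + r" unfolding r_def by (rule mpart_split)
  ultimately show "p \<in> ?R" by blast
next
  let ?v = "Poly_Mapping.single (Suc n, Suc c) (1::nat)"
  let ?b = "b(Suc n := c)"
  fix r :: "(nat \<times> nat, 'k) mpol" assume "r \<in> ?R"
  then obtain p q where r: "r = p + indet (Suc n, Suc c) * q"
    and p: "p \<in> transversal_ideal V (Suc n) ?b (Suc t)" and q: "q \<in> transversal_ideal V n b t" by blast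
  have "p \<in> ?I"
  proof -
    have "card (hit_rows (Suc n) ?b m) \<le> card (hit_rows (Suc n) b m)" for m
      using hit_rows_remove_var_subset by (intro card_mono) auto
    then show ?thesis using p by (auto simp: transversal_ideal_def intro: order_trans)
  qed
  moreover have "indet (Suc n, Suc c) * q \<in> ?I"
  proof -
    have "Suc t \<le> card (hit_rows (Suc n) b m)" if mq: "m \<in> Poly_Mapping.keys (indet (Suc n, Suc c) * q)" for m
    proof -
      obtain m' where m': "m = ?v + m'" "m' \<in> Poly_Mapping.keys q"
        using keys_mult[of "indet (Suc n, Suc c)" q] mq by (auto simp: indet_def)
      \<comment> \<open>\<open>hit_rows n b m'\<close> contains only indices up to \<open>n\<close>,
        so inserting the last row raises the cardinality.\<close>
      have "Suc t \<le> card (insert (Suc n) (hit_rows n b m'))"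
        using q m'(2) by (subst card_insert_disjoint) (auto simp: transversal_ideal_def hit_rows_def)
      also have "\<dots> \<le> card (hit_rows (Suc n) b m)"
        unfolding m'(1) hit_rows_plus hit_rows_single_last(3)
        using hit_rows_remove_row_subset(1) by (intro card_mono) auto
      finally show ?thesis .
    qed
    then show ?thesis using q V by (simp add: transversal_ideal_def)
  qed
  ultimately show "r \<in> ?I" unfolding r by (rule transversal_ideal_add)
qed

end

section \<open>The resolutions that start the induction\<close>

lemma linear_resolution_unit_ideal:
  "linear_resolution V (carrier (pring V) :: ('v, 'k::field) mpol set) 0 (\<lambda>q. if q \<le> 1 then 1 else 0)
    (\<lambda>q. if q = 0 then 1\<^sub>m 1 else 0\<^sub>m (if q = 1 then 1 else 0) 0)"
proof -
  have "(carrier (pring V) :: ('v, 'k) mpol set) \<subseteq> (\<lambda>v. v $ 0) ` free_mod V 1"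
  proof
    fix p :: "('v, 'k) mpol" assume "p \<in> carrier (pring V)"
    then have "vec 1 (\<lambda>_. p) \<in> free_mod V 1" "vec 1 (\<lambda>_. p) $ 0 = p" by (auto simp: free_mod_def)
    then show "p \<in> (\<lambda>v. v $ 0) ` free_mod V 1" by (metis imageI)
  qed
  then have img: "(\<lambda>v. (1\<^sub>m 1 *\<^sub>v v) $ 0) ` free_mod V 1 = (carrier (pring V) :: ('v, 'k) mpol set)"
    by (auto simp: free_mod_def image_iff)
  have zero: "free_mod V 0 = {0\<^sub>v 0 :: ('v, 'k) mpol vec}"
    by (auto simp: free_mod_def)
  have "0\<^sub>m m 0 *\<^sub>v 0\<^sub>v 0 = (0\<^sub>v m :: ('v, 'k) mpol vec)" for m by (rule mat_mult_zero_vec) simp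
  moreover have "{v \<in> free_mod V 1. 1\<^sub>m 1 *\<^sub>v v = 0\<^sub>v 1} = {0\<^sub>v 1 :: ('v, 'k) mpol vec}"
    by (auto simp: free_mod_def)
  ultimately show ?thesis
    using img zero by (auto simp: linear_resolution_def aug_resolution_def hom_mat_one)
qed

text \<open>A zero matrix is homogeneous of every degree. Hence \<open>d\<close> is free, and the
  induction can take it to be any \<open>t > 0\<close> once no rows are left.\<close>

lemma linear_resolution_zero_ideal:
  "linear_resolution V {0 :: ('v, 'k::field) mpol} d (\<lambda>q. if q = 0 then 1 else 0)
    (\<lambda>q. 0\<^sub>m (if q = 0 then 1 else 0) 0)"
proof -
  have zero: "free_mod V 0 = {0\<^sub>v 0 :: ('v, 'k) mpol vec}"
    by (auto simp: free_mod_def)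
  have "0\<^sub>m m 0 *\<^sub>v 0\<^sub>v 0 = (0\<^sub>v m :: ('v, 'k) mpol vec)" for m by (rule mat_mult_zero_vec) simp
  then show ?thesis
    using zero by (auto simp: linear_resolution_def aug_resolution_def)
qed

section \<open>The generating function of the Betti numbers\<close>

lemma finite_increasing_tuples [simp]: "finite (increasing_tuples n s)"
  by (rule finite_subset[OF _ finite_lists_length_eq[of "{1..n}" s]]) (auto simp: increasing_tuples_def)

lemma increasing_tuples_0 [simp]: "increasing_tuples n 0 = {[]}"
  by (auto simp: increasing_tuples_def)

lemma increasing_tuples_Suc_Suc:
  "increasing_tuples (Suc n) (Suc s) =
    increasing_tuples n (Suc s) \<union> (\<lambda>xs. xs @ [Suc n]) ` increasing_tuples n s"
proof (intro equalityI subsetI)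
  fix xs assume xs: "xs \<in> increasing_tuples (Suc n) (Suc s)"
  then have "xs \<noteq> []" by (auto simp: increasing_tuples_def)
  then obtain ys y where ys: "xs = ys @ [y]" by (cases xs rule: rev_cases) auto
  have *: "length ys = s" "sorted_wrt (<) ys" "\<forall>z\<in>set ys. z < y" "set ys \<subseteq> {1..Suc n}" "y \<in> {1..Suc n}"
    using xs by (auto simp: ys increasing_tuples_def sorted_wrt_append)
  show "xs \<in> increasing_tuples n (Suc s) \<union> (\<lambda>xs. xs @ [Suc n]) ` increasing_tuples n s"
  proof (cases "y = Suc n")
    case True
    have "z \<in> {1..n}" if "z \<in> set ys" for z
      using bspec[OF *(3) that] subsetD[OF *(4) that] True by simp
    then have "ys \<in> increasing_tuples n s" using *(1,2) by (auto simp: increasing_tuples_def)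
    then show ?thesis using True ys by blast
  next
    case False
    then have "y \<le> n" using * by auto
    have "z \<in> {1..n}" if "z \<in> set ys" for z
      using bspec[OF *(3) that] subsetD[OF *(4) that] \<open>y \<le> n\<close> by simp
    then have "xs \<in> increasing_tuples n (Suc s)"
      using * \<open>y \<le> n\<close> by (auto simp: ys increasing_tuples_def sorted_wrt_append)
    then show ?thesis ..
  qed
next
  fix xs assume "xs \<in> increasing_tuples n (Suc s) \<union> (\<lambda>xs. xs @ [Suc n]) ` increasing_tuples n s"
  then show "xs \<in> increasing_tuples (Suc n) (Suc s)"
  proof
    assume "xs \<in> increasing_tuples n (Suc s)"
    then show ?thesis by (auto simp: increasing_tuples_def)
  next
    assume "xs \<in> (\<lambda>xs. xs @ [Suc n]) ` increasing_tuples n s"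
    then obtain ys where ys: "xs = ys @ [Suc n]" "ys \<in> increasing_tuples n s" by blast
    have "z < Suc n" if "z \<in> set ys" for z
      using ys(2) that by (auto simp: increasing_tuples_def)
    then show ?thesis
      using ys by (auto simp: increasing_tuples_def sorted_wrt_append)
  qed
qed

lemma increasing_tuples_empty: "n < s \<Longrightarrow> increasing_tuples n s = {}"
proof (induction n arbitrary: s)
  case 0
  then show ?case by (auto simp: increasing_tuples_def)
next
  case (Suc n)
  then obtain s' where "s = Suc s'" by (cases s) auto
  with Suc show ?case by (simp add: increasing_tuples_Suc_Suc)
qed

lemma sum_increasing_tuples_Suc_Suc:
  "(\<Sum>xs\<in>increasing_tuples (Suc n) (Suc s). f xs) =
    (\<Sum>xs\<in>increasing_tuples n (Suc s). f xs) + (\<Sum>xs\<in>increasing_tuples n s. f (xs @ [Suc n]))"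
proof -
  have "increasing_tuples n (Suc s) \<inter> (\<lambda>xs. xs @ [Suc n]) ` increasing_tuples n s = {}"
    by (auto simp: increasing_tuples_def)
  moreover have "inj_on (\<lambda>xs. xs @ [Suc n]) (increasing_tuples n s)"
    by (auto intro: inj_onI)
  ultimately show ?thesis
    unfolding increasing_tuples_Suc_Suc by (subst sum.union_disjoint) (auto simp: sum.reindex)
qed

lemma card_increasing_tuples: "card (increasing_tuples n s) = n choose s"
proof (induction n arbitrary: s)
  case 0
  then show ?case by (cases s) (auto simp: increasing_tuples_empty)
next
  case (Suc n)
  show ?case
  proof (cases s)
    case (Suc s')
    have "card (increasing_tuples (Suc n) (Suc s')) =
        card (increasing_tuples n (Suc s')) + card (increasing_tuples n s')"
      using sum_increasing_tuples_Suc_Suc[of "\<lambda>_. 1::nat" n s'] by simp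
    then show ?thesis using Suc.IH Suc by simp
  qed simp
qed

text \<open>For \<open>r > 0\<close> the coefficient of \<open>z^r\<close> counts the subsets of
  size \<open>r\<close> of a block of \<open>c\<close> variables; subtracting 1 discards the empty
  subset, in accordance with \<open>r \<ge> 1\<close> in the compositions.\<close>

definition block_poly :: "nat \<Rightarrow> int poly" where
  "block_poly c = [:1, 1:] ^ c - 1"

definition esym :: "(nat \<Rightarrow> nat) \<Rightarrow> nat \<Rightarrow> nat \<Rightarrow> int poly" where
  "esym b n s = (\<Sum>xs\<in>increasing_tuples n s. \<Prod>u<s. block_poly (b (xs ! u)))"

lemma esym_0 [simp]: "esym b n 0 = 1"
  by (simp add: esym_def)

lemma esym_gt: "n < s \<Longrightarrow> esym b n s = 0"
  by (simp add: esym_def increasing_tuples_empty)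

lemma esym_Suc_Suc:
  "esym b (Suc n) (Suc s) = esym b n (Suc s) + block_poly (b (Suc n)) * esym b n s"
proof -
  have "(\<Prod>u<Suc s. block_poly (b ((xs @ [Suc n]) ! u))) =
      block_poly (b (Suc n)) * (\<Prod>u<s. block_poly (b (xs ! u)))"
    if "xs \<in> increasing_tuples n s" for xs
    using that by (simp add: increasing_tuples_def nth_append)
  then show ?thesis
    unfolding esym_def sum_increasing_tuples_Suc_Suc by (simp add: sum_distrib_left)
qed

lemma esym_cong: "(\<And>i. 1 \<le> i \<Longrightarrow> i \<le> n \<Longrightarrow> b i = b' i) \<Longrightarrow> esym b n s = esym b' n s"
proof (induction n arbitrary: s)
  case 0
  then show ?case by (cases s) (auto simp: esym_gt)
next
  case (Suc n)
  then show ?case by (cases s) (auto simp: esym_Suc_Suc)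
qed

text \<open>The coefficient of \<open>z^(t+q)\<close> will be the \<open>q\<close>-th Betti number. The case \<open>t = 0\<close> is that of
  the unit ideal.\<close>

definition betti_poly :: "(nat \<Rightarrow> nat) \<Rightarrow> nat \<Rightarrow> nat \<Rightarrow> int poly" where
  "betti_poly b n t =
    (if t = 0 then 1 else \<Sum>s=1..n. of_nat ((s - 1) choose (t - 1)) * esym b n s)"

lemma betti_poly_0 [simp]: "betti_poly b n 0 = 1"
  and betti_poly_no_rows [simp]: "betti_poly b 0 (Suc t) = 0"
  by (simp_all add: betti_poly_def)

lemma betti_poly_cong:
  "(\<And>i. 1 \<le> i \<Longrightarrow> i \<le> n \<Longrightarrow> b i = b' i) \<Longrightarrow> betti_poly b n t = betti_poly b' n t"
  unfolding betti_poly_def using esym_cong[of n b b'] by simp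

text \<open>The recursion of \<open>esym\<close> splits the sum in two. After a shift of
  \<open>s\<close> the first half is an instance of the definition, and Pascal's rule breaks the
  second into the terms for \<open>Suc t\<close> and \<open>t\<close>.\<close>

lemma betti_poly_Suc_rows:
  "betti_poly b (Suc n) (Suc t) = betti_poly b n (Suc t) +
    block_poly (b (Suc n)) * (betti_poly b n (Suc t) + betti_poly b n t)"
proof -
  have "betti_poly b (Suc n) (Suc t) = (\<Sum>s\<le>n. of_nat (s choose t) * esym b (Suc n) (Suc s))"
    unfolding betti_poly_def
    by (simp add: sum.atLeast1_atMost_eq lessThan_Suc_atMost[symmetric])
  also have "\<dots> = (\<Sum>s\<le>n. of_nat (s choose t) * esym b n (Suc s)) +
      block_poly (b (Suc n)) * (\<Sum>s\<le>n. of_nat (s choose t) * esym b n s)"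
    by (simp add: esym_Suc_Suc algebra_simps sum.distrib sum_distrib_left)
  also have "(\<Sum>s\<le>n. of_nat (s choose t) * esym b n (Suc s)) = betti_poly b n (Suc t)"
    unfolding betti_poly_def
    by (simp add: sum.atLeast1_atMost_eq lessThan_Suc_atMost[symmetric] esym_gt)
  \<comment> \<open>Pascal's rule applies for \<open>s > 0\<close>. The term \<open>s = 0\<close> is
    nonzero only for \<open>t = 0\<close>, where it equals
    \<open>betti_poly b n 0 = 1\<close>.\<close>
  also have "(\<Sum>s\<le>n. of_nat (s choose t) * esym b n s) = betti_poly b n (Suc t) + betti_poly b n t"
  proof -
    have shift: "(\<Sum>s\<le>n. f s) = f 0 + (\<Sum>s<n. f (Suc s))" for f :: "nat \<Rightarrow> int poly"
      by (cases n) (simp_all add: sum.atMost_Suc_shift lessThan_Suc_atMost del: sum.atMost_Suc)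
    show ?thesis
    proof (cases t)
      case 0
      then show ?thesis unfolding shift betti_poly_def by (simp add: sum.atLeast1_atMost_eq)
    next
      case (Suc k)
      then show ?thesis
        unfolding shift betti_poly_def
        by (simp add: sum.atLeast1_atMost_eq sum.distrib[symmetric] algebra_simps)
    qed
  qed
  finally show ?thesis .
qed

lemma block_poly_0 [simp]: "block_poly 0 = 0"
  by (simp add: block_poly_def)

lemma block_poly_Suc: "block_poly (Suc c) = [:1, 1:] * block_poly c + [:0, 1:]"
proof -
  have "[:1, 1:] - 1 = ([:0, 1:] :: int poly)" by (simp add: one_pCons)
  then show ?thesis by (simp add: block_poly_def algebra_simps)
qed

text \<open>The Betti numbers of the cone in polynomial form: the factor \<open>1 + z\<close>
  accounts for the resolution of \<open>J\<close> and its shifted copy, the factor \<open>z\<close>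
  for \<open>K\<close> being generated one degree below \<open>Suc t\<close>.\<close>

lemma betti_poly_remove_var:
  assumes "b (Suc n) = Suc c"
  shows "betti_poly b (Suc n) (Suc t) =
    [:1, 1:] * betti_poly (b(Suc n := c)) (Suc n) (Suc t) + [:0, 1:] * betti_poly b n t"
proof -
  have "betti_poly (b(Suc n := c)) n k = betti_poly b n k" for k
    by (rule betti_poly_cong) auto
  moreover have "[:1, 1:] = (1 + [:0, 1:] :: int poly)" by (simp add: one_pCons)
  ultimately show ?thesis
    unfolding betti_poly_Suc_rows assms block_poly_Suc by (simp add: algebra_simps)
qed

section \<open>Coefficients of the generating polynomials\<close>

lemma coeff_linear_power: "coeff ([:a, 1:] ^ n) i = int (n choose i) * a ^ (n - i)"
proof (cases "i \<le> n")
  case False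
  have "degree ([:a, 1:] ^ n) \<le> degree [:a, 1:] * n" by (rule degree_power_le)
  with False have "coeff ([:a, 1:] ^ n) i = 0" by (intro coeff_eq_0) simp
  with False show ?thesis by simp
qed (simp add: coeff_linear_poly_power)

lemma coeff_block_poly: "coeff (block_poly c) j = (if j = 0 then 0 else int (c choose j))"
  by (cases j) (simp_all add: block_poly_def coeff_linear_power)

lemma compositions_0: "compositions 0 m = (if m = 0 then {[]} else {})"
  by (auto simp: compositions_def)

lemma finite_compositions [simp]: "finite (compositions s m)"
proof (rule finite_subset[OF _ finite_lists_length_eq[of "{..m}" s]])
  show "compositions s m \<subseteq> {xs. set xs \<subseteq> {..m} \<and> length xs = s}"
    by (auto simp: compositions_def intro: member_le_sum_list)
qed simp

text \<open>The last part is split off; \<open>i\<close> is the sum of the other parts, and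
  \<open>i < m\<close> expresses that the last one is positive.\<close>

lemma sum_compositions_Suc:
  "(\<Sum>rs\<in>compositions (Suc s) m. f rs) = (\<Sum>i<m. \<Sum>rs\<in>compositions s i. f (rs @ [m - i]))"
proof -
  have "(\<Sum>rs\<in>compositions (Suc s) m. f rs) =
      (\<Sum>(i, rs)\<in>Sigma {..<m} (compositions s). f (rs @ [m - i]))"
  proof (rule sum.reindex_bij_witness[of _ "\<lambda>(i, rs). rs @ [m - i]"
        "\<lambda>rs. (sum_list (butlast rs), butlast rs)"])
    fix rs assume "rs \<in> compositions (Suc s) m"
    then obtain ys y where rs: "rs = ys @ [y]" "length ys = s" "sum_list ys + y = m"
        "\<forall>r\<in>set ys. 1 \<le> r" "1 \<le> y"
      by (cases rs rule: rev_cases) (auto simp: compositions_def)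
    then have y: "m - sum_list ys = y" by simp
    show "(case (sum_list (butlast rs), butlast rs) of (i, rs) \<Rightarrow> rs @ [m - i]) = rs"
      using rs y by simp
    show "(sum_list (butlast rs), butlast rs) \<in> Sigma {..<m} (compositions s)"
      using rs by (auto simp: compositions_def)
    show "(case (sum_list (butlast rs), butlast rs) of (i, rs) \<Rightarrow> f (rs @ [m - i])) = f rs"
      using rs y by simp
  qed (auto simp: compositions_def)
  also have "\<dots> = (\<Sum>i<m. \<Sum>rs\<in>compositions s i. f (rs @ [m - i]))"
    by (subst sum.Sigma) auto
  finally show ?thesis .
qed

lemma coeff_prod_block_poly:
  "coeff (\<Prod>u<s. block_poly (c u)) m = int (\<Sum>rs\<in>compositions s m. \<Prod>u<s. c u choose (rs ! u))"
proof (induction s arbitrary: m)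
  case 0
  then show ?case by (auto simp: compositions_0 coeff_1)
next
  case (Suc s)
  have prod: "(\<Prod>u<Suc s. c u choose ((rs @ [r]) ! u)) = (\<Prod>u<s. c u choose (rs ! u)) * (c s choose r)"
    if "rs \<in> compositions s i" for rs r i
    using that by (simp add: compositions_def nth_append)
  have "coeff (\<Prod>u<Suc s. block_poly (c u)) m =
      (\<Sum>i\<le>m. coeff (\<Prod>u<s. block_poly (c u)) i * coeff (block_poly (c s)) (m - i))"
    by (simp add: coeff_mult)
  \<comment> \<open>The term \<open>i = m\<close> drops out because \<open>block_poly\<close> has
    constant term zero.\<close>
  also have "\<dots> = (\<Sum>i<m. coeff (\<Prod>u<s. block_poly (c u)) i * int (c s choose (m - i)))"
    by (rule sum.mono_neutral_cong_right) (auto simp: coeff_block_poly)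
  also have "\<dots> = int (\<Sum>i<m. \<Sum>rs\<in>compositions s i. (\<Prod>u<s. c u choose (rs ! u)) * (c s choose (m - i)))"
    by (simp add: Suc.IH sum_distrib_right)
  also have "\<dots> = int (\<Sum>rs\<in>compositions (Suc s) m. \<Prod>u<Suc s. c u choose (rs ! u))"
    unfolding sum_compositions_Suc using prod by (intro arg_cong[of _ _ int] sum.cong refl) simp
  finally show ?case .
qed

lemma compositions_empty: "m < s \<Longrightarrow> compositions s m = {}"
proof -
  have "length rs \<le> sum_list rs" if "\<forall>r\<in>set rs. 1 \<le> r" for rs :: "nat list"
    using that by (induction rs) auto
  then show "m < s \<Longrightarrow> ?thesis" by (force simp: compositions_def)
qed

lemma coeff_betti_poly:
  assumes "1 \<le> t"
  shows "coeff (betti_poly b n t) (t + q) =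
    int (\<Sum>s=t..min (t + q) n. ((s - 1) choose (t - 1)) *
      (\<Sum>xs\<in>increasing_tuples n s. \<Sum>rs\<in>compositions s (t + q). \<Prod>u<s. b (xs ! u) choose (rs ! u)))"
proof -
  define f where "f s = ((s - 1) choose (t - 1)) * (\<Sum>xs\<in>increasing_tuples n s.
      \<Sum>rs\<in>compositions s (t + q). \<Prod>u<s. b (xs ! u) choose (rs ! u))" for s
  have smult: "coeff (of_nat k * p) i = int k * coeff p i" for k i and p :: "int poly"
    by (simp add: of_nat_poly)
  have "coeff (betti_poly b n t) (t + q) = (\<Sum>s=1..n. int (f s))"
    using assms by (simp add: betti_poly_def esym_def coeff_sum smult coeff_prod_block_poly f_def)
  also have "\<dots> = int (\<Sum>s=1..n. f s)" by simp
  \<comment> \<open>Below \<open>t\<close> the binomial coefficient vanishes, and above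
    \<open>t + q\<close> there are no compositions of \<open>t + q\<close> into \<open>s\<close>
    positive parts.\<close>
  also have "(\<Sum>s=1..n. f s) = (\<Sum>s=t..min (t + q) n. f s)"
    by (rule sum.mono_neutral_right) (use assms in \<open>auto simp: f_def compositions_empty\<close>)
  finally show ?thesis unfolding f_def .
qed

text \<open>As \<open>(1 + z)^2 - 1 = z (2 + z)\<close>, the product is
  \<open>z^s (2 + z)^s\<close>. For \<open>m > 2 s\<close> the exponent of 2 is truncated to 0,
  harmlessly, since the binomial coefficient is then zero.\<close>

lemma sum_compositions_choose_2:
  assumes "s \<le> m"
  shows "(\<Sum>rs\<in>compositions s m. \<Prod>u<s. 2 choose (rs ! u)) = (s choose (m - s)) * 2 ^ (2 * s - m)"
proof -
  have "block_poly 2 = monom 1 1 * [:2, 1:]"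
    by (simp add: block_poly_def power2_eq_square one_pCons monom_altdef)
  then have "(\<Prod>u<s. block_poly 2) = monom 1 s * [:2, 1:] ^ s"
    by (simp only: prod_constant card_lessThan power_mult_distrib monom_power) simp
  then have "coeff (\<Prod>u<s. block_poly 2) m = coeff ([:2, 1:] ^ s) (m - s)"
    using assms by (simp add: coeff_monom_mult)
  also have "\<dots> = int ((s choose (m - s)) * 2 ^ (2 * s - m))"
    using assms by (simp add: coeff_linear_power mult_2)
  finally show ?thesis
    unfolding coeff_prod_block_poly of_nat_eq_iff .
qed

section \<open>Betti numbers of transversal ideals\<close>

text \<open>The measure counts variables and rows, so it drops when a variable is removed and also
  when an empty last row is dropped. The vanishing of the coefficients below \<open>t\<close> is
  carried along for the recursion at \<open>q = 0\<close>, where it stands for the absent Betti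
  number of \<open>J\<close> in degree -1.\<close>

lemma ex_linear_resolution_transversal_ideal:
  assumes "yvars n b \<subseteq> V"
  shows "\<exists>\<rho> M. linear_resolution V (transversal_ideal V n b t :: (nat \<times> nat, 'k::field) mpol set) (int t) \<rho> M \<and>
    (\<forall>q. int (\<rho> (Suc q)) = coeff (betti_poly b n t) (t + q)) \<and>
    (\<forall>m<t. coeff (betti_poly b n t) m = 0)"
  using assms
proof (induction "n + (\<Sum>i=1..n. b i)" arbitrary: n b t rule: less_induct)
  case less
  show ?case
  proof (cases t)
    case 0
    have "linear_resolution V (transversal_ideal V n b t :: (nat \<times> nat, 'k) mpol set) (int t)
        (\<lambda>q. if q \<le> 1 then 1 else 0) (\<lambda>q. if q = 0 then 1\<^sub>m 1 else 0\<^sub>m (if q = 1 then 1 else 0) 0)"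
      using linear_resolution_unit_ideal[of V] 0 by (simp add: transversal_ideal_def)
    moreover have "int (if Suc q \<le> 1 then 1 else 0) = coeff (betti_poly b n t) (t + q)" for q
      using 0 by (simp add: coeff_1)
    ultimately show ?thesis using 0 by blast
  next
    case (Suc t')
    show ?thesis
    proof (cases n)
      case 0
      have "p = 0" if "Poly_Mapping.keys p = {}" for p :: "(nat \<times> nat, 'k) mpol"
        using that by (intro poly_mapping_eqI) (metis empty_iff in_keys_iff lookup_zero)
      then have "(transversal_ideal V n b t :: (nat \<times> nat, 'k) mpol set) = {0}"
        using 0 Suc by (auto simp: transversal_ideal_def)
      then have "linear_resolution V (transversal_ideal V n b t :: (nat \<times> nat, 'k) mpol set) (int t)
          (\<lambda>q. if q = 0 then 1 else 0) (\<lambda>q. 0\<^sub>m (if q = 0 then 1 else 0) 0)"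
        by (simp only: linear_resolution_zero_ideal)
      moreover have "betti_poly b n t = 0" using 0 Suc by simp
      ultimately show ?thesis by (intro exI conjI) auto
    next
      case n: (Suc n')
      have yn': "yvars n' b \<subseteq> V" using less.prems n by (auto simp: yvars_def)
      show ?thesis
      proof (cases "b n")
        case 0
        have "(transversal_ideal V n b t :: (nat \<times> nat, 'k) mpol set) = transversal_ideal V n' b t"
          using 0 n by (simp add: transversal_ideal_def hit_rows_empty_row)
        moreover have "betti_poly b n t = betti_poly b n' t"
          using 0 n Suc by (simp add: betti_poly_Suc_rows)
        ultimately show ?thesis
          using less.hyps[OF _ yn', of t] n by simp
      next
        case bn: (Suc c)
        let ?b = "b(n := c)" and ?x = "indet (n, Suc c) :: (nat \<times> nat, 'k) mpol"
        have b_Suc: "b (Suc n') = Suc c" using bn n by simp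
        have x: "(n, Suc c) \<in> V" using less.prems n bn by (auto simp: yvars_def)
        have "(\<Sum>i=1..n. ?b i) < (\<Sum>i=1..n. b i)"
          using n bn by (intro sum_strict_mono_ex1) auto
        moreover have "yvars n ?b \<subseteq> V"
          using less.prems bn by (auto simp: yvars_def split: if_splits)
        ultimately obtain \<sigma> N where J:
          "linear_resolution V (transversal_ideal V n ?b t :: (nat \<times> nat, 'k) mpol set) (int t) \<sigma> N"
          "\<And>q. int (\<sigma> (Suc q)) = coeff (betti_poly ?b n t) (t + q)"
          "\<And>m. m < t \<Longrightarrow> coeff (betti_poly ?b n t) m = 0"
          using less.hyps[of n ?b t] by auto
        obtain \<rho> M where K:
          "linear_resolution V (transversal_ideal V n' b t' :: (nat \<times> nat, 'k) mpol set) (int t') \<rho> M"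
          "\<And>q. int (\<rho> (Suc q)) = coeff (betti_poly b n' t') (t' + q)"
          "\<And>m. m < t' \<Longrightarrow> coeff (betti_poly b n' t') m = 0"
          using less.hyps[OF _ yn', of t'] n by auto
        have "\<exists>C. linear_resolution V (transversal_ideal V n b t :: (nat \<times> nat, 'k) mpol set)
            (int t' + 1) (cone_rank \<sigma> \<rho>) C"
        proof (rule linear_resolution_cone)
          show "linear_resolution V (transversal_ideal V n ?b t :: (nat \<times> nat, 'k) mpol set) (int t' + 1) \<sigma> N"
            using J(1) Suc by (simp add: add.commute)
          show "linear_resolution V (transversal_ideal V n' b t' :: (nat \<times> nat, 'k) mpol set) (int t') \<rho> M"
            by (rule K(1))
          show "(transversal_ideal V n ?b t :: (nat \<times> nat, 'k) mpol set) \<subseteq> transversal_ideal V n' b t'"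
            unfolding n Suc by (rule transversal_ideal_subset[where b = b and c = c and n = n', OF b_Suc])
          show "?x \<in> carrier (pring V)" "homogeneous 1 ?x"
            using x by (auto intro: homogeneous_indet)
          show "p = 0" if "?x * p = 0" for p using that by (rule indet_mult_eq_0)
          show "p \<in> transversal_ideal V n ?b t"
            if "p \<in> transversal_ideal V n' b t'" "?x * p \<in> transversal_ideal V n ?b t" for p
            using transversal_ideal_cancel[where b = b and c = c and n = n', OF b_Suc, of p V t] that unfolding n
            by (simp add: transversal_ideal_def)
          show "(transversal_ideal V n b t :: (nat \<times> nat, 'k) mpol set) =
              {p + ?x * q |p q. p \<in> transversal_ideal V n ?b t \<and> q \<in> transversal_ideal V n' b t'}"
            using transversal_ideal_decomp[where b = b and c = c and n = n', OF b_Suc, of V t'] x unfolding n Suc by simp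
        qed (rule transversal_ideal_uminus)
        then obtain C where C: "linear_resolution V (transversal_ideal V n b t :: (nat \<times> nat, 'k) mpol set)
            (int t) (cone_rank \<sigma> \<rho>) C"
          using Suc by (auto simp: add.commute)
        have coeff: "coeff (betti_poly b n t) (Suc m) =
            coeff (betti_poly ?b n t) (Suc m) + coeff (betti_poly ?b n t) m + coeff (betti_poly b n' t') m"
          "coeff (betti_poly b n t) 0 = coeff (betti_poly ?b n t) 0" for m
          unfolding n Suc betti_poly_remove_var[where b = b and c = c and n = n', OF b_Suc] by simp_all
        have "int (cone_rank \<sigma> \<rho> (Suc q)) = coeff (betti_poly b n t) (t + q)" for q
        proof -
          \<comment> \<open>At \<open>q = 0\<close> both sides are zero: the left one by definition,
            the right one because its exponent \<open>t' = t - 1\<close> is below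
            \<open>t\<close>.\<close>
          have "int (cone_tail \<sigma> q) = coeff (betti_poly ?b n t) (t' + q)"
            using J(2)[of "q - 1"] J(3)[of t'] Suc by (cases q) (auto simp: cone_tail_def)
          then show ?thesis
            using coeff(1)[of "t' + q"] J(2)[of q] K(2)[of q] Suc by (simp add: cone_rank_def)
        qed
        moreover have "coeff (betti_poly b n t) m = 0" if "m < t" for m
          using coeff J(3) K(3) that Suc by (cases m) auto
        ultimately show ?thesis using C by blast
      qed
    qed
  qed
qed

section \<open>From linear resolutions to Betti numbers\<close>

lemma minimal_of_linear_resolution:
  fixes I :: "('v, 'k::field) mpol set"
  assumes "linear_resolution V I d \<rho> M"
  shows "minimal_graded_free_resolution V I (\<lambda>q. \<rho> (Suc q)) (\<lambda>q c. d + int q) (row (M 0) 0) (\<lambda>q. M (Suc q))"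
proof -
  have res: "aug_resolution V I \<rho> M" and hom: "hom_mat d (M 0)" "\<And>q. hom_mat 1 (M (Suc q))"
    using assms by (auto simp: linear_resolution_def)
  have M0: "M 0 \<in> pring_mat V 1 (\<rho> 1)" using aug_mat[OF res, of 0] aug_rank_0[OF res] by simp
  have row: "(M 0 *\<^sub>v v) $ 0 = row (M 0) 0 \<bullet> v" for v
    using pring_mat_dims[OF M0] by simp
  have ker0: "M 0 *\<^sub>v v = 0\<^sub>v (\<rho> 0) \<longleftrightarrow> row (M 0) 0 \<bullet> v = 0" for v
    using pring_mat_dims[OF M0] aug_rank_0[OF res] by (auto simp: vec_eq_iff)
  have entry: "M (Suc q) $$ (i, c) \<in> carrier (pring V)" "homogeneous 1 (M (Suc q) $$ (i, c))"
    if "i < \<rho> (Suc q)" "c < \<rho> (Suc (Suc q))" for q i c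
    using aug_mat[OF res, of "Suc q"] hom(2)[of q] that by (auto simp: pring_mat_def hom_mat_def)
  show ?thesis
    unfolding minimal_graded_free_resolution_def
  proof (intro conjI allI impI)
    show "row (M 0) 0 \<in> free_mod V (\<rho> (Suc 0))"
      using M0 by (auto simp: pring_mat_def free_mod_def intro!: row_carrier_vec)
    show "homogeneous (d + int 0) (row (M 0) 0 $ c)" if "c < \<rho> (Suc 0)" for c
      using hom(1) pring_mat_dims[OF M0] that by (simp add: hom_mat_def)
    show "M (Suc q) \<in> carrier_mat (\<rho> (Suc q)) (\<rho> (Suc (Suc q)))" for q
      by (rule aug_carrier[OF res])
    show "(\<lambda>v. row (M 0) 0 \<bullet> v) ` free_mod V (\<rho> (Suc 0)) = I"
      using aug_image[OF res] by (simp only: row One_nat_def)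
    show "{v \<in> free_mod V (\<rho> (Suc 0)). row (M 0) 0 \<bullet> v = 0} =
        (\<lambda>w. M (Suc 0) *\<^sub>v w) ` free_mod V (\<rho> (Suc 1))"
      using aug_exact[OF res, of 0] by (simp only: ker0 One_nat_def)
    show "{v \<in> free_mod V (\<rho> (Suc (Suc q))). M (Suc q) *\<^sub>v v = 0\<^sub>v (\<rho> (Suc q))} =
        (\<lambda>w. M (Suc (Suc q)) *\<^sub>v w) ` free_mod V (\<rho> (Suc (Suc (Suc q))))" for q
      by (rule aug_exact[OF res])
    fix q i c assume ic: "i < \<rho> (Suc q)" "c < \<rho> (Suc (Suc q))"
    show "M (Suc q) $$ (i, c) \<in> carrier (pring V)" by (rule entry(1)[OF ic])
    show "homogeneous (d + int (Suc q) - (d + int q)) (M (Suc q) $$ (i, c))"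
      using entry(2)[OF ic] by simp
    show "M (Suc q) $$ (i, c) \<in> irrelevant_ideal V"
      by (rule linear_in_irrelevant_ideal[OF entry[OF ic]])
  qed
qed

text \<open>Prepending the augmentation as a matrix with one row shifts all indices by one, which is
  what \<open>case_nat\<close> records. The comparison of ranks is available in this augmented
  form.\<close>

lemma aug_of_minimal_resolution:
  fixes I :: "('v, 'k::field) mpol set"
  assumes min: "minimal_graded_free_resolution V I rk a g \<phi>"
  shows "aug_resolution V I (case_nat 1 rk) (case_nat (mat_of_row g) \<phi>)"
    and "i < rk q \<Longrightarrow> j < rk (Suc q) \<Longrightarrow> const_coeff (\<phi> q $$ (i, j)) = 0"
proof -
  note min' = min[unfolded minimal_graded_free_resolution_def]
  from min' have g: "g \<in> free_mod V (rk 0)" by (elim conjE)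
  from min' have "\<forall>q. \<phi> q \<in> carrier_mat (rk q) (rk (Suc q))" by (elim conjE)
  moreover from min' have "\<forall>q. \<forall>i<rk q. \<forall>c<rk (Suc q). \<phi> q $$ (i, c) \<in> carrier (pring V) \<and>
       homogeneous (a (Suc q) c - a q i) (\<phi> q $$ (i, c))" by (elim conjE)
  ultimately have \<phi>: "\<phi> q \<in> pring_mat V (rk q) (rk (Suc q))" for q
    by (simp add: pring_mat_def)
  from min' have img: "(\<lambda>v. g \<bullet> v) ` free_mod V (rk 0) = I" by (elim conjE)
  from min' have ex0: "{v \<in> free_mod V (rk 0). g \<bullet> v = 0} = (\<lambda>w. \<phi> 0 *\<^sub>v w) ` free_mod V (rk 1)"
    by (elim conjE)
  from min' have ex: "\<forall>q. {v \<in> free_mod V (rk (Suc q)). \<phi> q *\<^sub>v v = 0\<^sub>v (rk q)} =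
         (\<lambda>w. \<phi> (Suc q) *\<^sub>v w) ` free_mod V (rk (Suc (Suc q)))" by (elim conjE)
  from min' have irr: "\<forall>q. \<forall>i<rk q. \<forall>c<rk (Suc q). \<phi> q $$ (i, c) \<in> irrelevant_ideal V"
    by (elim conjE)
  have row: "(mat_of_row g *\<^sub>v v) $ 0 = g \<bullet> v" for v by simp
  have ker0: "mat_of_row g *\<^sub>v v = 0\<^sub>v 1 \<longleftrightarrow> g \<bullet> v = 0" for v
    by (auto simp: vec_eq_iff)
  have G: "mat_of_row g \<in> pring_mat V 1 (rk 0)"
    using g by (auto simp: pring_mat_def free_mod_def)
  show "aug_resolution V I (case_nat 1 rk) (case_nat (mat_of_row g) \<phi>)"
    unfolding aug_resolution_def
  proof (intro conjI allI)
    fix q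
    show "case_nat (mat_of_row g) \<phi> q \<in> pring_mat V (case_nat 1 rk q) (case_nat 1 rk (Suc q))"
      using G \<phi> by (cases q) auto
    show "{v \<in> free_mod V (case_nat 1 rk (Suc q)). case_nat (mat_of_row g) \<phi> q *\<^sub>v v = 0\<^sub>v (case_nat 1 rk q)} =
      (\<lambda>w. case_nat (mat_of_row g) \<phi> (Suc q) *\<^sub>v w) ` free_mod V (case_nat 1 rk (Suc (Suc q)))"
    proof (cases q)
      case 0
      then show ?thesis using ex0 by (simp only: nat.case ker0[unfolded One_nat_def] One_nat_def)
    next
      case (Suc p)
      then show ?thesis using ex by simp
    qed
  qed (use img in \<open>simp_all add: row\<close>)
  show "i < rk q \<Longrightarrow> j < rk (Suc q) \<Longrightarrow> const_coeff (\<phi> q $$ (i, j)) = 0"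
    using irr lookup_0_irrelevant_ideal unfolding const_coeff_def by blast
qed

lemma minimal_resolution_rank_le:
  fixes I :: "('v, 'k::field) mpol set"
  assumes "minimal_graded_free_resolution V I rk a g \<phi>" "minimal_graded_free_resolution V I rk' a' g' \<phi>'"
  shows "rk q \<le> rk' q"
  using minimal_rank_le[OF aug_of_minimal_resolution(1)[OF assms(1)] aug_of_minimal_resolution(1)[OF assms(2)],
      of q] aug_of_minimal_resolution(2)[OF assms(1)] by simp

text \<open>Comparing ranks in both directions shows that the description in \<open>betti\<close>
  has a unique solution, so any one minimal resolution computes it.\<close>

lemma betti_eqI:
  assumes "minimal_graded_free_resolution V I rk a g \<phi>"
  shows "betti V I q = rk q"
  unfolding betti_def
proof (rule the_equality)
  fix r assume "\<exists>rk a g \<phi>. minimal_graded_free_resolution V I rk a g \<phi> \<and> rk q = r"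
  then show "r = rk q"
    using minimal_resolution_rank_le[OF assms] minimal_resolution_rank_le[OF _ assms] by (metis order_antisym)
qed (use assms in blast)

lemma betti_transversal_ideal:
  assumes "1 \<le> t"
  shows "betti (yvars n b) (transversal_ideal (yvars n b) n b t :: (nat \<times> nat, 'k::field) mpol set) q =
    (\<Sum>s=t..min (t + q) n. ((s - 1) choose (t - 1)) *
      (\<Sum>xs\<in>increasing_tuples n s. \<Sum>rs\<in>compositions s (t + q). \<Prod>u<s. b (xs ! u) choose (rs ! u)))"
proof -
  obtain \<rho> M where \<rho>: "linear_resolution (yvars n b)
      (transversal_ideal (yvars n b) n b t :: (nat \<times> nat, 'k) mpol set) (int t) \<rho> M"
    "int (\<rho> (Suc q)) = coeff (betti_poly b n t) (t + q)"
    using ex_linear_resolution_transversal_ideal[OF order_refl] by blast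
  have "betti (yvars n b) (transversal_ideal (yvars n b) n b t :: (nat \<times> nat, 'k) mpol set) q = \<rho> (Suc q)"
    by (rule betti_eqI[OF minimal_of_linear_resolution[OF \<rho>(1)]])
  then show ?thesis
    using \<rho>(2) unfolding coeff_betti_poly[OF assms] of_nat_eq_iff by simp
qed

section \<open>The determinantal ideals of D\<close>

text \<open>Made for the summands of the Leibniz expansion of a minor, whose factors are zero or
  variables of prescribed rows. A zero factor leaves no monomials to check; otherwise each variable
  contributes its row.\<close>

lemma keys_prod_row_entries:
  fixes e :: "nat \<Rightarrow> (nat \<times> nat, 'k::field) mpol"
  assumes "\<And>k. k < s \<Longrightarrow> r k \<in> {1..n}"
    and "\<And>k. k < s \<Longrightarrow> e k = 0 \<or> (\<exists>j\<in>{1..b (r k)}. e k = indet (r k, j) \<and> (r k, j) \<in> V)"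
  shows "(\<Prod>k<s. e k) \<in> carrier (pring V) \<and>
    (\<forall>m\<in>Poly_Mapping.keys (\<Prod>k<s. e k). r ` {..<s} \<subseteq> hit_rows n b m)"
  using assms
proof (induction s)
  case (Suc s)
  let ?P = "\<Prod>k<s. e k"
  have P: "?P \<in> carrier (pring V)" "\<And>m. m \<in> Poly_Mapping.keys ?P \<Longrightarrow> r ` {..<s} \<subseteq> hit_rows n b m"
    using Suc by auto
  have "e s = 0 \<or> (\<exists>j\<in>{1..b (r s)}. e s = indet (r s, j) \<and> (r s, j) \<in> V)"
    using Suc.prems(2) by simp
  then show ?case
  proof
    assume "\<exists>j\<in>{1..b (r s)}. e s = indet (r s, j) \<and> (r s, j) \<in> V"
    then obtain j where j: "j \<in> {1..b (r s)}" "e s = indet (r s, j)" "(r s, j) \<in> V" by blast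
    have "r ` {..<Suc s} \<subseteq> hit_rows n b m" if m: "m \<in> Poly_Mapping.keys (?P * e s)" for m
    proof -
      obtain m1 where m1: "m = m1 + Poly_Mapping.single (r s, j) 1" "m1 \<in> Poly_Mapping.keys ?P"
        using keys_mult[of ?P "e s"] m j(2) by (auto simp: indet_def)
      have "r s \<in> hit_rows n b (Poly_Mapping.single (r s, j) 1)"
        using j(1) Suc.prems(1)[of s] by (auto simp: hit_rows_def)
      then show ?thesis
        using P(2)[OF m1(2)] unfolding m1(1) hit_rows_plus lessThan_Suc by blast
    qed
    then show ?thesis using P(1) j(2,3) by simp
  qed simp
qed simp

lemma inj_on_pick: "inj_on (pick S) {..<card S}"
proof (rule inj_onI)
  fix k l assume "k \<in> {..<card S}" "l \<in> {..<card S}" "pick S k = pick S l"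
  then show "k = l"
    using pick_mono_le[of l S k] pick_mono_le[of k S l] by (cases k l rule: linorder_cases) auto
qed

text \<open>Each summand of the Leibniz formula is, up to sign, a product of one entry from each of
  \<open>t\<close> distinct rows; the sign is absorbed by closure under negation.\<close>

lemma minors_subset_transversal_ideal:
  "minors t (Dmat n b :: (nat \<times> nat, 'k::field) mpol mat) \<subseteq> transversal_ideal (yvars n b) n b t"
proof
  fix x :: "(nat \<times> nat, 'k) mpol" assume "x \<in> minors t (Dmat n b)"
  define L where "L = (\<Sum>l=1..n. b l)"
  from \<open>x \<in> _\<close> obtain R C where x: "x = det (submatrix (Dmat n b) R C)"
    and R: "R \<subseteq> {..<n}" "card R = t" and C: "C \<subseteq> {..<L}" "card C = t"
    by (auto simp: minors_def Dmat_def L_def)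
  let ?D = "Dmat n b :: (nat \<times> nat, 'k) mpol mat"
  let ?A = "submatrix ?D R C"
  have RC: "{i. i < n \<and> i \<in> R} = R" "{j. j < L \<and> j \<in> C} = C" using R C by auto
  have dim: "dim_row ?D = n" "dim_col ?D = L" by (simp_all add: Dmat_def L_def)
  have A: "?A \<in> carrier_mat t t"
    by (rule carrier_matI) (simp_all add: dim_submatrix dim RC R C)
  interpret I: ideal "transversal_ideal (yvars n b) n b t :: (nat \<times> nat, 'k) mpol set" "pring (yvars n b)"
    by (rule ideal_transversal_ideal)
  have "signof p * (\<Prod>i=0..<t. ?A $$ (i, p i)) \<in> transversal_ideal (yvars n b) n b t"
    if p: "p permutes {0..<t}" for p
  proof -
    \<comment> \<open>Matrix rows are counted from 0, the first indices of the variables from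
      1.\<close>
    define r where "r k = Suc (pick R k)" for k
    have r: "r k \<in> {1..n}" if "k < t" for k
      using pick_in_set_le[of k R] that R by (auto simp: r_def)
    have "inj_on r {..<t}"
      using inj_on_pick[of R] R(2) by (auto simp: inj_on_def r_def)
    then have card: "card (r ` {..<t}) = t" by (simp add: card_image)
    have e: "?A $$ (k, p k) = 0 \<or>
        (\<exists>j\<in>{1..b (r k)}. ?A $$ (k, p k) = indet (r k, j) \<and> (r k, j) \<in> yvars n b)" if k: "k < t" for k
    proof -
      have pk: "p k < t" using permutes_in_image[OF p, of k] k by simp
      have in_RC: "pick R k < n" "pick C (p k) < L"
        using pick_in_set_le[of k R] pick_in_set_le[of "p k" C] R C k pk by auto
      define off where "off = (\<Sum>l=1..pick R k. b l)"
      define c where "c = pick C (p k)"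
      have "?A $$ (k, p k) = ?D $$ (pick R k, c)"
        unfolding c_def by (rule submatrix_index) (use k pk R C RC dim in simp_all)
      also have "\<dots> = (if off \<le> c \<and> c < off + b (r k) then indet (r k, c - off + 1) else 0)"
        using in_RC unfolding Dmat_def off_def c_def[symmetric] L_def r_def by (simp add: Let_def)
      finally have eq: "?A $$ (k, p k) = (if off \<le> c \<and> c < off + b (r k) then indet (r k, c - off + 1) else 0)" .
      show ?thesis
      proof (cases "off \<le> c \<and> c < off + b (r k)")
        case True
        then have "c - off + 1 \<in> {1..b (r k)}" by auto
        moreover from this r[OF k] have "(r k, c - off + 1) \<in> yvars n b" by (simp add: yvars_def)
        ultimately show ?thesis unfolding eq if_P[OF True] by blast
      next
        case False
        show ?thesis unfolding eq if_not_P[OF False] by blast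
      qed
    qed
    define P where "P = (\<Prod>k<t. ?A $$ (k, p k))"
    have P: "P \<in> carrier (pring (yvars n b)) \<and> (\<forall>m\<in>Poly_Mapping.keys P. r ` {..<t} \<subseteq> hit_rows n b m)"
      unfolding P_def by (rule keys_prod_row_entries[where e = "\<lambda>k. ?A $$ (k, p k)" and r = r and b = b, OF r e])
    have hits: "t \<le> card (hit_rows n b m)" if "m \<in> Poly_Mapping.keys P" for m
      using card_mono[OF finite_hit_rows bspec[OF conjunct2[OF P] that]] card by simp
    have "P \<in> transversal_ideal (yvars n b) n b t"
      unfolding transversal_ideal_def by (rule CollectI) (use P hits in blast)
    then have "(\<Prod>i=0..<t. ?A $$ (i, p i)) \<in> transversal_ideal (yvars n b) n b t"
      unfolding P_def by (simp only: atLeast0LessThan)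
    then show ?thesis
      using transversal_ideal_uminus[of "\<Prod>i=0..<t. ?A $$ (i, p i)"]
      by (cases "evenperm p") (simp_all add: sign_def)
  qed
  then show "x \<in> transversal_ideal (yvars n b) n b t"
    unfolding x det_def'[OF A] by (intro transversal_ideal_sum) simp
qed

section \<open>Square-free monomials as minors\<close>

lemma block_offset_mono:
  fixes b :: "nat \<Rightarrow> nat"
  assumes "i < i'"
  shows "(\<Sum>l=1..i. b l) + b (Suc i) \<le> (\<Sum>l=1..i'. b l)"
proof -
  have "(\<Sum>l=1..i. b l) + b (Suc i) = (\<Sum>l=1..Suc i. b l)" by simp
  also have "\<dots> \<le> (\<Sum>l=1..i'. b l)"
    using assms by (intro sum_mono2) auto
  finally show ?thesis .
qed

text \<open>\<open>f (pick R k)\<close> has exactly \<open>k\<close> elements of the image below it.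
  It serves to list the chosen columns in the order of their rows, so that they meet on the diagonal
  of the submatrix.\<close>

lemma pick_strict_mono_image:
  assumes f: "strict_mono_on R f" and R: "finite R" and k: "k < card R"
  shows "pick (f ` R) k = f (pick R k)"
proof -
  have in_R: "pick R k \<in> R" using pick_in_set_le[OF k] .
  have inj: "inj_on f R" using f by (rule strict_mono_on_imp_inj_on)
  have "{a \<in> f ` R. a < f (pick R k)} = f ` {a \<in> R. a < pick R k}"
    using strict_mono_on_less[OF f _ in_R] by auto
  also have "card \<dots> = card {a \<in> R. a < pick R k}"
    by (intro card_image inj_on_subset[OF inj]) auto
  also have "\<dots> = k" by (rule card_pick_le[OF k])
  finally show ?thesis
    using pick_card_in_set[of "f (pick R k)" "f ` R"] in_R by simp
qed

lemma prod_indet: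
  fixes s :: nat
  shows
  "(\<Prod>k<s. indet (v k)) = (Poly_Mapping.single (\<Sum>k<s. Poly_Mapping.single (v k) 1) 1 :: ('v, 'k::field) mpol)"
  by (induction s) (simp_all add: indet_def mult_single)

text \<open>For each row in \<open>R\<close> the column holding its prescribed variable is chosen.
  Different rows have disjoint blocks, so the submatrix is diagonal and its determinant is the
  product itself, with no sign.\<close>

lemma prod_indet_in_minors:
  assumes R: "R \<subseteq> {..<n}" "card R = t" and j: "\<And>i. i \<in> R \<Longrightarrow> j i \<in> {1..b (Suc i)}"
  shows "(\<Prod>k<t. indet (Suc (pick R k), j (pick R k))) \<in> minors t (Dmat n b :: (nat \<times> nat, 'k::field) mpol mat)"
proof -
  let ?D = "Dmat n b :: (nat \<times> nat, 'k) mpol mat"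
  define off where "off i = (\<Sum>l=1..i. b l)" for i
  \<comment> \<open>The block of matrix row \<open>i\<close> starts at column \<open>off i\<close>,
    and \<open>j i\<close> counts from 1, whence the subtraction of 1.\<close>
  define f where "f i = off i + j i - 1" for i
  have f_bounds: "off i \<le> f i" "f i < off i + b (Suc i)" "f i - off i + 1 = j i" if "i \<in> R" for i
    using j[OF that] by (auto simp: f_def)
  have off: "off i + b (Suc i) \<le> off i'" if "i < i'" for i i'
    unfolding off_def using that by (rule block_offset_mono)
  have mono: "strict_mono_on R f"
  proof (rule strict_mono_onI)
    fix i i' assume "i \<in> R" "i' \<in> R" "i < i'"
    with f_bounds(2)[of i] off[of i i'] f_bounds(1)[of i'] show "f i < f i'" by linarith
  qed
  have fin: "finite R" using R(1) finite_subset by blast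
  define C where "C = f ` R"
  have dim: "dim_row ?D = n" "dim_col ?D = off n" by (simp_all add: Dmat_def off_def)
  have "f i < off n" if "i \<in> R" for i
  proof -
    have "i < n" using R that by auto
    from f_bounds(2)[OF that] off[OF this] show ?thesis by linarith
  qed
  then have C: "C \<subseteq> {..<off n}" by (auto simp: C_def)
  have card_C: "card C = t"
    unfolding C_def using R(2) strict_mono_on_imp_inj_on[OF mono] by (simp add: card_image)
  let ?A = "submatrix ?D R C"
  have RC: "{i. i < n \<and> i \<in> R} = R" "{i. i < off n \<and> i \<in> C} = C" using R C by auto
  have A: "?A \<in> carrier_mat t t"
    by (rule carrier_matI) (simp_all add: dim_submatrix dim RC R card_C)
  have entry: "?A $$ (k, l) = (if k = l then indet (Suc (pick R k), j (pick R k)) else 0)"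
    if kl: "k < t" "l < t" for k l
  proof -
    have in_R: "pick R k \<in> R" "pick R l \<in> R" using pick_in_set_le R(2) kl by auto
    have C_l: "pick C l = f (pick R l)"
      unfolding C_def using pick_strict_mono_image[OF mono fin] R(2) kl by simp
    have C_lt: "f (pick R l) < off n" using C in_R by (auto simp: C_def)
    have "?A $$ (k, l) = ?D $$ (pick R k, pick C l)"
      by (rule submatrix_index) (use kl R RC dim card_C in simp_all)
    also have "\<dots> = (if off (pick R k) \<le> f (pick R l) \<and> f (pick R l) < off (pick R k) + b (Suc (pick R k))
        then indet (Suc (pick R k), f (pick R l) - off (pick R k) + 1) else 0)"
    proof -
      have "pick R k < n" using in_R R by auto
      then show ?thesis
        unfolding C_l using C_lt unfolding Dmat_def off_def by (simp add: Let_def)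
    qed
    also have "\<dots> = (if k = l then indet (Suc (pick R k), j (pick R k)) else 0)"
    proof (cases "k = l")
      case True
      then show ?thesis using f_bounds[OF in_R(1)] by simp
    next
      case False
      have "pick R k \<noteq> pick R l"
      proof
        assume eq: "pick R k = pick R l"
        have "k \<in> {..<card R}" "l \<in> {..<card R}" using kl R(2) by simp_all
        from inj_onD[OF inj_on_pick eq this] False show False by simp
      qed
      then consider "pick R k < pick R l" | "pick R l < pick R k" by linarith
      then have neg: "\<not> (off (pick R k) \<le> f (pick R l) \<and> f (pick R l) < off (pick R k) + b (Suc (pick R k)))"
      proof cases
        case 1
        from off[OF 1] f_bounds(1)[OF in_R(2)] show ?thesis by linarith
      next
        case 2
        from off[OF 2] f_bounds(2)[OF in_R(2)] show ?thesis by linarith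
      qed
      show ?thesis unfolding if_not_P[OF neg] using False by simp
    qed
    finally show ?thesis .
  qed
  have "det ?A = prod_list (diag_mat ?A)"
  proof (rule det_upper_triangular[OF _ A])
    have "?A $$ (k, l) = 0" if "l < k" "k < t" for k l
      using entry[of k l] that by simp
    then show "upper_triangular ?A"
      unfolding upper_triangular_def carrier_matD(1)[OF A] by blast
  qed
  also have "\<dots> = (\<Prod>k<t. ?A $$ (k, k))"
    using carrier_matD(1)[OF A] by (simp only: prod_list_diag_prod atLeast0LessThan)
  also have "\<dots> = (\<Prod>k<t. indet (Suc (pick R k), j (pick R k)))"
    by (rule prod.cong) (simp_all add: entry)
  finally have det: "det ?A = (\<Prod>k<t. indet (Suc (pick R k), j (pick R k)))" .
  have "det ?A \<in> minors t ?D"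
    unfolding minors_def
    by (rule CollectI, rule exI[of _ R], rule exI[of _ C]) (use R C card_C dim in simp)
  then show ?thesis unfolding det .
qed

text \<open>For the inclusion into \<open>It_D\<close> one monomial at a time suffices: meeting
  \<open>t\<close> rows, it is divisible by a product of variables from \<open>t\<close> distinct
  rows, and that product is itself a minor.\<close>

lemma It_D_eq_transversal_ideal:
  "(It_D t n b :: (nat \<times> nat, 'k::field) mpol set) = transversal_ideal (yvars n b) n b t"
proof
  let ?S = "pring (yvars n b) :: (nat \<times> nat, 'k) mpol ring"
  let ?T = "transversal_ideal (yvars n b) n b t :: (nat \<times> nat, 'k) mpol set"
  show "It_D t n b \<subseteq> ?T"
    unfolding It_D_def genideal_def
  proof (rule Inter_lower, rule CollectI, intro conjI)
    show "ideal ?T ?S" by (rule ideal_transversal_ideal)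
    show "minors t (Dmat n b) \<subseteq> ?T" by (rule minors_subset_transversal_ideal)
  qed
  interpret S: cring ?S by (rule cring_pring)
  have sub: "minors t (Dmat n b) \<subseteq> carrier ?S"
    using minors_subset_transversal_ideal[of t n b, where 'k = 'k] by (auto simp: transversal_ideal_def)
  interpret I: ideal "It_D t n b" ?S
    unfolding It_D_def by (rule S.genideal_ideal[OF sub])
  have minor: "x \<in> It_D t n b" if "x \<in> minors t (Dmat n b)" for x :: "(nat \<times> nat, 'k) mpol"
    unfolding It_D_def by (rule subsetD[OF S.genideal_self[OF sub] that])
  have single: "Poly_Mapping.single m c \<in> It_D t n b"
    if m: "t \<le> card (hit_rows n b m)" "Poly_Mapping.keys m \<subseteq> yvars n b" for m and c :: 'k
  proof -
    obtain H where H: "H \<subseteq> hit_rows n b m" "card H = t"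
      using obtain_subset_with_card_n[OF m(1)] by blast
    \<comment> \<open>These are the rows as counted in the matrix; \<open>H\<close> consists of
      positive indices, so the truncated subtraction is injective on it.\<close>
    define R where "R = (\<lambda>i. i - 1) ` H"
    have H1: "H \<subseteq> {1..n}" using H(1) by (auto simp: hit_rows_def)
    have "inj_on (\<lambda>i. i - 1) H"
    proof (rule inj_onI)
      fix x y assume "x \<in> H" "y \<in> H" "x - 1 = y - 1"
      moreover from this have "1 \<le> x" "1 \<le> y" using H1 by auto
      ultimately show "x = y" by simp
    qed
    then have card_R: "card R = t" unfolding R_def using H(2) by (simp add: card_image)
    have R_hit: "Suc i \<in> hit_rows n b m" if i: "i \<in> R" for i
    proof -
      obtain h where h: "h \<in> H" "i = h - 1" using i by (auto simp: R_def)
      then have "Suc i = h" using H1 by auto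
      then show ?thesis using h(1) H(1) by blast
    qed
    have R: "R \<subseteq> {..<n}"
    proof
      fix i assume "i \<in> R"
      from R_hit[OF this] show "i \<in> {..<n}" by (simp add: hit_rows_def)
    qed
    have "\<exists>j. j \<in> {1..b (Suc i)} \<and> (Suc i, j) \<in> Poly_Mapping.keys m" if "i \<in> R" for i
      using R_hit[OF that] unfolding hit_rows_def by blast
    then obtain j where j: "\<And>i. i \<in> R \<Longrightarrow> j i \<in> {1..b (Suc i)}"
        "\<And>i. i \<in> R \<Longrightarrow> (Suc i, j i) \<in> Poly_Mapping.keys m" by metis
    define v where "v k = (Suc (pick R k), j (pick R k))" for k
    define s where "s = (\<Sum>k<t. Poly_Mapping.single (v k) (1::nat))"
    have v_keys: "v k \<in> Poly_Mapping.keys m" if "k < t" for k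
      using j(2) pick_in_set_le[of k R] that card_R by (simp add: v_def)
    have v_inj: "inj_on v {..<t}"
      using inj_on_pick[of R] card_R by (auto simp: inj_on_def v_def)
    \<comment> \<open>The variables \<open>v k\<close> are distinct, so \<open>s\<close> is
      square-free; its support lies in that of \<open>m\<close>, hence it divides
      \<open>m\<close>.\<close>
    have le: "Poly_Mapping.lookup s y \<le> Poly_Mapping.lookup m y" for y
    proof -
      have "Poly_Mapping.lookup s y = (\<Sum>k<t. if v k = y then 1 else 0)"
        unfolding s_def lookup_sum by (intro sum.cong) (auto simp: lookup_single when_def)
      also have "\<dots> = card {k \<in> {..<t}. v k = y}"
        by (simp add: sum.If_cases Int_def)
      also have "\<dots> \<le> Poly_Mapping.lookup m y"
      proof (cases "y \<in> v ` {..<t}")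
        case True
        then obtain k where k: "k < t" "y = v k" by auto
        then have "{k \<in> {..<t}. v k = y} = {k}" using v_inj by (auto simp: inj_on_def)
        moreover have "Poly_Mapping.lookup m y \<noteq> 0" using v_keys[OF k(1)] k(2) by (simp add: in_keys_iff)
        ultimately show ?thesis by simp
      next
        case False
        then have none: "{k \<in> {..<t}. v k = y} = {}" by auto
        show ?thesis unfolding none by simp
      qed
      finally show ?thesis .
    qed
    have m_eq: "(m - s) + s = m"
      by (rule poly_mapping_eqI) (simp add: lookup_add lookup_minus le)
    have "Poly_Mapping.keys (m - s) \<subseteq> Poly_Mapping.keys m"
      using keys_plus_nat[of "m - s" s] unfolding m_eq by blast
    with m(2) have "Poly_Mapping.keys (m - s) \<subseteq> yvars n b" by (rule order_trans[rotated])
    then have rest: "Poly_Mapping.single (m - s) c \<in> carrier ?S" by (rule pring_single)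
    have "Poly_Mapping.single m c = Poly_Mapping.single (m - s) c * (\<Prod>k<t. indet (v k))"
      unfolding prod_indet s_def[symmetric] mult_single m_eq by simp
    moreover have "(\<Prod>k<t. indet (v k)) \<in> (It_D t n b :: (nat \<times> nat, 'k) mpol set)"
      unfolding v_def by (rule minor[OF prod_indet_in_minors[where j = j and b = b, OF R card_R j(1)]])
    ultimately show ?thesis using I.I_l_closed[OF _ rest] by simp
  qed
  show "?T \<subseteq> It_D t n b"
  proof
    fix p assume p: "p \<in> ?T"
    have "(\<Sum>m\<in>A. Poly_Mapping.single m (Poly_Mapping.lookup p m)) \<in> It_D t n b"
      if "A \<subseteq> Poly_Mapping.keys p" for A
      using finite_subset[OF that finite_keys] that
    proof (induction A rule: finite_induct)
      case empty
      then show ?case using I.zero_closed by simp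
    next
      case (insert m A)
      then have "Poly_Mapping.single m (Poly_Mapping.lookup p m) \<in> It_D t n b"
        using p by (intro single) (auto simp: transversal_ideal_def carrier_pring)
      with insert show ?case using I.a_closed by simp
    qed
    from this[OF order_refl] show "p \<in> It_D t n b" by (simp add: sum_single_lookup)
  qed
qed

theorem proposition2p4:
  fixes n t :: nat and b :: "nat \<Rightarrow> nat"
    and I :: "(nat \<times> nat, 'k::field) mpol set"
  assumes "n \<ge> 1" and "\<And>i. 1 \<le> i \<Longrightarrow> i \<le> n \<Longrightarrow> b i \<ge> 1" and "1 \<le> t" and "t \<le> n"
    and I: "I = It_D t n b"
  shows "(\<forall>q. betti (yvars n b) I q =
            (\<Sum>s=t..min (t + q) n. ((s - 1) choose (t - 1)) *
               (\<Sum>xs\<in>increasing_tuples n s. \<Sum>rs\<in>compositions s (t + q).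
                  \<Prod>u<s. b (xs ! u) choose (rs ! u)))) \<and>
         (\<forall>c. (\<forall>i\<in>{1..n}. b i = c) \<longrightarrow>
            (\<forall>q. betti (yvars n b) I q =
               (\<Sum>s=t..t + q. ((s - 1) choose (t - 1)) * (n choose s) *
                  (\<Sum>rs\<in>compositions s (t + q). \<Prod>u<s. c choose (rs ! u))))) \<and>
         ((\<forall>i\<in>{1..n}. b i = 2) \<longrightarrow>
            (\<forall>q. betti (yvars n b) I q =
               (\<Sum>s=t..t + q. ((s - 1) choose (t - 1)) * (n choose s) *
                  (s choose (t + q - s)) * 2 ^ (2 * s - (t + q)))))"
proof (intro conjI allI impI)
  have main: "betti (yvars n b) I q =
      (\<Sum>s=t..min (t + q) n. ((s - 1) choose (t - 1)) *
        (\<Sum>xs\<in>increasing_tuples n s. \<Sum>rs\<in>compositions s (t + q). \<Prod>u<s. b (xs ! u) choose (rs ! u)))" for q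
    unfolding I It_D_eq_transversal_ideal by (rule betti_transversal_ideal[OF \<open>1 \<le> t\<close>])
  then show "betti (yvars n b) I q =
      (\<Sum>s=t..min (t + q) n. ((s - 1) choose (t - 1)) *
        (\<Sum>xs\<in>increasing_tuples n s. \<Sum>rs\<in>compositions s (t + q). \<Prod>u<s. b (xs ! u) choose (rs ! u)))" for q .
  have const: "betti (yvars n b) I q =
      (\<Sum>s=t..t + q. ((s - 1) choose (t - 1)) * (n choose s) *
        (\<Sum>rs\<in>compositions s (t + q). \<Prod>u<s. c choose (rs ! u)))"
    if c: "\<forall>i\<in>{1..n}. b i = c" for c q
  proof -
    have bc: "b (xs ! u) = c" if xs: "xs \<in> increasing_tuples n s" "u < s" for xs s u
    proof -
      have "xs ! u \<in> set xs" "set xs \<subseteq> {1..n}"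
        using xs by (auto simp: increasing_tuples_def)
      then show ?thesis using c by blast
    qed
    have "betti (yvars n b) I q = (\<Sum>s=t..min (t + q) n. ((s - 1) choose (t - 1)) *
        (\<Sum>xs\<in>increasing_tuples n s. \<Sum>rs\<in>compositions s (t + q). \<Prod>u<s. c choose (rs ! u)))"
      unfolding main using bc by (intro sum.cong refl arg_cong2[of _ _ _ _ "(*)"] prod.cong) auto
    \<comment> \<open>The summand no longer depends on the tuple \<open>xs\<close>, so the sum over
      tuples contributes their number \<open>n choose s\<close>.\<close>
    also have "\<dots> = (\<Sum>s=t..min (t + q) n. ((s - 1) choose (t - 1)) * (n choose s) *
        (\<Sum>rs\<in>compositions s (t + q). \<Prod>u<s. c choose (rs ! u)))"
      by (simp add: card_increasing_tuples mult.assoc)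
    \<comment> \<open>The range extends beyond \<open>n\<close>, where \<open>n choose s\<close> is
      zero.\<close>
    also have "\<dots> = (\<Sum>s=t..t + q. ((s - 1) choose (t - 1)) * (n choose s) *
        (\<Sum>rs\<in>compositions s (t + q). \<Prod>u<s. c choose (rs ! u)))"
      by (rule sum.mono_neutral_left) auto
    finally show ?thesis .
  qed
  show "betti (yvars n b) I q =
      (\<Sum>s=t..t + q. ((s - 1) choose (t - 1)) * (n choose s) *
        (\<Sum>rs\<in>compositions s (t + q). \<Prod>u<s. c choose (rs ! u)))"
    if "\<forall>i\<in>{1..n}. b i = c" for c q
    using that by (rule const)
  show "betti (yvars n b) I q =
      (\<Sum>s=t..t + q. ((s - 1) choose (t - 1)) * (n choose s) *
        (s choose (t + q - s)) * 2 ^ (2 * s - (t + q)))"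
    if "\<forall>i\<in>{1..n}. b i = 2" for q
    unfolding const[OF that]
    by (rule sum.cong) (simp_all add: sum_compositions_choose_2)
qed

end
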